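(* Fix Hodge polygon data $\mathbf k=(\mathbf k^{(i)})_{i\in\mathbb{Z}/f\mathbb{Z}}$, $\mathbf k^{(i)}=(k_{i1}\ge k_{i2}\ge\dots\ge k_{id})$. The assignment sending $(A)=(A^{(0)},\dots,A^{(f-1)})\in\mathrm{GL}_d(\mathscr O_F)^f$ to the strongly divisible lattice $L=\prod_iL^{(i)}$ which has $\mathscr O_F$-bases $\{e_1^{(i)},\dots,e_d^{(i)}\}$ of $L^{(i)}$ adapted to the filtration, in which $\varphi_L^{(i)}(e_1^{(i-1)},\dots,e_d^{(i-1)})=(e_1^{(i)},\dots,e_d^{(i)})A^{(i)}\Delta_{\mathbf k^{(i-1)}}$, induces a bijection \[\Theta:\mathrm{GL}_d(\mathscr O_F)^f/\!\sim_{\mathbf k}\ \longrightarrow\ \{\text{isomorphism classes of strongly divisible lattices with Hodge polygon data }\mathbf k\}.\]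
   Context: $K=\mathbb{Q}_{p^f}$ with ring of integers $\mathscr O_K$, $F/\mathbb{Q}_p$ finite with ring of integers $\mathscr O_F$ and a fixed embedding $\tau_0:K\hookrightarrow F$; $\tau_i=\tau_0\circ\sigma_K^{-i}$ and $\mathscr O_F\otimes_{\mathbb{Z}_p}\mathscr O_K\cong\prod_{i\in\mathbb{Z}/f\mathbb{Z}}\mathscr O_F$ via $x\otimes y\mapsto(x\tau_i(y))_i$, with idempotents $\mathfrak e_i$. For a weakly admissible filtered $\varphi$-module $D$ over $F\otimes_{\mathbb{Q}_p}K$, a $\varphi$-lattice is an $\mathscr O_F\otimes\mathscr O_K$-submodule $L$ spanning $D$ with $\varphi(L)\subseteq L$, given the induced filtration $\mathrm{Fil}^jL=\mathrm{Fil}^jD\cap L$; it decomposes as $L=\prod_iL^{(i)}$, $L^{(i)}=\mathfrak e_iL$, with $\mathscr O_F$-linear partial Frobenii $\varphi^{(i)}:L^{(i-1)}\to L^{(i)}$. $L$ is strongly divisible if $\varphi(\mathrm{Fil}^jL)\subseteq p^jL$ for all $j$ and $\sum_jp^{-j}\varphi(\mathrm{Fil}^jL)=L$. $D$ (and $L$) has Hodge polygon data $\mathbf k$ if the filtration jumps of $D^{(i)}$ are $k_{i1}\ge\dots\ge k_{id}$ with multiplicity. A basis $\{e_1^{(i)},\dots,e_d^{(i)}\}$ of $L^{(i)}$ is adapted to the filtration if for every $j$, $\{e_1^{(i)},\dots,e_{\dim\mathrm{Fil}^jL^{(i)}}^{(i)}\}$ is a basis of $\mathrm{Fil}^jL^{(i)}$.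 Isomorphisms of strongly divisible lattices are $\mathscr O_F\otimes\mathscr O_K$-linear bijections compatible with $\varphi$ and filtrations. $\Delta_{\mathbf k^{(i)}}=\mathrm{Diag}(p^{k_{i1}},\dots,p^{k_{id}})$. With $r_{ij}=\dim_F\mathrm{Fil}^{k_{ij}}D^{(i)}$, the parabolic group $\mathscr P_{\mathbf k^{(i)}}(\mathscr O_F)\subset\mathrm{GL}_d(\mathscr O_F)$ consists of block upper-triangular matrices with invertible diagonal blocks in $\mathrm{GL}_{r_{i1}}(\mathscr O_F),\mathrm{GL}_{r_{i2}-r_{i1}}(\mathscr O_F),\dots,\mathrm{GL}_{d-r_{i(d-1)}}(\mathscr O_F)$ and arbitrary $\mathscr O_F$-entries above; $\mathscr P_{\mathbf k}=\prod_i\mathscr P_{\mathbf k^{(i)}}$. $(A)\sim_{\mathbf k}(B)$ iff there is $(C^{(i)})\in\mathscr P_{\mathbf k}(\mathscr O_F)$ with $B^{(i)}=C^{(i)}A^{(i)}\Delta_{\mathbf k^{(i-1)}}(C^{(i-1)})^{-1}\Delta_{\mathbf k^{(i-1)}}^{-1}$ for all $i$.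
   Formalization: Formally all k_ij ≥ 0 (a negative k_ij allows no lattice with φ(L)⊆L, yet GL_d(O_F)^f is nonempty) and lattices are finitely generated (else L=D qualifies but has no O_F-basis); all lattices are taken inside one fixed underlying group of F-dimension df. *)

theory Defs
  imports
    Complex_Main
    "HOL-Library.FuncSet"
    "HOL-Computational_Algebra.Primes"
    "Jordan_Normal_Form.Matrix"
    "Jordan_Normal_Form.Determinant"
    "Jordan_Normal_Form.Gauss_Jordan_Elimination"
begin

section \<open>The fields\<close>

definition padic_abs :: "nat \<Rightarrow> rat \<Rightarrow> real" where
  "padic_abs p x =
     (if x = 0 then 0
      else real p powi (int (multiplicity (int p) (snd (quotient_of x)))
                        - int (multiplicity (int p) (fst (quotient_of x)))))"

definition nonarch_abs :: "('x::field \<Rightarrow> real) \<Rightarrow> bool" where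
  "nonarch_abs v \<longleftrightarrow>
     (\<forall>x. 0 \<le> v x) \<and> (\<forall>x. v x = 0 \<longleftrightarrow> x = 0) \<and>
     (\<forall>x y. v (x * y) = v x * v y) \<and> (\<forall>x y. v (x + y) \<le> max (v x) (v y))"

text \<open>The type \<open>'q\<close> with the absolute value \<open>v\<close> is the field of \<open>p\<close>-adic numbers,
  i.e. the completion of the rationals with respect to the \<open>p\<close>-adic absolute value.\<close>

definition is_padic_field :: "nat \<Rightarrow> ('q::field_char_0 \<Rightarrow> real) \<Rightarrow> bool" where
  "is_padic_field p v \<longleftrightarrow>
     prime p \<and> nonarch_abs v \<and>
     (\<forall>r. v (of_rat r) = padic_abs p r) \<and>
     (\<forall>x. \<forall>\<epsilon>>0. \<exists>r. v (x - of_rat r) < \<epsilon>) \<and>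
     (\<forall>X::nat \<Rightarrow> 'q. (\<forall>\<epsilon>>0. \<exists>N. \<forall>m\<ge>N. \<forall>n\<ge>N. v (X m - X n) < \<epsilon>) \<longrightarrow>
        (\<exists>l. \<forall>\<epsilon>>0. \<exists>N. \<forall>n\<ge>N. v (X n - l) < \<epsilon>))"

text \<open>The types \<open>'q\<close>, \<open>'a\<close>, \<open>'k\<close> are the \<open>p\<close>-adic numbers, \<open>F\<close> and \<open>K\<close>.
  \<open>F\<close> and \<open>K\<close> are given with their structure maps from the \<open>p\<close>-adic numbers and with the
  (unique) extensions of the \<open>p\<close>-adic absolute value; \<open>emb0\<close> is \<open>\<tau>\<^sub>0\<close> and \<open>frob\<close> is
  \<open>\<sigma>\<^sub>K\<close>.\<close>

record ('q, 'a, 'k) coeff_data =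
  char_p :: nat
  res_deg :: nat
  absQ :: "'q \<Rightarrow> real"
  absF :: "'a \<Rightarrow> real"
  absK :: "'k \<Rightarrow> real"
  inclF :: "'q \<Rightarrow> 'a"
  inclK :: "'q \<Rightarrow> 'k"
  emb0 :: "'k \<Rightarrow> 'a"
  frob :: "'k \<Rightarrow> 'k"

definition ringF :: "('q, 'a, 'k) coeff_data \<Rightarrow> 'a set" where
  "ringF S = {x. absF S x \<le> 1}"

definition ringK :: "('q, 'a, 'k) coeff_data \<Rightarrow> 'k set" where
  "ringK S = {x. absK S x \<le> 1}"

definition residue_field_K :: "('q, 'a, 'k::field) coeff_data \<Rightarrow> 'k set set" where
  "residue_field_K S = ringK S // {(x, y). x \<in> ringK S \<and> y \<in> ringK S \<and> absK S (x - y) < 1}"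

text \<open>\<open>K\<close> is the unramified extension of degree \<open>f\<close>: its degree \<open>f\<close> equals its residue degree,
  i.e. its residue field has \<open>p ^ f\<close> elements.\<close>

definition coeff_datum :: "('q::field_char_0, 'a::field, 'k::field) coeff_data \<Rightarrow> bool" where
  "coeff_datum S \<longleftrightarrow>
     is_padic_field (char_p S) (absQ S) \<and>
     field_hom (inclF S) \<and>
     (\<exists>B. finite B \<and> Modules.module.span (\<lambda>q x. inclF S q * x) B = UNIV) \<and>
     nonarch_abs (absF S) \<and> (\<forall>q. absF S (inclF S q) = absQ S q) \<and>
     field_hom (inclK S) \<and>
     res_deg S > 0 \<and> Vector_Spaces.vector_space.dim (\<lambda>q x. inclK S q * x) (UNIV :: 'k set) = res_deg S \<and>
     nonarch_abs (absK S) \<and> (\<forall>q. absK S (inclK S q) = absQ S q) \<and>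
     card (residue_field_K S) = char_p S ^ res_deg S \<and>
     field_hom (emb0 S) \<and> (\<forall>q. emb0 S (inclK S q) = inclF S q) \<and>
     field_hom (frob S) \<and> bij (frob S) \<and> (\<forall>q. frob S (inclK S q) = inclK S q) \<and>
     (\<forall>x\<in>ringK S. absK S (frob S x - x ^ char_p S) < 1)"

definition ordF :: "('q, 'a, 'k) coeff_data \<Rightarrow> 'a \<Rightarrow> real" where
  "ordF S x = - log (real (char_p S)) (absF S x)"

definition emb :: "('q, 'a, 'k) coeff_data \<Rightarrow> nat \<Rightarrow> 'k \<Rightarrow> 'a" where
  "emb S i = emb0 S \<circ> (inv_into UNIV (frob S) ^^ i)"

text \<open>Elements of \<open>\<int>/f\<int>\<close> are represented by \<open>0, \<dots>, f - 1\<close>.\<close>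

definition prev :: "('q, 'a, 'k) coeff_data \<Rightarrow> nat \<Rightarrow> nat" where
  "prev S i = (i + res_deg S - 1) mod res_deg S"


section \<open>Filtered \<open>\<phi>\<close>-modules\<close>

text \<open>A module over the tensor product of \<open>F\<close> and \<open>K\<close> over the \<open>p\<close>-adic numbers is an abelian
  group with commuting actions of \<open>F\<close> and \<open>K\<close> that agree on the \<open>p\<close>-adic numbers. Its
  submodules are the subgroups stable under both actions; likewise for the rings of integers.\<close>

record ('a, 'k, 'v) fil_phi_module =
  sF :: "'a \<Rightarrow> 'v \<Rightarrow> 'v"
  sK :: "'k \<Rightarrow> 'v \<Rightarrow> 'v"
  phi :: "'v \<Rightarrow> 'v"
  Fil :: "int \<Rightarrow> 'v set"

definition submod ::
  "('a, 'k, 'v::ab_group_add) fil_phi_module \<Rightarrow> 'a set \<Rightarrow> 'k set \<Rightarrow> 'v set \<Rightarrow> bool" where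
  "submod D R R' M \<longleftrightarrow>
     0 \<in> M \<and> (\<forall>x\<in>M. \<forall>y\<in>M. x + y \<in> M) \<and> (\<forall>x\<in>M. - x \<in> M) \<and>
     (\<forall>a\<in>R. \<forall>x\<in>M. sF D a x \<in> M) \<and> (\<forall>b\<in>R'. \<forall>x\<in>M. sK D b x \<in> M)"

definition filtered_phi_module ::
  "('q, 'a::field, 'k::field) coeff_data \<Rightarrow> ('a, 'k, 'v::ab_group_add) fil_phi_module \<Rightarrow> bool" where
  "filtered_phi_module S D \<longleftrightarrow>
     Vector_Spaces.vector_space (sF D) \<and> Vector_Spaces.vector_space (sK D) \<and>
     (\<forall>a b x. sF D a (sK D b x) = sK D b (sF D a x)) \<and>
     (\<forall>q x. sF D (inclF S q) x = sK D (inclK S q) x) \<and>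
     (\<exists>B. finite B \<and> Modules.module.span (sF D) B = UNIV) \<and>
     Vector_Spaces.linear (sF D) (sF D) (phi D) \<and>
     (\<forall>b x. phi D (sK D b x) = sK D (frob S b) (phi D x)) \<and>
     bij (phi D) \<and>
     (\<forall>j. submod D UNIV UNIV (Fil D j)) \<and>
     (\<forall>j. Fil D (j + 1) \<subseteq> Fil D j) \<and>
     (\<exists>j. Fil D j = UNIV) \<and> (\<exists>j. Fil D j = {0})"

definition hodge_number ::
  "('a::field, 'k, 'v::ab_group_add) fil_phi_module \<Rightarrow> 'v set \<Rightarrow> int" where
  "hodge_number D W =
     (\<Sum>j | Fil D j \<inter> W \<noteq> Fil D (j + 1) \<inter> W.
        j * (int (Vector_Spaces.vector_space.dim (sF D) (Fil D j \<inter> W))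
             - int (Vector_Spaces.vector_space.dim (sF D) (Fil D (j + 1) \<inter> W))))"

text \<open>\<open>R\<close> is a subring of \<open>F\<close>.\<close>

definition is_basis ::
  "('a::field, 'k, 'v::ab_group_add) fil_phi_module \<Rightarrow> 'a set \<Rightarrow> 'v set \<Rightarrow> nat \<Rightarrow> (nat \<Rightarrow> 'v) \<Rightarrow> bool"
  where
  "is_basis D R M n b \<longleftrightarrow>
     M = {(\<Sum>l<n. sF D (c l) (b l)) | c. c ` {..<n} \<subseteq> R} \<and>
     (\<forall>c. c ` {..<n} \<subseteq> R \<longrightarrow> (\<Sum>l<n. sF D (c l) (b l)) = 0 \<longrightarrow> (\<forall>l<n. c l = 0))"

text \<open>The determinant of \<open>\<phi>\<close>, as an \<open>F\<close>-linear endomorphism of the \<open>\<phi>\<close>-stable subspace \<open>W\<close>.\<close>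

definition det_phi :: "('a::field, 'k, 'v::ab_group_add) fil_phi_module \<Rightarrow> 'v set \<Rightarrow> 'a" where
  "det_phi D W =
     (THE \<delta>. \<exists>n b M. is_basis D UNIV W n b \<and> M \<in> carrier_mat n n \<and>
        (\<forall>m<n. phi D (b m) = (\<Sum>l<n. sF D (M $$ (l, m)) (b l))) \<and> \<delta> = det M)"

text \<open>\<open>hodge_number\<close> and \<open>newton_number\<close> are both normalised with respect to \<open>F\<close>; they are
  Fontaine's numbers for the underlying filtered module over \<open>K\<close> multiplied by
  \<open>f / [F : \<rat>\<^sub>p]\<close>.\<close>

definition newton_number ::
  "('q, 'a::field, 'k) coeff_data \<Rightarrow> ('a, 'k, 'v::ab_group_add) fil_phi_module \<Rightarrow> 'v set \<Rightarrow> real" where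
  "newton_number S D W = ordF S (det_phi D W)"

definition weakly_admissible ::
  "('q, 'a::field, 'k::field) coeff_data \<Rightarrow> ('a, 'k, 'v::ab_group_add) fil_phi_module \<Rightarrow> bool" where
  "weakly_admissible S D \<longleftrightarrow>
     filtered_phi_module S D \<and>
     real_of_int (hodge_number D UNIV) = newton_number S D UNIV \<and>
     (\<forall>W. submod D UNIV UNIV W \<longrightarrow> phi D ` W \<subseteq> W \<longrightarrow>
        real_of_int (hodge_number D W) \<le> newton_number S D W)"


section \<open>Idempotents and components\<close>

text \<open>A list of pairs \<open>(x, y)\<close> represents the tensor \<open>\<Sum> x \<otimes> y\<close>.
  The idempotent \<open>\<ee>\<^sub>i\<close> is the element of the tensor product of the rings of integers whose image
  under \<open>x \<otimes> y \<mapsto> (x \<tau>\<^sub>l(y))\<^sub>l\<close> is the \<open>i\<close>-th unit vector; since that map is an isomorphism, the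
  action of \<open>\<ee>\<^sub>i\<close> does not depend on the representing list.\<close>

definition tensor_act ::
  "('a, 'k, 'v::ab_group_add) fil_phi_module \<Rightarrow> ('a \<times> 'k) list \<Rightarrow> 'v \<Rightarrow> 'v" where
  "tensor_act D t v = (\<Sum>(x, y)\<leftarrow>t. sF D x (sK D y v))"

definition idem :: "('q, 'a::field, 'k) coeff_data \<Rightarrow> nat \<Rightarrow> ('a \<times> 'k) list" where
  "idem S i = (SOME t. set t \<subseteq> ringF S \<times> ringK S \<and>
     (\<forall>l<res_deg S. (\<Sum>(x, y)\<leftarrow>t. x * emb S l y) = (if l = i then 1 else 0)))"

definition component ::
  "('q, 'a::field, 'k) coeff_data \<Rightarrow> ('a, 'k, 'v::ab_group_add) fil_phi_module \<Rightarrow> nat \<Rightarrow> 'v set \<Rightarrow> 'v set"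
  where
  "component S D i M = tensor_act D (idem S i) ` M"


section \<open>Strongly divisible lattices\<close>

definition phi_lattice ::
  "('q, 'a::field, 'k::field) coeff_data \<Rightarrow> ('a, 'k, 'v::ab_group_add) fil_phi_module \<Rightarrow> 'v set \<Rightarrow> bool"
  where
  "phi_lattice S D L \<longleftrightarrow>
     submod D (ringF S) (ringK S) L \<and>
     (\<exists>B. finite B \<and> L = submod D (ringF S) (ringK S) hull B) \<and>
     submod D UNIV UNIV hull L = UNIV \<and>
     phi D ` L \<subseteq> L"

definition FilL :: "('a, 'k, 'v) fil_phi_module \<Rightarrow> 'v set \<Rightarrow> int \<Rightarrow> 'v set" where
  "FilL D L j = Fil D j \<inter> L"

definition scale_p ::
  "('q, 'a::field, 'k) coeff_data \<Rightarrow> ('a, 'k, 'v) fil_phi_module \<Rightarrow> int \<Rightarrow> 'v \<Rightarrow> 'v" where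
  "scale_p S D j = sF D (of_nat (char_p S) powi j)"

definition strongly_divisible ::
  "('q, 'a::field, 'k::field) coeff_data \<Rightarrow> ('a, 'k, 'v::ab_group_add) fil_phi_module \<Rightarrow> 'v set \<Rightarrow> bool"
  where
  "strongly_divisible S D L \<longleftrightarrow>
     weakly_admissible S D \<and> phi_lattice S D L \<and>
     (\<forall>j. phi D ` FilL D L j \<subseteq> scale_p S D j ` L) \<and>
     {(\<Sum>j\<in>J. scale_p S D (- j) (phi D (x j))) | J x. finite J \<and> (\<forall>j\<in>J. x j \<in> FilL D L j)} = L"

text \<open>Positions \<open>1, \<dots>, d\<close> are numbered \<open>0, \<dots>, d - 1\<close> throughout.\<close>

definition has_hodge_data ::
  "('q, 'a::field, 'k) coeff_data \<Rightarrow> nat \<Rightarrow> (nat \<Rightarrow> nat \<Rightarrow> int) \<Rightarrow>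
   ('a, 'k, 'v::ab_group_add) fil_phi_module \<Rightarrow> bool" where
  "has_hodge_data S d k D \<longleftrightarrow>
     (\<forall>i<res_deg S. \<forall>j.
        int (Vector_Spaces.vector_space.dim (sF D) (component S D i (Fil D j)))
        - int (Vector_Spaces.vector_space.dim (sF D) (component S D i (Fil D (j + 1))))
        = int (card {m. m < d \<and> k i m = j}))"

definition SDL ::
  "('q, 'a::field, 'k::field) coeff_data \<Rightarrow> nat \<Rightarrow> (nat \<Rightarrow> nat \<Rightarrow> int) \<Rightarrow>
   (('a, 'k, 'v::ab_group_add) fil_phi_module \<times> 'v set) set" where
  "SDL S d k = {(D, L). strongly_divisible S D L \<and> has_hodge_data S d k D}"

definition lattice_iso ::
  "('q, 'a, 'k) coeff_data \<Rightarrow> ('a, 'k, 'v::ab_group_add) fil_phi_module \<times> 'v set \<Rightarrow>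
   ('a, 'k, 'v) fil_phi_module \<times> 'v set \<Rightarrow> ('v \<Rightarrow> 'v) \<Rightarrow> bool" where
  "lattice_iso S = (\<lambda>(D, L) (D', L') h.
     bij_betw h L L' \<and>
     (\<forall>x\<in>L. \<forall>y\<in>L. h (x + y) = h x + h y) \<and>
     (\<forall>a\<in>ringF S. \<forall>x\<in>L. h (sF D a x) = sF D' a (h x)) \<and>
     (\<forall>b\<in>ringK S. \<forall>x\<in>L. h (sK D b x) = sK D' b (h x)) \<and>
     (\<forall>x\<in>L. h (phi D x) = phi D' (h x)) \<and>
     (\<forall>j. h ` FilL D L j = FilL D' L' j))"

definition iso_rel ::
  "('q, 'a::field, 'k::field) coeff_data \<Rightarrow> nat \<Rightarrow> (nat \<Rightarrow> nat \<Rightarrow> int) \<Rightarrow>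
   ((('a, 'k, 'v::ab_group_add) fil_phi_module \<times> 'v set) \<times>
    (('a, 'k, 'v) fil_phi_module \<times> 'v set)) set" where
  "iso_rel S d k = {(X, Y). X \<in> SDL S d k \<and> Y \<in> SDL S d k \<and> (\<exists>h. lattice_iso S X Y h)}"

text \<open>\<open>vector_space.dim\<close> of a set is the dimension of its span, so on a sublattice it is the rank
  over the ring of integers of \<open>F\<close>.\<close>

definition adapted_basis ::
  "('q, 'a::field, 'k) coeff_data \<Rightarrow> nat \<Rightarrow> ('a, 'k, 'v::ab_group_add) fil_phi_module \<Rightarrow> 'v set \<Rightarrow>
   nat \<Rightarrow> (nat \<Rightarrow> 'v) \<Rightarrow> bool" where
  "adapted_basis S d D L i e \<longleftrightarrow>
     is_basis D (ringF S) (component S D i L) d e \<and>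
     (\<forall>j. is_basis D (ringF S) (component S D i (FilL D L j))
            (Vector_Spaces.vector_space.dim (sF D) (component S D i (FilL D L j))) e)"


section \<open>Matrices\<close>

definition GLO :: "('q, 'a::field, 'k) coeff_data \<Rightarrow> nat \<Rightarrow> 'a mat set" where
  "GLO S n = {A \<in> carrier_mat n n. elements_mat A \<subseteq> ringF S \<and>
     (\<exists>B \<in> carrier_mat n n. elements_mat B \<subseteq> ringF S \<and> A * B = 1\<^sub>m n \<and> B * A = 1\<^sub>m n)}"

definition GLO_tuples :: "('q, 'a::field, 'k) coeff_data \<Rightarrow> nat \<Rightarrow> (nat \<Rightarrow> 'a mat) set" where
  "GLO_tuples S d = ({..<res_deg S} \<rightarrow>\<^sub>E GLO S d)"

abbreviation minv :: "'a::field mat \<Rightarrow> 'a mat" where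
  "minv A \<equiv> the (mat_inverse A)"

definition Delta :: "('q, 'a::field, 'k) coeff_data \<Rightarrow> nat \<Rightarrow> (nat \<Rightarrow> int) \<Rightarrow> 'a mat" where
  "Delta S d ki = mat_diag d (\<lambda>m. of_nat (char_p S) powi ki m)"

text \<open>\<open>block_bound d ki j\<close> is \<open>r\<^sub>i\<^sub>j\<close>, with \<open>r\<^sub>i\<^sub>0 = 0\<close>: for \<open>j \<ge> 1\<close> it is the dimension of
  \<open>Fil\<close> in degree \<open>k\<^sub>i\<^sub>j\<close> on a component with jumps \<open>ki\<close>. The \<open>j\<close>-th diagonal block occupies
  the rows and columns from \<open>block_bound d ki j\<close> up to, but excluding,
  \<open>block_bound d ki (j + 1)\<close>; it is empty if \<open>k\<^sub>i\<^sub>j\<close> is repeated.\<close>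

definition block_bound :: "nat \<Rightarrow> (nat \<Rightarrow> int) \<Rightarrow> nat \<Rightarrow> nat" where
  "block_bound d ki j = (if j = 0 then 0 else card {m. m < d \<and> ki (j - 1) \<le> ki m})"

definition parabolic :: "('q, 'a::field, 'k) coeff_data \<Rightarrow> nat \<Rightarrow> (nat \<Rightarrow> int) \<Rightarrow> 'a mat set" where
  "parabolic S d ki = {C \<in> GLO S d.
     (\<forall>j\<le>d. \<forall>a<d. \<forall>b<d. block_bound d ki j \<le> a \<longrightarrow> b < block_bound d ki j \<longrightarrow> C $$ (a, b) = 0) \<and>
     (\<forall>j<d. let r = block_bound d ki j; n = block_bound d ki (j + 1) - r
        in mat n n (\<lambda>(a, b). C $$ (r + a, r + b)) \<in> GLO S n)}"

definition sim ::
  "('q, 'a::field, 'k) coeff_data \<Rightarrow> nat \<Rightarrow> (nat \<Rightarrow> nat \<Rightarrow> int) \<Rightarrow>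
   ((nat \<Rightarrow> 'a mat) \<times> (nat \<Rightarrow> 'a mat)) set" where
  "sim S d k = {(A, B). A \<in> GLO_tuples S d \<and> B \<in> GLO_tuples S d \<and>
     (\<exists>C. (\<forall>i<res_deg S. C i \<in> parabolic S d (k i)) \<and>
        (\<forall>i<res_deg S. B i =
           C i * A i * Delta S d (k (prev S i)) * minv (C (prev S i))
             * minv (Delta S d (k (prev S i)))))}"

definition presented_by ::
  "('q, 'a::field, 'k) coeff_data \<Rightarrow> nat \<Rightarrow> (nat \<Rightarrow> nat \<Rightarrow> int) \<Rightarrow> (nat \<Rightarrow> 'a mat) \<Rightarrow>
   ('a, 'k, 'v::ab_group_add) fil_phi_module \<times> 'v set \<Rightarrow> bool" where
  "presented_by S d k A = (\<lambda>(D, L). \<exists>e :: nat \<Rightarrow> nat \<Rightarrow> 'v.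
     (\<forall>i<res_deg S. adapted_basis S d D L i (e i)) \<and>
     (\<forall>i<res_deg S. \<forall>m<d.
        phi D (e (prev S i) m)
        = (\<Sum>l<d. sF D ((A i * Delta S d (k (prev S i))) $$ (l, m)) (e i l))))"

definition Theta ::
  "('q, 'a::field, 'k::field) coeff_data \<Rightarrow> nat \<Rightarrow> (nat \<Rightarrow> nat \<Rightarrow> int) \<Rightarrow> (nat \<Rightarrow> 'a mat) set \<Rightarrow>
   (('a, 'k, 'v::ab_group_add) fil_phi_module \<times> 'v set) set" where
  "Theta S d k T = {X \<in> SDL S d k. \<exists>A\<in>T. presented_by S d k A X}"

end

theory Submission
  imports Defs "HOL-Number_Theory.Cong"
begin

text \<open>
  The idempotents come from an element \<open>a\<close> of \<open>\<O>\<^sub>K\<close> whose conjugates \<open>\<tau>\<^sub>l(a)\<close> differ pairwise by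
  units: they are Lagrange interpolation polynomials evaluated at \<open>a\<close>. Hence a module splits into
  eigenspaces on which \<open>K\<close> acts through \<open>\<tau>\<^sub>i\<close>, and \<open>\<phi>\<close> permutes them cyclically.

  Over the valuation ring \<open>\<O>\<^sub>F\<close> a finitely generated lattice has a basis adapted to any flag: among the
  generators, one whose last coordinate has maximal absolute value clears that coordinate from all
  the others. In an adapted basis, strong divisibility says exactly that the matrix of \<open>\<phi>\<close> is
  \<open>A \<Delta>\<close> with \<open>A\<close> integral and surjective, hence in \<open>GL\<^sub>d(\<O>\<^sub>F)\<close>. Two adapted bases differ by a
  parabolic matrix, which is the relation \<open>\<sim>\<^sub>k\<close>, and a lattice is determined up to isomorphism by the
  matrices of \<open>\<phi>\<close>.

  Conversely, weak admissibility of the standard module attached to \<open>A\<close> follows by intersecting its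
  lattice with a \<open>\<phi>\<close>-stable subspace: in an adapted basis the matrix of \<open>\<phi>\<close> is an integral matrix times
  \<open>Diag(p\<^sup>\<kappa>)\<close>, so the Newton number is at least the Hodge number, with equality on the whole space.
\<close>

section \<open>Non-archimedean absolute values and families of vectors\<close>

text \<open>Integrality has to pass between \<open>K\<close> and \<open>F\<close>. A field
  homomorphism that is isometric on the p-adic numbers preserves it because the integers of
  \<open>K\<close> are finitely generated, and generators come from lifting the residue field by
  counting, without completing or factoring polynomials. Two hypotheses of the theorem reflect the
  objects. The jumps are nonnegative because a lattice satisfies \<phi>(L) \<subseteq> L: the
  matrices \<open>A i * \<Delta> i\<close> must be integral for the standard lattice to be stable,
  and for an isomorphism, which is linear only over the rings of integers, to be applied to the
  equation for \<phi>. All modules live on one type, so that type has to carry an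
  \<open>F\<close>-vector space of dimension \<open>f * d\<close>, on which the standard lattice is
  built. Strong divisibility contains weak admissibility. For the standard lattice the latter is
  therefore derived from the two divisibility conditions alone, in a locale that does not presuppose
  it.\<close>

locale nonarch_field =
  fixes v :: "'x::field \<Rightarrow> real"
  assumes nonarch: "nonarch_abs v"
begin

lemma nonneg [simp]: "0 \<le> v x"
  and eq_0_iff [simp]: "v x = 0 \<longleftrightarrow> x = 0"
  and mult: "v (x * y) = v x * v y"
  and add_le: "v (x + y) \<le> max (v x) (v y)"
  using nonarch by (auto simp: nonarch_abs_def)

lemma zero [simp]: "v 0 = 0"
  by simp

lemma pos_iff [simp]: "0 < v x \<longleftrightarrow> x \<noteq> 0"
  using nonneg[of x] eq_0_iff[of x] by linarith

lemma one [simp]: "v 1 = 1"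
  using mult[of 1 1] eq_0_iff[of 1] by simp

lemma minus [simp]: "v (- x) = v x"
proof -
  have "v (- 1) * v (- 1) = 1" using mult[of "- 1" "- 1"] by simp
  hence "(v (- 1) - 1) * (v (- 1) + 1) = 0" by (simp add: algebra_simps)
  hence "v (- 1) = 1" using nonneg[of "- 1"] by (auto simp: add_eq_0_iff)
  thus ?thesis using mult[of "- 1" x] by simp
qed

lemma diff_commute: "v (x - y) = v (y - x)"
  using minus[of "x - y"] by simp

lemma diff_le: "v (x - y) \<le> max (v x) (v y)"
  using add_le[of x "- y"] by simp

lemma power: "v (x ^ n) = v x ^ n"
  by (induction n) (auto simp: mult)

lemma inverse: "v (inverse x) = inverse (v x)"
proof (cases "x = 0")
  case False
  have "v x * v (inverse x) = 1" using mult[of x "inverse x"] False by simp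
  thus ?thesis using False by (simp add: field_simps)
qed simp

lemma divide: "v (x / y) = v x / v y"
  by (simp add: divide_inverse mult inverse)

lemma powi: "v (x powi n) = v x powi n"
  by (simp add: power_int_def power inverse)

lemma prod: "v (prod g A) = (\<Prod>x\<in>A. v (g x))"
  by (induction A rule: infinite_finite_induct) (auto simp: mult)

lemma sum_le: "(\<And>x. x \<in> A \<Longrightarrow> v (g x) \<le> C) \<Longrightarrow> 0 \<le> C \<Longrightarrow> v (sum g A) \<le> C"
proof (induction A rule: infinite_finite_induct)
  case (insert a A)
  thus ?case using add_le[of "g a" "sum g A"] by fastforce
qed auto

lemma sum_less: "(\<And>x. x \<in> A \<Longrightarrow> v (g x) < C) \<Longrightarrow> 0 < C \<Longrightarrow> v (sum g A) < C"
proof (induction A rule: infinite_finite_induct)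
  case (insert a A)
  thus ?case using add_le[of "g a" "sum g A"] by fastforce
qed auto

lemma of_nat_le_1: "v (of_nat n) \<le> 1"
  using sum_le[of "{..<n}" "\<lambda>_. 1" 1] by simp

lemma le_1_mult: "v x \<le> 1 \<Longrightarrow> v y \<le> 1 \<Longrightarrow> v (x * y) \<le> 1"
  by (simp add: mult mult_le_one)

lemma le_1_add: "v x \<le> 1 \<Longrightarrow> v y \<le> 1 \<Longrightarrow> v (x + y) \<le> 1"
  using add_le[of x y] by simp

lemma le_1_diff: "v x \<le> 1 \<Longrightarrow> v y \<le> 1 \<Longrightarrow> v (x - y) \<le> 1"
  using diff_le[of x y] by simp

lemma add_less: "v x < C \<Longrightarrow> v y < C \<Longrightarrow> v (x + y) < C"
  using add_le[of x y] by simp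

lemma diff_less: "v x < C \<Longrightarrow> v y < C \<Longrightarrow> v (x - y) < C"
  using diff_le[of x y] by simp

lemma le_1_power: "v x \<le> 1 \<Longrightarrow> v (x ^ n) \<le> 1"
  by (simp add: power power_le_one)

lemma mult_less_1: "v x < 1 \<Longrightarrow> v y \<le> 1 \<Longrightarrow> v (x * y) < 1"
  using mult_le_one[of "v x" "v y"] mult_left_le[of "v y" "v x"] nonneg[of x] nonneg[of y]
  by (simp add: mult)

lemma le_1_poly: "(\<And>n. v (coeff p n) \<le> 1) \<Longrightarrow> v x \<le> 1 \<Longrightarrow> v (poly p x) \<le> 1"
  unfolding poly_altdef by (intro sum_le) (auto intro!: le_1_mult le_1_power)

text \<open>Congruence modulo the maximal ideal \<open>v < 1\<close> survives powers; this is what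
  allows the congruence for Frobenius to be iterated.\<close>

lemma diff_power_less_1:
  assumes "v x \<le> 1" "v y \<le> 1" "v (x - y) < 1"
  shows "v (x ^ n - y ^ n) < 1"
proof (induction n)
  case (Suc n)
  have "x ^ Suc n - y ^ Suc n = (x - y) * x ^ n + (x ^ n - y ^ n) * y"
    by (simp add: algebra_simps)
  thus ?case
    using assms Suc by (auto intro!: add_less mult_less_1 le_1_power)
qed simp

text \<open>By Horner's scheme the coefficients of the quotient are values at \<open>a\<close> of
  tails of \<open>p\<close>.\<close>

lemma coeff_synthetic_div_le_1:
  assumes "\<And>n. v (coeff p n) \<le> 1" "v a \<le> 1"
  shows "v (coeff (synthetic_div p a) n) \<le> 1"
  using assms(1)
proof (induction p arbitrary: n)
  case (pCons c p)
  have p: "v (coeff p m) \<le> 1" for m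
    using pCons.prems[of "Suc m"] by simp
  show ?case
    using pCons.IH[OF p] le_1_poly[of p a] p assms(2)
    by (cases n) (auto simp: synthetic_div_pCons)
qed auto

text \<open>This is the bound on the number of roots over the residue field, which is never formed:
  \<open>T\<close> consists of representatives of distinct residues, and
  \<open>v (poly p x) < 1\<close> says that the residue of \<open>x\<close> is a root. The unit
  leading coefficient keeps the reduced polynomial nonzero.\<close>

lemma card_roots_mod_le_degree:
  assumes "finite T" and "\<And>x. x \<in> T \<Longrightarrow> v x \<le> 1"
    and "\<And>x y. x \<in> T \<Longrightarrow> y \<in> T \<Longrightarrow> x \<noteq> y \<Longrightarrow> v (x - y) = 1"
    and "\<And>n. v (coeff p n) \<le> 1" and "v (lead_coeff p) = 1"
    and "\<And>x. x \<in> T \<Longrightarrow> v (poly p x) < 1"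
  shows "card T \<le> degree p"
  using assms
proof (induction "degree p" arbitrary: p T)
  case 0
  then obtain c where "p = [:c:]" by (metis degree_eq_zeroE)
  hence "T = {}" using 0 by fastforce
  thus ?case by simp
next
  case (Suc N p T)
  show ?case
  proof (cases "T = {}")
    case False
    then obtain a where a: "a \<in> T" by auto
    define q where "q = synthetic_div p a"
    have q: "degree q = N" using Suc(2) by (simp add: q_def degree_synthetic_div)
    have "coeff (p + smult a q) (Suc N) = coeff (pCons (poly p a) q) (Suc N)"
      by (simp only: q_def synthetic_div_correct)
    hence lead: "lead_coeff q = lead_coeff p"
      using q Suc.hyps(2)[symmetric] by (simp add: coeff_eq_0)
    have eval: "poly p x - poly p a = (x - a) * poly q x" for x
      using arg_cong[OF synthetic_div_correct'[of a p], of "\<lambda>r. poly r x"]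
      by (simp add: q_def algebra_simps)
    \<comment> \<open>For \<open>x\<close> in \<open>T\<close> other than \<open>a\<close> the
      factor \<open>x - a\<close> is a unit, so being a root passes to the quotient.\<close>
    have "v (poly q x) < 1" if "x \<in> T - {a}" for x
    proof -
      have "v (poly p x - poly p a) < 1" using that a Suc.prems(6) by (intro diff_less) auto
      thus ?thesis unfolding eval mult using Suc.prems(3)[of x a] that a by simp
    qed
    hence "card (T - {a}) \<le> degree q"
      using Suc.hyps(1)[of q "T - {a}"] q lead Suc.prems coeff_synthetic_div_le_1[of p a] a
      by (auto simp: q_def)
    thus ?thesis using a Suc.prems(1) q Suc(2)[symmetric] by simp
  qed simp
qed

end

text \<open>The Vandermonde argument, stated for coefficient sequences because relations among the
  powers of an element arise in this form.\<close>

lemma polyfun_zero_of_many_roots: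
  fixes c :: "nat \<Rightarrow> 'x::idom"
  assumes "finite X" "n \<le> card X" "\<And>x. x \<in> X \<Longrightarrow> (\<Sum>j<n. c j * x ^ j) = 0" "j < n"
  shows "c j = 0"
proof (rule ccontr)
  assume "c j \<noteq> 0"
  define p where "p = (\<Sum>j<n. monom (c j) j)"
  have co: "coeff p i = (if i < n then c i else 0)" for i
    by (auto simp: p_def coeff_sum if_distrib cong: if_cong)
  have "p \<noteq> 0" using co[of j] \<open>c j \<noteq> 0\<close> assms(4) by auto
  have "degree p < n" using co[of "degree p"] \<open>p \<noteq> 0\<close>
    by (metis leading_coeff_0_iff)
  have "poly p x = (\<Sum>j<n. c j * x ^ j)" for x
    by (simp add: p_def poly_sum poly_monom)
  hence "X \<subseteq> {x. poly p x = 0}" using assms by auto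
  hence "card X \<le> card {x. poly p x = 0}"
    using \<open>p \<noteq> 0\<close> by (intro card_mono poly_roots_finite)
  thus False using card_poly_roots_bound[OF \<open>p \<noteq> 0\<close>] \<open>degree p < n\<close> assms(2) by simp
qed


section \<open>Indexed families of vectors\<close>

locale lin_space = vector_space
begin

text \<open>Families rather than sets: matrices refer to positions, and the steps of a flag are
  spanned by the initial segments of one family.\<close>

definition indep_family :: "nat \<Rightarrow> (nat \<Rightarrow> 'b) \<Rightarrow> bool" where
  "indep_family n b \<longleftrightarrow> (\<forall>c. (\<Sum>l<n. scale (c l) (b l)) = 0 \<longrightarrow> (\<forall>l<n. c l = 0))"

lemma sum_in_span: "(\<Sum>l<(n::nat). scale (c l) (b l)) \<in> span (b ` {..<n})"
  by (intro span_sum span_scale span_base) auto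

lemma span_family: "span (b ` {..<n::nat}) = {(\<Sum>l<n. scale (c l) (b l)) | c. True}"
proof
  show "span (b ` {..<n}) \<subseteq> {(\<Sum>l<n. scale (c l) (b l)) | c. True}"
  proof (rule span_minimal)
    show "b ` {..<n} \<subseteq> {(\<Sum>l<n. scale (c l) (b l)) | c. True}"
    proof
      fix x assume "x \<in> b ` {..<n}"
      then obtain j where j: "j < n" "x = b j" by auto
      have "(\<Sum>l<n. scale (if l = j then 1 else 0) (b l)) = b j"
        using j(1) by (subst sum.mono_neutral_right[of _ "{j}"]) auto
      thus "x \<in> {(\<Sum>l<n. scale (c l) (b l)) | c. True}"
        by (intro CollectI exI[of _ "\<lambda>l. if l = j then 1 else 0"]) (simp only: j simp_thms)
    qed
    show "subspace {(\<Sum>l<n. scale (c l) (b l)) | c. True}"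
    proof (rule subspaceI, goal_cases)
      case 1
      have "0 = (\<Sum>l<n. scale ((\<lambda>_. 0) l) (b l))" by simp
      thus ?case by - (intro CollectI exI conjI TrueI, assumption)
    next
      case (2 x y)
      then obtain c c' where "x = (\<Sum>l<n. scale (c l) (b l))" "y = (\<Sum>l<n. scale (c' l) (b l))" by auto
      hence "x + y = (\<Sum>l<n. scale ((\<lambda>l. c l + c' l) l) (b l))"
        by (simp add: scale_left_distrib sum.distrib)
      thus ?case by - (intro CollectI exI conjI TrueI, assumption)
    next
      case (3 a x)
      then obtain c where "x = (\<Sum>l<n. scale (c l) (b l))" by auto
      hence "scale a x = (\<Sum>l<n. scale ((\<lambda>l. a * c l) l) (b l))"
        by (simp add: scale_sum_right)
      thus ?case by - (intro CollectI exI conjI TrueI, assumption)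
    qed
  qed
qed (auto intro: sum_in_span)

lemma indep_family_coeff_eq:
  assumes "indep_family n b" "(\<Sum>l<n. scale (c l) (b l)) = (\<Sum>l<n. scale (c' l) (b l))" "l < n"
  shows "c l = c' l"
proof -
  have "(\<Sum>l<n. scale (c l - c' l) (b l)) = 0"
    using assms(2) by (simp add: scale_left_diff_distrib sum_subtractf)
  from assms(1)[unfolded indep_family_def, rule_format, OF this assms(3)] show ?thesis by simp
qed

lemma indep_family_Suc:
  "indep_family (Suc n) b \<longleftrightarrow> indep_family n b \<and> b n \<notin> span (b ` {..<n})"
proof
  assume L: "indep_family (Suc n) b"
  have "indep_family n b" unfolding indep_family_def
  proof (intro allI impI)
    fix c l assume *: "(\<Sum>l<n. scale (c l) (b l)) = 0" "l < n"
    have "(\<Sum>l<Suc n. scale (if l = n then 0 else c l) (b l)) = 0"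
      using *(1) by simp
    from L[unfolded indep_family_def, rule_format, OF this, of l] *(2) show "c l = 0" by simp
  qed
  moreover have "b n \<notin> span (b ` {..<n})"
  proof
    assume "b n \<in> span (b ` {..<n})"
    then obtain c where "b n = (\<Sum>l<n. scale (c l) (b l))" unfolding span_family by auto
    hence "(\<Sum>l<Suc n. scale (if l = n then - 1 else c l) (b l)) = 0" by simp
    from L[unfolded indep_family_def, rule_format, OF this, of n] show False by simp
  qed
  ultimately show "indep_family n b \<and> b n \<notin> span (b ` {..<n})" ..
next
  assume R: "indep_family n b \<and> b n \<notin> span (b ` {..<n})"
  show "indep_family (Suc n) b" unfolding indep_family_def
  proof (intro allI impI)
    fix c l assume *: "(\<Sum>l<Suc n. scale (c l) (b l)) = 0" "l < Suc n"
    have 0: "c n = 0"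
    proof (rule ccontr)
      assume "c n \<noteq> 0"
      have "scale (c n) (b n) = - (\<Sum>l<n. scale (c l) (b l))"
        using *(1) by (simp add: eq_neg_iff_add_eq_0 add.commute)
      hence "scale (inverse (c n)) (scale (c n) (b n)) \<in> span (b ` {..<n})"
        by (simp only: span_scale span_neg sum_in_span)
      thus False using R \<open>c n \<noteq> 0\<close> by simp
    qed
    hence "(\<Sum>l<n. scale (c l) (b l)) = 0" using *(1) by simp
    thus "c l = 0" using R *(2) 0 by (auto simp: indep_family_def less_Suc_eq)
  qed
qed

lemma indep_family_0 [simp]: "indep_family 0 b"
  by (simp add: indep_family_def)

lemma indep_family_mono: "indep_family n b \<Longrightarrow> m \<le> n \<Longrightarrow> indep_family m b"
  by (induction n) (auto simp: indep_family_Suc le_Suc_eq)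

lemma indep_familyD:
  assumes "indep_family n b"
  shows "independent (b ` {..<n})" "inj_on b {..<n}"
proof -
  have "independent (b ` {..<n}) \<and> inj_on b {..<n}"
    using assms
  proof (induction n)
    case (Suc n)
    hence *: "independent (b ` {..<n})" "inj_on b {..<n}" "b n \<notin> span (b ` {..<n})"
      by (auto simp: indep_family_Suc)
    hence "b n \<notin> b ` {..<n}" using span_base[of "b n" "b ` {..<n}"] by metis
    thus ?case using * by (simp add: lessThan_Suc independent_insert)
  qed (simp add: independent_empty)
  thus "independent (b ` {..<n})" "inj_on b {..<n}" by auto
qed

lemma indep_familyI:
  assumes "independent (b ` {..<n})" "inj_on b {..<n}"
  shows "indep_family n b"
  using assms
proof (induction n)
  case (Suc n)
  hence "b n \<notin> b ` {..<n}" "inj_on b {..<n}" by (auto simp: lessThan_Suc)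
  moreover have "independent (insert (b n) (b ` {..<n}))" using Suc.prems(1) by (simp add: lessThan_Suc)
  ultimately show ?case using Suc.IH by (simp add: indep_family_Suc independent_insert)
qed simp

lemma dim_indep_family: "indep_family n b \<Longrightarrow> dim (span (b ` {..<n})) = n"
  using indep_familyD[of n b] by (simp add: dim_span_eq_card_independent card_image del: dim_span)

lemma indep_family_card_le:
  assumes "indep_family n b" "finite B" "\<And>l. l < n \<Longrightarrow> b l \<in> span B"
  shows "n \<le> card B"
  using independent_span_bound[OF assms(2) indep_familyD(1)[OF assms(1)]] assms(3)
    indep_familyD(2)[OF assms(1)] by (auto simp: card_image)

text \<open>A vector of \<open>U\<close> outside the span would prolong the family beyond the size
  of a basis of \<open>U\<close>. The finite set \<open>B\<close> makes that basis finite, so that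
  \<open>dim U\<close> is its true size.\<close>

lemma indep_family_spans:
  assumes "indep_family (dim U) b" "finite B" "U \<subseteq> span B" "b ` {..<dim U} \<subseteq> U" "subspace U"
  shows "span (b ` {..<dim U}) = U"
proof
  show "span (b ` {..<dim U}) \<subseteq> U" using assms by (simp add: span_minimal)
  show "U \<subseteq> span (b ` {..<dim U})"
  proof (rule ccontr)
    assume "\<not> ?thesis"
    then obtain x where x: "x \<in> U" "x \<notin> span (b ` {..<dim U})" by auto
    have eq: "(b(dim U := x)) ` {..<dim U} = b ` {..<dim U}" by auto
    \<comment> \<open>The position \<open>dim U\<close> is the first one outside the family and is
      free to hold \<open>x\<close>.\<close>
    have "indep_family (dim U) (b(dim U := x))"
      using indep_familyI[of "b(dim U := x)" "dim U"] indep_familyD[OF assms(1)] unfolding eq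
      by (auto simp: inj_on_def)
    hence ind: "indep_family (Suc (dim U)) (b(dim U := x))"
      unfolding indep_family_Suc eq using x by simp
    obtain C where C: "C \<subseteq> U" "independent C" "U \<subseteq> span C" "card C = dim U"
      using basis_exists by blast
    have "finite C"
      using independent_span_bound[OF assms(2) C(2)] C(1) assms(3) by blast
    have "Suc (dim U) \<le> card C"
      using x C(3) assms(4) by (intro indep_family_card_le[OF ind \<open>finite C\<close>]) (auto simp: less_Suc_eq)
    thus False using C(4) by simp
  qed
qed

text \<open>An infinite basis has \<open>card\<close> equal to 0, so a positive dimension already
  forces a finite one. In this way the degree of \<open>K\<close> yields finite
  dimensionality.\<close>

lemma finite_spanning_if_dim_pos:
  assumes "dim UNIV > 0"
  shows "\<exists>B. finite B \<and> span B = UNIV"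
proof -
  obtain C where "C \<subseteq> UNIV" "independent C" "UNIV \<subseteq> span C" "card C = dim UNIV"
    using basis_exists by blast
  thus ?thesis using assms card_ge_0_finite[of C] by auto
qed

end

section \<open>The coefficient fields\<close>

lemma padic_abs_of_int:
  assumes "prime p"
  shows "padic_abs p (of_int a) = (if a = 0 then 0 else real p powi - int (multiplicity (int p) a))"
  by (simp add: padic_abs_def)

locale coeff_ring =
  fixes S :: "('q::field_char_0, 'a::field, 'k::field) coeff_data"
  assumes datum: "coeff_datum S"
begin

abbreviation "p \<equiv> char_p S"
abbreviation "f \<equiv> res_deg S"

lemma padic: "is_padic_field p (absQ S)"
  and hom_inclF: "field_hom (inclF S)"
  and hom_inclK: "field_hom (inclK S)"
  and hom_emb0: "field_hom (emb0 S)"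
  and hom_frob: "field_hom (frob S)"
  and bij_frob: "bij (frob S)"
  and abs_inclF: "absF S (inclF S q) = absQ S q"
  and abs_inclK: "absK S (inclK S q) = absQ S q"
  and emb0_inclK: "emb0 S (inclK S q) = inclF S q"
  and frob_inclK: "frob S (inclK S q) = inclK S q"
  and frob_cong: "absK S x \<le> 1 \<Longrightarrow> absK S (frob S x - x ^ p) < 1"
  and f_pos: "f > 0"
  and dim_K: "vector_space.dim (\<lambda>q x. inclK S q * x) (UNIV :: 'k set) = f"
  and card_residue: "card (residue_field_K S) = p ^ f"
  and nonarch_F: "nonarch_abs (absF S)"
  and nonarch_K: "nonarch_abs (absK S)"
  using datum by (auto simp: coeff_datum_def ringK_def)

lemma prime_p: "prime p"
  and nonarch_Q: "nonarch_abs (absQ S)"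
  and abs_of_rat: "absQ S (of_rat r) = padic_abs p r"
  and rat_dense: "\<epsilon> > 0 \<Longrightarrow> \<exists>r. absQ S (x - of_rat r) < \<epsilon>"
  using padic by (auto simp: is_padic_field_def)

sublocale Q: nonarch_field "absQ S" by unfold_locales (rule nonarch_Q)
sublocale F: nonarch_field "absF S" by unfold_locales (rule nonarch_F)
sublocale K: nonarch_field "absK S" by unfold_locales (rule nonarch_K)

sublocale inclF: field_hom "inclF S" by (rule hom_inclF)
sublocale inclK: field_hom "inclK S" by (rule hom_inclK)
sublocale emb0: field_hom "emb0 S" by (rule hom_emb0)
sublocale frob: field_hom "frob S" by (rule hom_frob)

lemma p_gt_1: "p > 1"
  using prime_p by (rule prime_gt_1_nat)

section \<open>Absolute values of integers, digits and residues\<close>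

lemma absQ_of_int: "absQ S (of_int a) = (if a = 0 then 0 else real p powi - int (multiplicity (int p) a))"
  using abs_of_rat[of "of_int a"] padic_abs_of_int[OF prime_p] by simp

lemma absQ_of_int_le_1: "absQ S (of_int a) \<le> 1"
  using Q.of_nat_le_1[of "nat \<bar>a\<bar>"] by (cases "a \<ge> 0") (auto simp: abs_if)

lemma absQ_p: "absQ S (of_nat p) = 1 / real p"
proof -
  have "multiplicity (int p) (int p) = 1"
    using p_gt_1 prime_p by (intro multiplicity_self) auto
  thus ?thesis using absQ_of_int[of "int p"] p_gt_1 by (simp add: power_int_minus field_simps)
qed

lemma absF_p: "absF S (of_nat p) = 1 / real p"
  using abs_inclF[of "of_nat p"] absQ_p by (simp add: inclF.hom_of_nat)

lemma absQ_of_int_dvd: "int p dvd a \<Longrightarrow> absQ S (of_int a) < 1"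
proof -
  assume "int p dvd a"
  then obtain t where "a = int p * t" by auto
  hence "absQ S (of_int a) = absQ S (of_nat p) * absQ S (of_int t)" by (simp add: Q.mult)
  moreover have "absQ S (of_nat p) < 1" using absQ_p p_gt_1 by simp
  ultimately show ?thesis
    using Q.mult_less_1[of "of_nat p" "of_int t"] absQ_of_int_le_1[of t] by (simp add: Q.mult)
qed

lemma absQ_of_int_not_dvd: "\<not> int p dvd a \<Longrightarrow> absQ S (of_int a) = 1"
  using absQ_of_int[of a] by (auto simp: not_dvd_imp_multiplicity_0)

text \<open>By density \<open>q\<close> may be replaced by a fraction \<open>a / b\<close> in lowest
  terms. Integrality forces \<open>p\<close> not to divide \<open>b\<close>, and \<open>a\<close>
  times an inverse of \<open>b\<close> modulo \<open>p\<close> is the digit.\<close>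

lemma padic_digit:
  assumes "absQ S q \<le> 1"
  shows "\<exists>n<p. absQ S (q - of_nat n) < 1"
proof -
  obtain r where r: "absQ S (q - of_rat r) < 1" using rat_dense[of 1 q] by auto
  obtain a b where ab: "quotient_of r = (a, b)" by force
  have b: "b > 0" and cop: "coprime a b" and r_eq: "r = of_int a / of_int b"
    using quotient_of_denom_pos[OF ab] quotient_of_coprime[OF ab] quotient_of_div[OF ab] by auto
  have q_r: "(of_rat r :: 'q) = of_int a / of_int b" by (simp add: r_eq of_rat_divide)
  have "absQ S (of_rat r) \<le> 1"
    using Q.diff_le[of q "q - of_rat r"] r assms by simp
  hence le: "absQ S (of_int a) \<le> absQ S (of_int b)"
    using b by (simp add: q_r Q.divide divide_le_eq)
  have nb: "\<not> int p dvd b"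
  proof
    assume "int p dvd b"
    hence "\<not> int p dvd a" using cop prime_p p_gt_1
      using coprime_common_divisor[OF cop, of "int p"] \<open>int p dvd b\<close> by auto
    thus False using absQ_of_int_dvd[OF \<open>int p dvd b\<close>] absQ_of_int_not_dvd le by force
  qed
  hence "coprime b (int p)"
    using prime_imp_coprime[of "int p" b] prime_p by (simp add: coprime_commute)
  then obtain c where c: "[b * c = 1] (mod int p)" using cong_solve_coprime_int by blast
  define n where "n = nat ((a * c) mod int p)"
  have n: "int n = (a * c) mod int p" "n < p"
    using p_gt_1 by (auto simp: n_def nat_less_iff)
  have "[int n * b = a * c * b] (mod int p)" using n by (intro cong_mult) (auto simp: cong_def)
  moreover have "[a * (b * c) = a * 1] (mod int p)" using c by (intro cong_mult) auto
  ultimately have "[int n * b = a] (mod int p)" by (simp add: ac_simps cong_def)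
  hence "int p dvd a - int n * b" by (metis cong_iff_dvd_diff cong_sym)
  hence "absQ S (of_int (a - int n * b)) < 1" by (rule absQ_of_int_dvd)
  moreover have "of_rat r - of_nat n = (of_int (a - int n * b) / of_int b :: 'q)"
    using b by (simp add: q_r field_simps)
  ultimately have "absQ S (of_rat r - of_nat n) < 1"
    using absQ_of_int_not_dvd[OF nb] by (simp add: Q.divide)
  hence "absQ S ((q - of_rat r) + (of_rat r - of_nat n)) < 1" using r by (intro Q.add_less)
  thus ?thesis using n(2) by auto
qed

text \<open>One representative per residue class stands in for the residue field; an integral
  difference that is not in the maximal ideal is a unit.\<close>

lemma residue_representatives:
  obtains T where "finite T" "card T = p ^ f" "\<And>x. x \<in> T \<Longrightarrow> absK S x \<le> 1"
    "\<And>x y. x \<in> T \<Longrightarrow> y \<in> T \<Longrightarrow> x \<noteq> y \<Longrightarrow> absK S (x - y) = 1"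
proof -
  define E where "E = {(x, y). x \<in> ringK S \<and> y \<in> ringK S \<and> absK S (x - y) < 1}"
  have E: "equiv (ringK S) E"
  proof (rule equivI)
    show "refl_on (ringK S) E" "E \<subseteq> ringK S \<times> ringK S" by (auto simp: E_def refl_on_def)
    show "sym E" by (auto simp: E_def sym_def K.diff_commute)
    show "trans E"
    proof (rule transI)
      fix x y z assume "(x, y) \<in> E" "(y, z) \<in> E"
      thus "(x, z) \<in> E" using K.add_less[of "x - y" 1 "y - z"] by (auto simp: E_def)
    qed
  qed
  define r where "r c = (SOME x. x \<in> c)" for c :: "'k set"
  have r: "r c \<in> c" if "c \<in> ringK S // E" for c
    unfolding r_def using in_quotient_imp_non_empty[OF E that] by (simp add: some_in_eq)
  have c: "card (ringK S // E) = p ^ f" using card_residue by (simp add: residue_field_K_def E_def)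
  have inj: "inj_on r (ringK S // E)"
  proof (rule inj_onI)
    fix c c' assume *: "c \<in> ringK S // E" "c' \<in> ringK S // E" "r c = r c'"
    hence "c \<inter> c' \<noteq> {}" using r by (metis disjoint_iff)
    thus "c = c'" using quotient_disj[OF E *(1,2)] by blast
  qed
  have rO: "r c \<in> ringK S" if "c \<in> ringK S // E" for c
    using r[OF that] in_quotient_imp_subset[OF E that] by blast
  show thesis
  proof (rule that[of "r ` (ringK S // E)"])
    \<comment> \<open>A positive \<open>card\<close> excludes an infinite quotient.\<close>
    show "finite (r ` (ringK S // E))" using c p_gt_1 by (intro finite_imageI card_ge_0_finite) auto
    show "card (r ` (ringK S // E)) = p ^ f" using inj c by (simp add: card_image)
    show "absK S x \<le> 1" if "x \<in> r ` (ringK S // E)" for x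
      using that rO by (auto simp: ringK_def)
    show "absK S (x - y) = 1" if xy: "x \<in> r ` (ringK S // E)" "y \<in> r ` (ringK S // E)" "x \<noteq> y" for x y
    proof -
      obtain c c' where c: "c \<in> ringK S // E" "c' \<in> ringK S // E" "x = r c" "y = r c'"
        using xy by auto
      have "(x, y) \<notin> E"
      proof
        assume "(x, y) \<in> E"
        hence "c = c'" using quotient_eqI[OF E c(1,2)] r c by blast
        thus False using c xy(3) by simp
      qed
      hence "\<not> absK S (x - y) < 1" using c rO by (auto simp: E_def)
      moreover have "absK S (x - y) \<le> 1" using c rO by (intro K.le_1_diff) (auto simp: ringK_def)
      ultimately show ?thesis by simp
    qed
  qed
qed

text \<open>Such families lift linearly independent families of the residue field, so maximal ones have
  \<open>f\<close> elements.\<close>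

definition orthonormal :: "nat \<Rightarrow> (nat \<Rightarrow> 'k) \<Rightarrow> bool" where
  "orthonormal m w \<longleftrightarrow> (\<forall>l<m. absK S (w l) \<le> 1) \<and>
     (\<forall>q. \<forall>j<m. absQ S (q j) \<le> absK S (\<Sum>l<m. inclK S (q l) * w l))"

text \<open>Counting replaces linear algebra over the residue field: combinations of
  \<open>w\<close> with digits as coefficients reach at most \<open>p ^ m\<close> residues, fewer
  than the \<open>p ^ f\<close> available, and any missed residue gives the new vector.\<close>

lemma orthonormal_extend:
  assumes w: "orthonormal m w" and m: "m < f"
  shows "\<exists>w'. orthonormal (Suc m) w'"
proof -
  obtain T where T: "finite T" "card T = p ^ f" "\<And>x. x \<in> T \<Longrightarrow> absK S x \<le> 1"
    "\<And>x y. x \<in> T \<Longrightarrow> y \<in> T \<Longrightarrow> x \<noteq> y \<Longrightarrow> absK S (x - y) = 1"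
    using residue_representatives by blast
  define N where "N = ({..<m} \<rightarrow>\<^sub>E {..<p})"
  define lc where "lc n = (\<Sum>l<m. inclK S (of_nat (n l)) * w l)" for n :: "nat \<Rightarrow> nat"
  have cN: "finite N" "card N = p ^ m" by (auto simp: N_def card_PiE intro: finite_PiE)
  \<comment> \<open>Pigeonhole: one digit combination cannot approximate two representatives of
    different residues.\<close>
  have "\<exists>x\<in>T. \<forall>n\<in>N. \<not> absK S (x - lc n) < 1"
  proof (rule ccontr)
    assume "\<not> ?thesis"
    then obtain g where g: "\<And>x. x \<in> T \<Longrightarrow> g x \<in> N \<and> absK S (x - lc (g x)) < 1" by metis
    have "inj_on g T"
    proof (rule inj_onI, rule ccontr)
      fix x y assume *: "x \<in> T" "y \<in> T" "g x = g y" "x \<noteq> y"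
      have "absK S ((x - lc (g x)) - (y - lc (g y))) < 1" using g[of x] g[of y] * by (intro K.diff_less[of "x - lc (g x)"]) auto
      thus False using T(4)[OF *(1,2,4)] *(3) by simp
    qed
    hence "card T \<le> card N" using g cN by (intro card_inj_on_le[of g]) auto
    hence "p ^ f \<le> p ^ m" using T(2) cN by simp
    thus False using power_strict_increasing[OF m p_gt_1] by simp
  qed
  then obtain x where x: "x \<in> T" "\<And>n. n \<in> N \<Longrightarrow> \<not> absK S (x - lc n) < 1" by blast
  have x1: "absK S x \<le> 1" using T x by auto
  define w' where "w' = w(m := x)"
  have sum': "(\<Sum>l<Suc m. inclK S (q l) * w' l) = (\<Sum>l<m. inclK S (q l) * w l) + inclK S (q m) * x"
    for q by (simp add: w'_def)
  have "absQ S (q j) \<le> absK S (\<Sum>l<Suc m. inclK S (q l) * w' l)" if j: "j < Suc m" for q j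
  proof -
    define y where "y = (\<Sum>l<Suc m. inclK S (q l) * w' l)"
    have qm: "absQ S (q m) \<le> absK S y"
    proof (rule ccontr)
      assume "\<not> ?thesis"
      hence less: "absK S y < absQ S (q m)" by simp
      hence q0: "q m \<noteq> 0" using K.nonneg[of y] by (metis Q.zero not_le)
      \<comment> \<open>After division by the too large coefficient \<open>q m\<close>, the
        combination \<open>z + x\<close> lies in the maximal ideal. The digits of the negated
        coefficients of \<open>z\<close> then give a digit combination congruent to
        \<open>x\<close>, contrary to the choice of \<open>x\<close>.\<close>
      define z where "z = (\<Sum>l<m. inclK S (q l / q m) * w l)"
      have yz: "y / inclK S (q m) = z + x"
        using q0 unfolding y_def sum' z_def
        by (simp add: add_divide_distrib sum_divide_distrib inclK.hom_div)
      have zx: "absK S (z + x) < 1"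
        unfolding yz[symmetric] K.divide abs_inclK using less q0 by simp
      hence "absK S z \<le> 1" using K.diff_le[of "z + x" x] x1 by simp
      hence "absQ S (q l / q m) \<le> 1" if "l < m" for l
        using w that unfolding orthonormal_def z_def by (meson order_trans)
      hence "\<exists>n<p. absQ S (- (q l / q m) - of_nat n) < 1" if "l < m" for l
        using padic_digit[of "- (q l / q m)"] that by simp
      then obtain n where n: "\<And>l. l < m \<Longrightarrow> n l < p \<and> absQ S (- (q l / q m) - of_nat (n l)) < 1"
        by metis
      define n' where "n' = restrict n {..<m}"
      have n': "n' \<in> N" using n by (auto simp: N_def n'_def)
      have "z + lc n' = - (\<Sum>l<m. inclK S (- (q l / q m) - of_nat (n l)) * w l)"
        by (simp add: z_def lc_def n'_def inclK.hom_add inclK.hom_mult inclK.hom_minus inclK.hom_uminus inclK.hom_of_nat algebra_simps sum.distrib sum_negf sum_subtractf)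
      moreover have "absK S (\<Sum>l<m. inclK S (- (q l / q m) - of_nat (n l)) * w l) < 1"
      proof (rule K.sum_less)
        fix l assume "l \<in> {..<m}"
        thus "absK S (inclK S (- (q l / q m) - of_nat (n l)) * w l) < 1"
          using n[of l] w by (intro K.mult_less_1) (auto simp: abs_inclK orthonormal_def)
      qed simp
      ultimately have "absK S (z + lc n') < 1" by simp
      hence "absK S ((z + x) - (z + lc n')) < 1" using zx by (intro K.diff_less)
      thus False using x(2)[OF n'] by simp
    qed
    show ?thesis
    proof (cases "j = m")
      case False
      \<comment> \<open>The last term is no larger than \<open>y\<close>, so removing it does not
        enlarge \<open>y\<close> and leaves a combination of the old family.\<close>
      have "absK S (inclK S (q m) * x) \<le> absQ S (q m)"
        using x1 by (simp add: K.mult abs_inclK mult_left_le)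
      hence "absK S (y - inclK S (q m) * x) \<le> absK S y"
        using qm K.diff_le[of y "inclK S (q m) * x"] by simp
      moreover have "y - inclK S (q m) * x = (\<Sum>l<m. inclK S (q l) * w l)"
        unfolding y_def sum' by simp
      moreover have "absQ S (q j) \<le> absK S (\<Sum>l<m. inclK S (q l) * w l)"
        using w j False unfolding orthonormal_def by (simp add: less_Suc_eq)
      ultimately show ?thesis by (simp only: y_def)
    qed (use qm in \<open>simp add: y_def\<close>)
  qed
  moreover have "\<forall>l<Suc m. absK S (w' l) \<le> 1"
    using w x1 by (auto simp: w'_def orthonormal_def less_Suc_eq)
  ultimately show ?thesis by (auto simp: orthonormal_def)
qed

lemma orthonormal_exists: "\<exists>w. orthonormal f w"
proof -
  have "m \<le> f \<Longrightarrow> \<exists>w. orthonormal m w" for m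
  proof (induction m)
    case (Suc m)
    thus ?case using orthonormal_extend[of m] by auto
  qed (auto simp: orthonormal_def)
  thus ?thesis by blast
qed

sublocale VK: lin_space "\<lambda>q x. inclK S q * x"
  by unfold_locales (auto simp: inclK.hom_add inclK.hom_mult inclK.hom_minus inclK.hom_uminus inclK.hom_of_nat algebra_simps)

lemma K_spanned:
  assumes "VK.indep_family f w"
  shows "\<exists>q. x = (\<Sum>l<f. inclK S (q l) * w l)"
proof -
  obtain B where "finite B" "VK.span B = UNIV"
    using VK.finite_spanning_if_dim_pos dim_K f_pos by auto
  hence "VK.span (w ` {..<f}) = UNIV"
    using VK.indep_family_spans[of UNIV w B] assms dim_K by simp
  hence "x \<in> VK.span (w ` {..<f})" by simp
  thus ?thesis unfolding VK.span_family by auto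
qed

lemma orthonormal_indep: "orthonormal m w \<Longrightarrow> VK.indep_family m w"
  unfolding VK.indep_family_def
proof (intro allI impI)
  fix c l assume "orthonormal m w" "(\<Sum>l<m. inclK S (c l) * w l) = 0" "l < m"
  hence "absQ S (c l) \<le> 0" unfolding orthonormal_def by (metis K.zero)
  thus "c l = 0" using Q.nonneg[of "c l"] Q.eq_0_iff[of "c l"] by linarith
qed

text \<open>\<open>\<O>\<^sub>K\<close> is finitely generated over the \<open>p\<close>-adic integers, so \<open>g\<close> is bounded on it; as \<open>\<O>\<^sub>K\<close> is
  closed under powers, the bound is 1.\<close>

lemma hom_integral:
  fixes g :: "'k \<Rightarrow> 'e::field"
  assumes g: "field_hom g" and u: "nonarch_abs u" and g_incl: "\<And>q. u (g (inclK S q)) = absQ S q"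
    and x: "absK S x \<le> 1"
  shows "u (g x) \<le> 1"
proof (rule ccontr)
  interpret g: field_hom g by fact
  interpret u: nonarch_field u by unfold_locales fact
  assume "\<not> u (g x) \<le> 1"
  hence gt: "u (g x) > 1" by simp
  obtain w where w: "orthonormal f w" using orthonormal_exists by blast
  define C where "C = (\<Sum>l<f. u (g (w l)))"
  have C: "0 \<le> C" "l < f \<Longrightarrow> u (g (w l)) \<le> C" for l
    unfolding C_def by (auto intro!: sum_nonneg member_le_sum)
  have "u (g y) \<le> C" if y: "absK S y \<le> 1" for y
  proof -
    obtain q where q: "y = (\<Sum>l<f. inclK S (q l) * w l)"
      using K_spanned[OF orthonormal_indep[OF w]] by blast
    have "absQ S (q l) \<le> 1" if "l < f" for l
      using w that q y unfolding orthonormal_def by (metis order_trans)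
    hence "u (g (inclK S (q l) * w l)) \<le> C" if "l < f" for l
      using mult_mono[of "absQ S (q l)" 1 "u (g (w l))" C] C(2)[OF that] that
      by (simp add: g.hom_mult u.mult g_incl)
    thus ?thesis unfolding q g.hom_sum using C(1) by (intro u.sum_le) auto
  qed
  hence "u (g x) ^ n \<le> C" for n
    using K.le_1_power[OF x, of n] by (metis g.hom_power u.power)
  moreover obtain n where "C < u (g x) ^ n" using real_arch_pow[OF gt] by blast
  ultimately show False by (metis not_le)
qed

end

section \<open>Conjugates and idempotents\<close>

context coeff_ring
begin

section \<open>Frobenius, its inverse and the embeddings\<close>

abbreviation frobi :: "'k \<Rightarrow> 'k" where "frobi \<equiv> inv_into UNIV (frob S)"

lemma frobi_frob [simp]: "frobi (frob S x) = x"
  using bij_frob by (simp add: bij_is_inj)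

lemma frob_frobi [simp]: "frob S (frobi x) = x"
  using bij_frob by (simp add: bij_is_surj surj_f_inv_f)

lemma hom_frobi: "field_hom frobi"
proof unfold_locales
  fix x y
  have inj: "frob S a = frob S b \<Longrightarrow> a = b" for a b using bij_frob by (simp add: bij_is_inj inj_eq)
  show "frobi (x + y) = frobi x + frobi y" by (rule inj) (simp add: frob.hom_add)
  show "frobi (x * y) = frobi x * frobi y" by (rule inj) (simp add: frob.hom_mult)
  show "frobi 0 = 0" "frobi 1 = 1" by (rule inj, simp)+
qed

lemma hom_funpow: "field_hom h \<Longrightarrow> field_hom (h ^^ n)" for h :: "'k \<Rightarrow> 'k"
proof -
  assume "field_hom h"
  then interpret h: field_hom h .
  show "field_hom (h ^^ n)"
  proof (induction n)
    case (Suc n)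
    then interpret hn: field_hom "h ^^ n" .
    show ?case by unfold_locales (auto simp: h.hom_add h.hom_mult hn.hom_add hn.hom_mult)
  qed (unfold_locales, auto)
qed

lemma hom_emb: "field_hom (emb S i)"
proof -
  interpret h: field_hom "frobi ^^ i" using hom_funpow[OF hom_frobi] .
  show ?thesis unfolding emb_def
    by unfold_locales (auto simp: h.hom_add h.hom_mult emb0.hom_add emb0.hom_mult)
qed

sublocale emb: field_hom "emb S i" for i by (rule hom_emb)

lemma frobi_inclK: "frobi (inclK S q) = inclK S q"
  using frob_inclK[of q] frobi_frob[of "inclK S q"] by simp

lemma frobi_pow_inclK: "(frobi ^^ i) (inclK S q) = inclK S q"
  by (induction i) (auto simp: frobi_inclK)

lemma emb_inclK: "emb S i (inclK S q) = inclF S q"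
  by (simp add: emb_def frobi_pow_inclK emb0_inclK)

lemma emb_integral: "absK S x \<le> 1 \<Longrightarrow> absF S (emb S i x) \<le> 1"
  using hom_integral[OF hom_emb nonarch_F] by (simp add: emb_inclK abs_inclF)

lemma frob_integral: "absK S x \<le> 1 \<Longrightarrow> absK S (frob S x) \<le> 1"
  using hom_integral[OF hom_frob nonarch_K] by (simp add: frob_inclK abs_inclK)

lemma frobi_integral: "absK S x \<le> 1 \<Longrightarrow> absK S (frobi x) \<le> 1"
  using hom_integral[OF hom_frobi nonarch_K] by (simp add: frobi_inclK abs_inclK)

text \<open>Both \<open>x\<close> and its inverse have integral images, and the absolute values of
  these images multiply to 1.\<close>

lemma emb0_unit:
  assumes "absK S x = 1"
  shows "absF S (emb0 S x) = 1"
proof -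
  have e: "emb0 S = emb S 0" by (simp add: emb_def)
  have "absF S (emb S 0 x) \<le> 1" "absF S (emb S 0 (inverse x)) \<le> 1"
    using assms by (auto intro!: emb_integral simp: K.inverse)
  moreover have "absF S (emb S 0 x) * absF S (emb S 0 (inverse x)) = 1"
    using assms K.zero unfolding F.mult[symmetric] emb.hom_mult[symmetric]
    by (metis F.one emb.hom_one right_inverse zero_neq_one)
  ultimately show ?thesis unfolding e
    by (metis F.nonneg mult.right_neutral mult_left_le order_antisym)
qed

text \<open>Otherwise the inverse of \<open>frob S x\<close> would be integral, and the inverse
  Frobenius would make the inverse of \<open>x\<close> integral.\<close>

lemma frob_less_1:
  assumes "absK S x < 1"
  shows "absK S (frob S x) < 1"
proof (rule ccontr)
  assume "\<not> ?thesis"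
  hence ge: "1 \<le> absK S (frob S x)" by simp
  hence x0: "x \<noteq> 0" by auto
  have "absK S (inverse (frob S x)) \<le> 1" using ge by (simp add: K.inverse inverse_le_1_iff)
  hence "absK S (frobi (frob S (inverse x))) \<le> 1" by (intro frobi_integral) (simp add: frob.hom_inverse)
  hence "inverse (absK S x) \<le> 1" by (simp add: K.inverse)
  thus False using one_less_inverse[of "absK S x"] assms x0 by simp
qed

lemma frob_pow_less_1: "absK S x < 1 \<Longrightarrow> absK S ((frob S ^^ n) x) < 1"
  by (induction n) (auto intro: frob_less_1)

lemma frob_pow_integral: "absK S x \<le> 1 \<Longrightarrow> absK S ((frob S ^^ n) x) \<le> 1"
  by (induction n) (auto intro: frob_integral)

lemma frob_pow_cong:
  assumes "absK S x \<le> 1"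
  shows "absK S ((frob S ^^ n) x - x ^ (p ^ n)) < 1"
proof (induction n)
  case (Suc n)
  let ?y = "(frob S ^^ n) x"
  have "absK S (frob S ?y - ?y ^ p) < 1" using assms by (intro frob_cong frob_pow_integral)
  moreover have "absK S (?y ^ p - (x ^ (p ^ n)) ^ p) < 1"
    using assms Suc by (intro K.diff_power_less_1 frob_pow_integral K.le_1_power) auto
  ultimately have "absK S ((frob S ?y - ?y ^ p) + (?y ^ p - (x ^ (p ^ n)) ^ p)) < 1"
    by (rule K.add_less)
  thus ?case by (simp add: power_mult[symmetric] mult.commute)
qed simp

lemma sum_powers_less: "(\<Sum>n\<in>{1..<f}. p ^ n) < p ^ f"
proof -
  have "(\<Sum>n<m. p ^ n) < p ^ m" for m
  proof (induction m)
    case (Suc m)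
    have "p ^ m + p ^ m \<le> p ^ Suc m" using mult_le_mono1[OF Suc_leI[OF p_gt_1], of "p ^ m"] by simp
    thus ?case using Suc by simp
  qed simp
  moreover have "(\<Sum>n\<in>{1..<f}. p ^ n) \<le> (\<Sum>n<f. p ^ n)" by (intro sum_mono2) auto
  ultimately show ?thesis by (meson le_less_trans)
qed

text \<open>The residue field has at most \<open>p ^ n\<close> solutions of \<open>x ^ (p ^ n) = x\<close>, and the sum of these bounds
  over \<open>0 < n < f\<close> is less than \<open>p ^ f\<close>.\<close>

lemma residue_generator:
  obtains x where "absK S x \<le> 1" "\<And>n. 0 < n \<Longrightarrow> n < f \<Longrightarrow> absK S (x ^ (p ^ n) - x) = 1"
proof -
  obtain T where T: "finite T" "card T = p ^ f" "\<And>x. x \<in> T \<Longrightarrow> absK S x \<le> 1"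
    "\<And>x y. x \<in> T \<Longrightarrow> y \<in> T \<Longrightarrow> x \<noteq> y \<Longrightarrow> absK S (x - y) = 1"
    using residue_representatives by blast
  define U where "U n = {x \<in> T. absK S (x ^ (p ^ n) - x) < 1}" for n
  have U: "card (U n) \<le> p ^ n" if "n > 0" for n
  proof -
    define r :: "'k poly" where "r = monom 1 (p ^ n) - monom 1 1"
    have pn: "p ^ n > 1" using one_less_power[OF p_gt_1 that] .
    have deg: "degree r = p ^ n"
      unfolding r_def diff_conv_add_uminus using pn
      by (subst degree_add_eq_left) (auto simp: degree_monom_eq)
    have "card (U n) \<le> degree r"
    proof (rule K.card_roots_mod_le_degree)
      show "absK S (coeff r m) \<le> 1" for m by (auto simp: r_def)
      show "absK S (lead_coeff r) = 1" unfolding deg using pn by (simp add: r_def)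
      show "absK S (poly r x) < 1" if "x \<in> U n" for x
        using that by (simp add: U_def r_def poly_monom)
    qed (use T in \<open>auto simp: U_def\<close>)
    thus ?thesis by (simp add: deg)
  qed
  have "card (\<Union>n\<in>{1..<f}. U n) \<le> (\<Sum>n\<in>{1..<f}. card (U n))" by (rule card_UN_le) simp
  also have "\<dots> \<le> (\<Sum>n\<in>{1..<f}. p ^ n)" by (intro sum_mono U) auto
  also have "\<dots> < card T" using sum_powers_less T by simp
  finally have "\<not> T \<subseteq> (\<Union>n\<in>{1..<f}. U n)"
    using card_mono[of "\<Union>n\<in>{1..<f}. U n" T] T(1) by (force simp: U_def)
  then obtain x where xT: "x \<in> T" and xU: "x \<notin> (\<Union>n\<in>{1..<f}. U n)" by blast
  have x: "\<not> absK S (x ^ (p ^ n) - x) < 1" if "0 < n" "n < f" for n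
    using xT xU that by (simp add: U_def Suc_le_eq)
  show thesis
  proof (rule that[of x])
    show "absK S x \<le> 1" using T xT by auto
    fix n assume "0 < n" "n < f"
    thus "absK S (x ^ (p ^ n) - x) = 1"
      using x[of n] K.le_1_diff[OF K.le_1_power[OF T(3)[OF xT], of "p ^ n"] T(3)[OF xT]] by linarith
  qed
qed

lemma frob_frobi_pow: "(frob S ^^ n) ((frobi ^^ n) x) = x"
proof (induction n)
  case (Suc n)
  have "(frob S ^^ Suc n) y = (frob S ^^ n) (frob S y)" for y by (simp add: funpow_swap1)
  thus ?case using Suc by simp
qed simp

lemma frob_pow_frobi_pow: "i \<le> j \<Longrightarrow> (frob S ^^ j) ((frobi ^^ i) x) = (frob S ^^ (j - i)) x"
  using frob_frobi_pow[of i x] funpow_add[of "j - i" i "frob S"] by simp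

text \<open>The comparison takes place in \<open>K\<close>, before embedding: if the preimages of
  \<open>a\<close> under two powers \<open>i < j\<close> of Frobenius were congruent, applying the
  \<open>j\<close>-th power would give \<open>a ^ p ^ (j - i)\<close> congruent to \<open>a\<close>,
  which the choice of \<open>a\<close> excludes.\<close>

lemma primitive_element:
  "\<exists>a. absK S a \<le> 1 \<and> (\<forall>i<f. \<forall>j<f. i \<noteq> j \<longrightarrow> absF S (emb S i a - emb S j a) = 1)"
proof -
  obtain a where a: "absK S a \<le> 1" "\<And>n. 0 < n \<Longrightarrow> n < f \<Longrightarrow> absK S (a ^ (p ^ n) - a) = 1"
    using residue_generator by blast
  have int: "absK S ((frobi ^^ i) a) \<le> 1" for i
    by (induction i) (auto intro: frobi_integral a)
  interpret fp: field_hom "frob S ^^ n" for n using hom_funpow[OF hom_frob] .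
  have *: "absF S (emb S i a - emb S j a) = 1" if ij: "i < j" "j < f" for i j
  proof -
    have "\<not> absK S ((frobi ^^ i) a - (frobi ^^ j) a) < 1"
    proof
      assume "absK S ((frobi ^^ i) a - (frobi ^^ j) a) < 1"
      hence "absK S ((frob S ^^ j) ((frobi ^^ i) a - (frobi ^^ j) a)) < 1" by (rule frob_pow_less_1)
      hence "absK S ((frob S ^^ (j - i)) a - a) < 1"
        using ij by (simp add: fp.hom_minus frob_pow_frobi_pow)
      hence "absK S (((frob S ^^ (j - i)) a - a) - ((frob S ^^ (j - i)) a - a ^ p ^ (j - i))) < 1"
        by (rule K.diff_less) (intro frob_pow_cong a)
      thus False using a(2)[of "j - i"] ij by simp
    qed
    hence "absK S ((frobi ^^ i) a - (frobi ^^ j) a) = 1"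
      using K.le_1_diff[OF int int, of i j] by simp
    from emb0_unit[OF this] show ?thesis by (simp add: emb_def emb0.hom_minus)
  qed
  have "absF S (emb S i a - emb S j a) = 1" if "i < f" "j < f" "i \<noteq> j" for i j
    using *[of i j] *[of j i] that F.diff_commute[of "emb S i a" "emb S j a"]
    by (cases i j rule: linorder_cases) auto
  thus ?thesis using a(1) by blast
qed

lemma emb_poly: "emb S i (\<Sum>j<n. inclK S (q j) * a ^ j) = (\<Sum>j<n. inclF S (q j) * emb S i a ^ j)"
  by (simp add: emb.hom_sum emb.hom_mult emb.hom_power emb_inclK)

text \<open>Under the embeddings, a relation among the powers of \<open>a\<close> becomes a
  polynomial of degree less than \<open>f\<close> with the \<open>f\<close> distinct roots
  \<open>emb S i a\<close>. So the powers are independent, and there are as many as the degree of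
  \<open>K\<close>.\<close>

lemma power_basis:
  assumes "\<And>i j. i < f \<Longrightarrow> j < f \<Longrightarrow> i \<noteq> j \<Longrightarrow> emb S i a \<noteq> emb S j a"
  shows "\<exists>q. x = (\<Sum>j<f. inclK S (q j) * a ^ j)"
proof (rule K_spanned, unfold VK.indep_family_def, intro allI impI)
  fix c l assume c: "(\<Sum>j<f. inclK S (c j) * a ^ j) = 0" and l: "l < f"
  have "inclF S (c l) = 0"
  proof (rule polyfun_zero_of_many_roots[of "(\<lambda>i. emb S i a) ` {..<f}" f "\<lambda>j. inclF S (c j)"])
    have "inj_on (\<lambda>i. emb S i a) {..<f}" using assms by (auto simp: inj_on_def)
    thus "f \<le> card ((\<lambda>i. emb S i a) ` {..<f})" by (simp add: card_image)
    show "(\<Sum>j<f. inclF S (c j) * x ^ j) = 0" if "x \<in> (\<lambda>i. emb S i a) ` {..<f}" for x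
      using that emb_poly[of _ c a f] c by auto
  qed (use l in auto)
  thus "c l = 0" by simp
qed

text \<open>\<open>\<tau>\<^sub>f(a)\<close> is a root of the minimal polynomial of \<open>a\<close>, which has degree \<open>f\<close>, so it is one of the
  \<open>\<tau>\<^sub>j(a)\<close> with \<open>j < f\<close>; injectivity of \<open>\<tau>\<^sub>0\<close> leaves only \<open>j = 0\<close>.\<close>

lemma emb_f: "emb S f x = emb S 0 x"
proof -
  obtain a where "absK S a \<le> 1"
    and a: "\<And>i j. i < f \<Longrightarrow> j < f \<Longrightarrow> i \<noteq> j \<Longrightarrow> absF S (emb S i a - emb S j a) = 1"
    using primitive_element by blast
  have ne: "emb S i a \<noteq> emb S j a" if "i < f" "j < f" "i \<noteq> j" for i j
    using a[OF that] by auto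
  obtain q where q: "a ^ f = (\<Sum>j<f. inclK S (q j) * a ^ j)" using power_basis[OF ne] by blast
  have root: "emb S i a ^ f = (\<Sum>j<f. inclF S (q j) * emb S i a ^ j)" for i
    using arg_cong[OF q, of "emb S i"] emb_poly[of i q a f] by (simp add: emb.hom_power)
  define X where "X = (\<lambda>i. emb S i a) ` {..<f}"
  have cX: "card X = f" "finite X" unfolding X_def using ne card_image[of "\<lambda>i. emb S i a" "{..<f}"] by (auto simp: inj_on_def)
  have "emb S f a \<in> X"
  proof (rule ccontr)
    assume nX: "emb S f a \<notin> X"
    \<comment> \<open>These are the coefficients of the monic relation satisfied by
      \<open>a\<close>; with \<open>f + 1\<close> distinct roots even the leading coefficient 1
      would vanish.\<close>
    define c where "c j = (if j = f then 1 else - inclF S (q j))" for j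
    have "c f = 0"
    proof (rule polyfun_zero_of_many_roots[of "insert (emb S f a) X" "Suc f"])
      fix x assume "x \<in> insert (emb S f a) X"
      then obtain i where "x = emb S i a" by (auto simp: X_def)
      thus "(\<Sum>j<Suc f. c j * x ^ j) = 0" using root[of i] by (simp add: c_def sum_negf)
    qed (use cX nX in auto)
    thus False by (simp add: c_def)
  qed
  then obtain j where j: "j < f" "emb S f a = emb S j a" by (auto simp: X_def)
  hence "(frobi ^^ f) a = (frobi ^^ j) a" by (simp add: emb_def)
  hence "(frob S ^^ j) ((frobi ^^ f) a) = a" by (simp add: frob_frobi_pow)
  moreover have "(frobi ^^ f) a = (frobi ^^ j) ((frobi ^^ (f - j)) a)"
    using j(1) by (metis add_diff_inverse_nat comp_apply funpow_add not_less_iff_gr_or_eq)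
  ultimately have "(frobi ^^ (f - j)) a = a" by (simp add: frob_frobi_pow)
  hence "emb S (f - j) a = emb S 0 a" by (simp add: emb_def)
  \<comment> \<open>For positive \<open>j\<close> the index \<open>f - j\<close> lies strictly
    between 0 and \<open>f\<close>, where the conjugates are distinct.\<close>
  hence "j = 0" using ne[of "f - j" 0] j by (cases "j = 0") auto
  hence fa: "emb S f a = emb S 0 a" using j by simp
  obtain r where "x = (\<Sum>j<f. inclK S (r j) * a ^ j)" using power_basis[OF ne] by blast
  thus ?thesis by (simp add: emb_poly fa)
qed

lemma prev_less: "prev S i < f"
  using f_pos by (simp add: prev_def)

text \<open>At \<open>i = 0\<close> the index wraps around to \<open>f - 1\<close>; this case rests
  on \<open>emb_f\<close>.\<close>

lemma emb_frob:
  assumes "i < f"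
  shows "emb S i (frob S x) = emb S (prev S i) x"
proof -
  have Suc: "emb S (Suc n) (frob S x) = emb S n x" for n
    by (simp add: emb_def funpow_Suc_right del: funpow.simps(2))
  show ?thesis
  proof (cases i)
    case 0
    hence "prev S i = f - 1" using f_pos by (simp add: prev_def)
    thus ?thesis using 0 Suc[of "f - 1"] f_pos emb_f[of "frob S x"] by simp
  next
    case (Suc n)
    hence "prev S i = n" using assms by (simp add: prev_def)
    thus ?thesis using Suc \<open>\<And>n. emb S (Suc n) (frob S x) = emb S n x\<close> by simp
  qed
qed

section \<open>Idempotents by interpolation\<close>

lemma coeff_prod_integral:
  fixes P :: "'i \<Rightarrow> 'a poly"
  assumes "\<And>m n. m \<in> A \<Longrightarrow> absF S (coeff (P m) n) \<le> 1"
  shows "absF S (coeff (\<Prod>m\<in>A. P m) n) \<le> 1"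
  using assms
proof (induction A arbitrary: n rule: infinite_finite_induct)
  case (insert m A)
  thus ?case by (auto simp: coeff_mult intro!: F.sum_le F.le_1_mult)
qed auto

lemma idem_exists:
  assumes "i < f"
  shows "\<exists>t. set t \<subseteq> ringF S \<times> ringK S \<and>
     (\<forall>l<f. (\<Sum>(x, y)\<leftarrow>t. x * emb S l y) = (if l = i then 1 else 0))"
proof -
  obtain a where aO: "absK S a \<le> 1"
    and a: "\<And>i j. i < f \<Longrightarrow> j < f \<Longrightarrow> i \<noteq> j \<Longrightarrow> absF S (emb S i a - emb S j a) = 1"
    using primitive_element by blast
  have ne: "emb S i a \<noteq> emb S j a" if "i < f" "j < f" "i \<noteq> j" for i j
    using a[OF that] by auto
  \<comment> \<open>The linear factor with value 1 at \<open>emb S i a\<close> and 0 at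
    \<open>emb S m a\<close>. Its denominator is a unit, so the interpolation polynomial has
    integral coefficients.\<close>
  define P where "P m = smult (inverse (emb S i a - emb S m a)) [:- emb S m a, 1:]" for m
  define L where "L = (\<Prod>m\<in>{..<f} - {i}. P m)"
  have evP: "poly (P m) x = (x - emb S m a) / (emb S i a - emb S m a)" for m x
    by (simp add: P_def divide_inverse algebra_simps)
  have ev: "poly L (emb S l a) = (if l = i then 1 else 0)" if l: "l < f" for l
  proof (cases "l = i")
    case True
    thus ?thesis using ne assms unfolding L_def poly_prod evP by (auto intro!: prod.neutral)
  next
    case False
    have "(\<Prod>m\<in>{..<f} - {i}. poly (P m) (emb S l a)) = 0"
      using False l by (intro prod_zero) (auto simp: evP intro!: bexI[of _ l])
    thus ?thesis using False by (simp add: L_def poly_prod)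
  qed
  have P1: "absF S (coeff (P m) n) \<le> 1" if m: "m \<in> {..<f} - {i}" for m n
  proof -
    have "absF S (coeff [:- emb S m a, 1:] n) \<le> 1"
      using emb_integral[OF aO] by (auto simp: coeff_pCons split: nat.split)
    moreover have "absF S (emb S i a - emb S m a) = 1" using a[of i m] m assms by auto
    ultimately show ?thesis unfolding P_def coeff_smult F.mult F.inverse by simp
  qed
  have L1: "absF S (coeff L n) \<le> 1" for n
    unfolding L_def using P1 by (rule coeff_prod_integral)
  \<comment> \<open>The polynomial with coefficients \<open>coeff L j\<close> turns into the tensor
    that is the sum of the \<open>coeff L j\<close> \<otimes> \<open>a ^ j\<close>.\<close>
  define t where "t = map (\<lambda>j. (coeff L j, a ^ j)) [0..<Suc (degree L)]"
  have "(\<Sum>(x, y)\<leftarrow>t. x * emb S l y) = poly L (emb S l a)" for l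
    unfolding t_def poly_altdef map_map comp_def
    by (simp add: sum_list_distinct_conv_sum_set emb.hom_power atLeast0_lessThan_Suc
        flip: lessThan_Suc_atMost atLeast0LessThan)
  moreover have "set t \<subseteq> ringF S \<times> ringK S"
    using L1 K.le_1_power[OF aO] by (auto simp: t_def ringF_def ringK_def)
  ultimately show ?thesis using ev by (intro exI[of _ t]) auto
qed

lemma idem_spec:
  assumes "i < f"
  shows "set (idem S i) \<subseteq> ringF S \<times> ringK S"
    "l < f \<Longrightarrow> (\<Sum>(x, y)\<leftarrow>idem S i. x * emb S l y) = (if l = i then 1 else 0)"
  using someI_ex[OF idem_exists[OF assms]] unfolding idem_def by auto

end

section \<open>Decomposition into components\<close>

context coeff_ring
begin

definition nxt :: "nat \<Rightarrow> nat" where "nxt i = (i + 1) mod f"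

lemma nxt_less: "nxt i < f"
  using f_pos by (simp add: nxt_def)

lemma prev_nxt: "i < f \<Longrightarrow> prev S (nxt i) = i"
  by (cases "i = f - 1") (auto simp: prev_def nxt_def)

lemma nxt_prev: "i < f \<Longrightarrow> nxt (prev S i) = i"
  by (cases i) (auto simp: prev_def nxt_def)

lemma bij_prev: "bij_betw (prev S) {..<f} {..<f}"
  by (rule bij_betw_byWitness[of _ nxt]) (auto simp: prev_nxt nxt_prev prev_less nxt_less)

lemma prev_eq_iff: "i < f \<Longrightarrow> j < f \<Longrightarrow> prev S i = prev S j \<longleftrightarrow> i = j"
  using nxt_prev by metis

end

locale phi_module = coeff_ring S
  for S :: "('q::field_char_0, 'a::field, 'k::field) coeff_data" +
  fixes D :: "('a, 'k, 'v::ab_group_add) fil_phi_module"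
  assumes fpm: "filtered_phi_module S D"
begin

sublocale VF: lin_space "sF D"
  using fpm by (simp add: filtered_phi_module_def lin_space_def)

sublocale VKD: vector_space "sK D"
  using fpm by (simp add: filtered_phi_module_def)

lemma sF_sK: "sF D a (sK D b x) = sK D b (sF D a x)"
  and sF_inclF: "sF D (inclF S q) x = sK D (inclK S q) x"
  and finite_span: "\<exists>B. finite B \<and> VF.span B = UNIV"
  and phi_linear: "Vector_Spaces.linear (sF D) (sF D) (phi D)"
  and phi_sK: "phi D (sK D b x) = sK D (frob S b) (phi D x)"
  and bij_phi: "bij (phi D)"
  and submod_Fil: "submod D UNIV UNIV (Fil D j)"
  and Fil_Suc: "Fil D (j + 1) \<subseteq> Fil D j"
  and Fil_UNIV: "\<exists>j. Fil D j = UNIV"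
  and Fil_0: "\<exists>j. Fil D j = {0}"
  using fpm by (simp_all add: filtered_phi_module_def)

sublocale phi: Vector_Spaces.linear "sF D" "sF D" "phi D" by (rule phi_linear)

lemma Fil_mono: "i \<le> j \<Longrightarrow> Fil D j \<subseteq> Fil D i"
  by (induction j rule: int_ge_induct) (use Fil_Suc in blast)+

lemma submod_iff_subspace:
  "submod D UNIV UNIV M \<longleftrightarrow> VF.subspace M \<and> (\<forall>b. \<forall>x\<in>M. sK D b x \<in> M)"
  by (auto simp: submod_def VF.subspace_def VF.subspace_neg)

lemma submod_mono: "submod D R R' M \<Longrightarrow> T \<subseteq> R \<Longrightarrow> T' \<subseteq> R' \<Longrightarrow> submod D T T' M"
  unfolding submod_def by blast

section \<open>Tensors acting on a module, and the eigenspaces of \<open>K\<close>\<close>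

lemma tensor_act_Nil [simp]: "tensor_act D [] v = 0"
  and tensor_act_Cons [simp]: "tensor_act D ((x, y) # t) v = sF D x (sK D y v) + tensor_act D t v"
  and tensor_act_append [simp]: "tensor_act D (t @ u) v = tensor_act D t v + tensor_act D u v"
  by (auto simp: tensor_act_def)

lemma tensor_act_add: "tensor_act D t (v + w) = tensor_act D t v + tensor_act D t w"
  by (induction t) (auto simp: VF.scale_right_distrib VKD.scale_right_distrib)

lemma tensor_act_0 [simp]: "tensor_act D t 0 = 0"
  by (induction t) auto

lemma tensor_act_sF: "tensor_act D t (sF D a v) = sF D a (tensor_act D t v)"
  by (induction t) (auto simp: VF.scale_right_distrib sF_sK[symmetric] VF.scale_left_commute)

lemma tensor_act_sum: "tensor_act D t (sum g A) = (\<Sum>x\<in>A. tensor_act D t (g x))"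
  by (induction A rule: infinite_finite_induct) (auto simp: tensor_act_add)

lemma tensor_act_in:
  assumes "submod D R R' M" "set t \<subseteq> R \<times> R'" "v \<in> M"
  shows "tensor_act D t v \<in> M"
  using assms(2) by (induction t) (use assms(1,3) in \<open>auto simp: submod_def\<close>)

text \<open>Injectivity of the map from the tensor product to the product of copies of
  \<open>F\<close>, on the level of actions. Identities between tensors can thereby be checked on
  their values under the embeddings.\<close>

lemma tensor_act_eq_0:
  assumes "\<And>l. l < f \<Longrightarrow> (\<Sum>(x, y)\<leftarrow>t. x * emb S l y) = 0"
  shows "tensor_act D t v = 0"
proof -
  obtain a where a: "\<forall>i<f. \<forall>j<f. i \<noteq> j \<longrightarrow> absF S (emb S i a - emb S j a) = 1"
    using primitive_element by blast
  have ne: "emb S i a \<noteq> emb S j a" if "i < f" "j < f" "i \<noteq> j" for i j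
    using a that by force
  have "\<forall>y. \<exists>q. y = (\<Sum>j<f. inclK S (q j) * a ^ j)" using power_basis[OF ne] by blast
  then obtain q where q: "\<And>y. y = (\<Sum>j<f. inclK S (q y j) * a ^ j)" by metis
  \<comment> \<open>The coefficients of the tensor with respect to the basis of powers of
    \<open>a\<close>. If all values of the tensor vanish, they form a polynomial of degree less than
    \<open>f\<close> with \<open>f\<close> roots.\<close>
  define c where "c u j = (\<Sum>(x, y)\<leftarrow>u. x * inclF S (q y j))" for u j
  have c_emb: "(\<Sum>(x, y)\<leftarrow>u. x * emb S l y) = (\<Sum>j<f. c u j * emb S l a ^ j)" for u l
  proof (induction u)
    case (Cons xy u)
    obtain x y where xy: "xy = (x, y)" by force
    have "emb S l y = (\<Sum>j<f. inclF S (q y j) * emb S l a ^ j)"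
      by (subst q[of y]) (simp add: emb_poly)
    thus ?case using Cons by (simp add: xy c_def distrib_right sum.distrib sum_distrib_left mult.assoc)
  qed (simp add: c_def)
  have c_act: "tensor_act D u v = (\<Sum>j<f. sF D (c u j) (sK D (a ^ j) v))" for u
  proof (induction u)
    case (Cons xy u)
    obtain x y where xy: "xy = (x, y)" by force
    have "sK D y v = (\<Sum>j<f. sF D (inclF S (q y j)) (sK D (a ^ j) v))"
      by (subst q[of y]) (simp add: VKD.scale_sum_left sF_inclF)
    thus ?case using Cons
      by (simp add: xy c_def VF.scale_left_distrib sum.distrib VF.scale_sum_right)
  qed (simp add: c_def)
  have "c t j = 0" if "j < f" for j
  proof (rule polyfun_zero_of_many_roots[of "(\<lambda>i. emb S i a) ` {..<f}" f "c t"])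
    have "inj_on (\<lambda>i. emb S i a) {..<f}" using ne by (auto simp: inj_on_def)
    thus "f \<le> card ((\<lambda>i. emb S i a) ` {..<f})" by (simp add: card_image)
  qed (use that assms c_emb[of _ t] in auto)
  thus ?thesis by (simp add: c_act)
qed

abbreviation proj :: "nat \<Rightarrow> 'v \<Rightarrow> 'v" where "proj i \<equiv> tensor_act D (idem S i)"

text \<open>The eigenspace form of the component: it does not mention the tensor chosen in
  \<open>idem\<close>, and it turns the component of a stable subset into an intersection.\<close>

definition comp :: "nat \<Rightarrow> 'v set" where
  "comp i = {v. \<forall>b. sK D b v = sF D (emb S i b) v}"

lemma comp_sK: "v \<in> comp i \<Longrightarrow> sK D b v = sF D (emb S i b) v"
  by (simp add: comp_def)

lemma subspace_comp: "VF.subspace (comp i)"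
  by (rule VF.subspaceI)
    (auto simp: comp_def VF.scale_right_distrib VKD.scale_right_distrib sF_sK[symmetric]
      VF.scale_left_commute)

lemma tensor_act_comp:
  assumes "v \<in> comp l"
  shows "tensor_act D t v = sF D (\<Sum>(x, y)\<leftarrow>t. x * emb S l y) v"
  by (induction t) (auto simp: VF.scale_left_distrib comp_sK[OF assms])

lemma proj_comp: "i < f \<Longrightarrow> l < f \<Longrightarrow> v \<in> comp l \<Longrightarrow> proj i v = (if l = i then v else 0)"
  by (simp add: tensor_act_comp idem_spec)

lemma proj_in_comp:
  assumes "i < f"
  shows "proj i v \<in> comp i"
  unfolding comp_def
proof (intro CollectI allI)
  fix b
  \<comment> \<open>This represents the \<open>i\<close>-th idempotent times 1 \<otimes>
    \<open>b\<close> minus \<open>emb S i b\<close> \<otimes> 1; each embedding annihilates one of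
    the two factors.\<close>
  define t where "t = map (\<lambda>(x, y). (x, b * y)) (idem S i) @ map (\<lambda>(x, y). (- (emb S i b) * x, y)) (idem S i)"
  have 1: "(\<Sum>(x, y)\<leftarrow>map (\<lambda>(x, y). (x, b * y)) u. x * emb S l y) = emb S l b * (\<Sum>(x, y)\<leftarrow>u. x * emb S l y)"
    for l u by (induction u) (auto simp: emb.hom_mult algebra_simps)
  have 2: "(\<Sum>(x, y)\<leftarrow>map (\<lambda>(x, y). (- (emb S i b) * x, y)) u. x * emb S l y)
      = - (emb S i b) * (\<Sum>(x, y)\<leftarrow>u. x * emb S l y)"
    for l u by (induction u) (auto simp: algebra_simps)
  have "tensor_act D t v = 0"
  proof (rule tensor_act_eq_0)
    fix l assume "l < f"
    thus "(\<Sum>(x, y)\<leftarrow>t. x * emb S l y) = 0"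
      unfolding t_def map_append sum_list_append 1 2 by (simp add: idem_spec assms)
  qed
  moreover have "tensor_act D (map (\<lambda>(x, y). (x, b * y)) u) v = sK D b (tensor_act D u v)" for u
    by (induction u) (auto simp: VKD.scale_right_distrib sF_sK)
  moreover have "tensor_act D (map (\<lambda>(x, y). (- (emb S i b) * x, y)) u) v
      = - sF D (emb S i b) (tensor_act D u v)" for u
    by (induction u) (auto simp: VF.scale_right_distrib VF.scale_minus_left)
  ultimately show "sK D b (proj i v) = sF D (emb S i b) (proj i v)"
    by (simp add: t_def)
qed

lemma sum_proj: "(\<Sum>i<f. proj i v) = v"
proof -
  \<comment> \<open>The list represents the sum of all idempotents minus 1.\<close>
  have "tensor_act D ([(- 1, 1)] @ concat (map (idem S) [0..<f])) v = 0"
  proof (rule tensor_act_eq_0)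
    fix l assume l: "l < f"
    have "(\<Sum>(x, y)\<leftarrow>concat (map (idem S) [0..<n]). x * emb S l y) = (if l < n then 1 else 0)"
      if "n \<le> f" for n
      using that l by (induction n) (auto simp: idem_spec)
    thus "(\<Sum>(x, y)\<leftarrow>[(- 1, 1)] @ concat (map (idem S) [0..<f]). x * emb S l y) = 0"
      using l by simp
  qed
  moreover have "tensor_act D (concat (map (idem S) [0..<n])) v = (\<Sum>i<n. proj i v)" for n
    by (induction n) auto
  ultimately show ?thesis by simp
qed

text \<open>The idempotents have integral entries, so stability under the rings of integers is
  enough; the lemma thus serves subspaces and lattices alike.\<close>

lemma component_eq:
  assumes "submod D R R' M" "ringF S \<subseteq> R" "ringK S \<subseteq> R'" "i < f"
  shows "component S D i M = M \<inter> comp i"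
proof -
  have "submod D (ringF S) (ringK S) M" using assms submod_mono by blast
  hence "proj i v \<in> M" if "v \<in> M" for v
    using tensor_act_in idem_spec(1)[OF assms(4)] that by blast
  moreover have "proj i v = v" if "v \<in> comp i" for v
    using proj_comp[OF assms(4,4) that] by simp
  ultimately show ?thesis using proj_in_comp[OF assms(4)]
    unfolding component_def by (auto intro: image_eqI[OF sym])
qed

lemma component_Fil: "i < f \<Longrightarrow> component S D i (Fil D j) = Fil D j \<inter> comp i"
  using submod_Fil by (rule component_eq) auto

lemma phi_comp:
  assumes "i < f" "v \<in> comp (prev S i)"
  shows "phi D v \<in> comp i"
  unfolding comp_def
proof (intro CollectI allI)
  fix b
  have "sK D b (phi D v) = phi D (sK D (frobi b) v)" by (simp add: phi_sK)
  also have "\<dots> = sF D (emb S (prev S i) (frobi b)) (phi D v)"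
    by (simp add: comp_sK[OF assms(2)] phi.scale)
  also have "emb S (prev S i) (frobi b) = emb S i b"
    using emb_frob[OF assms(1), of "frobi b"] by simp
  finally show "sK D b (phi D v) = sF D (emb S i b) (phi D v)" .
qed

text \<open>Frobenius moves each component to the next one, so only one summand of the decomposition
  of \<open>v\<close> contributes. This later cuts a generating sum in the lattice down to a single
  component.\<close>

lemma proj_phi:
  assumes "i < f"
  shows "proj i (phi D v) = phi D (proj (prev S i) v)"
proof -
  have "phi D v = (\<Sum>j<f. phi D (proj j v))"
    by (subst sum_proj[symmetric, of v]) (simp add: phi.sum)
  also have "\<dots> = (\<Sum>j<f. phi D (proj (prev S j) v))"
    using sum.reindex_bij_betw[OF bij_prev, of "\<lambda>j. phi D (proj j v)"] by simp
  finally have "proj i (phi D v) = (\<Sum>j<f. proj i (phi D (proj (prev S j) v)))"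
    by (simp add: tensor_act_sum)
  also have "\<dots> = (\<Sum>j<f. if j = i then phi D (proj (prev S j) v) else 0)"
    using assms by (intro sum.cong refl proj_comp phi_comp proj_in_comp prev_less) auto
  finally show ?thesis using assms by simp
qed

end

section \<open>Lattices over the valuation ring\<close>

lemma exists_argmax_below:
  fixes h :: "nat \<Rightarrow> real"
  assumes "i < n"
  shows "\<exists>m<n. \<forall>l<n. h l \<le> h m"
proof -
  have "Max (h ` {..<n}) \<in> h ` {..<n}" using assms by (intro Max_in) auto
  then obtain m where "m < n" "Max (h ` {..<n}) = h m" by auto
  thus ?thesis using Max_ge[of "h ` {..<n}"] by (metis finite_imageI finite_lessThan imageI lessThan_iff)
qed

section \<open>Bases adapted to chains of subspaces\<close>

context lin_space
begin

lemma finite_dimensional: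
  assumes "finite B" "span B = UNIV"
  shows "\<exists>C. finite_dimensional_vector_space scale C"
proof -
  obtain C where C: "independent C" "UNIV \<subseteq> span C" using basis_exists[of UNIV] by blast
  have "finite C" using independent_span_bound[OF assms(1) C(1)] assms(2) by simp
  thus ?thesis using C by (intro exI[of _ C]) (unfold_locales, auto)
qed

text \<open>Vectors are chosen one at a time. Two invariants are kept: members of dimension at most
  \<open>n\<close> are spanned by initial segments, and members of dimension at least
  \<open>n\<close> contain all vectors chosen so far. The chain may be indexed by all integers,
  since only the dimensions enter.\<close>

lemma basis_adapted_to_chain:
  assumes B: "finite B" "span B = UNIV"
    and sub: "\<And>W. W \<in> C \<Longrightarrow> subspace W"
    and chain: "\<And>W W'. W \<in> C \<Longrightarrow> W' \<in> C \<Longrightarrow> W \<subseteq> W' \<or> W' \<subseteq> W"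
    and V: "V \<in> C" "\<And>W. W \<in> C \<Longrightarrow> W \<subseteq> V"
  shows "\<exists>b. indep_family (dim V) b \<and> (\<forall>W\<in>C. span (b ` {..<dim W}) = W)"
proof -
  obtain E where "finite_dimensional_vector_space scale E" using finite_dimensional[OF B] by blast
  then interpret fd: finite_dimensional_vector_space scale E .
  have spans: "span (b ` {..<dim W}) = W" if "indep_family (dim W) b" "b ` {..<dim W} \<subseteq> W" "W \<in> C" for b W
    using indep_family_spans[OF that(1) B(1)] B(2) that sub by simp
  have "n \<le> dim V \<Longrightarrow> \<exists>b. indep_family n b \<and> (\<forall>W\<in>C. dim W \<le> n \<longrightarrow> span (b ` {..<dim W}) = W) \<and>
      (\<forall>W\<in>C. n \<le> dim W \<longrightarrow> b ` {..<n} \<subseteq> W)" for n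
  proof (induction n)
    case 0
    have "span ((\<lambda>_. 0) ` {..<dim W}) = W" if W: "W \<in> C" "dim W \<le> 0" for W
    proof -
      have d: "dim W = 0" using W(2) by (rule le_0_eq[THEN iffD1])
      show ?thesis using spans[of W "\<lambda>_. 0"] W(1) unfolding d by simp
    qed
    thus ?case by (intro exI[of _ "\<lambda>_. 0"]) simp_all
  next
    case (Suc n)
    then obtain b where b: "indep_family n b" "\<And>W. W \<in> C \<Longrightarrow> dim W \<le> n \<Longrightarrow> span (b ` {..<dim W}) = W"
      "\<And>W. W \<in> C \<Longrightarrow> n \<le> dim W \<Longrightarrow> b ` {..<n} \<subseteq> W" by (auto simp: Suc_le_eq)
    \<comment> \<open>The next vector comes from a member \<open>U\<close> of least dimension above
      \<open>n\<close>, which exists because of \<open>V\<close>. Being in a chain, \<open>U\<close>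
      lies in every member that has to contain the new vector.\<close>
    have "\<exists>W. (W \<in> C \<and> n < dim W) \<and> (\<forall>W'. W' \<in> C \<and> n < dim W' \<longrightarrow> dim W \<le> dim W')"
      by (rule ex_has_least_nat[of "\<lambda>W. W \<in> C \<and> n < dim W" V dim]) (use V(1) Suc.prems in auto)
    then obtain U where U: "U \<in> C" "n < dim U" "\<And>W. W \<in> C \<Longrightarrow> n < dim W \<Longrightarrow> dim U \<le> dim W"
      by blast
    have UW: "U \<subseteq> W" if W: "W \<in> C" "n < dim W" for W
    proof (cases "U \<subseteq> W")
      case False
      hence "W \<subseteq> U" using chain[OF U(1) W(1)] by blast
      thus ?thesis using fd.subspace_dim_equal[of W U] sub W U by auto
    qed
    have "\<not> U \<subseteq> span (b ` {..<n})"
    proof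
      assume "U \<subseteq> span (b ` {..<n})"
      hence "dim U \<le> card (b ` {..<n})" by (rule dim_le_card) simp
      also have "\<dots> \<le> n" using card_image_le[of "{..<n}" b] by simp
      finally show False using U(2) by simp
    qed
    then obtain x where x: "x \<in> U" "x \<notin> span (b ` {..<n})" by blast
    define b' where "b' = b(n := x)"
    have img: "b' ` {..<m} = b ` {..<m}" if "m \<le> n" for m using that by (auto simp: b'_def)
    have "indep_family n b'"
      unfolding indep_family_def
    proof (intro allI impI)
      fix c l assume "(\<Sum>l<n. scale (c l) (b' l)) = 0" "l < n"
      thus "c l = 0" using b(1) unfolding indep_family_def by (simp add: b'_def)
    qed
    hence ind: "indep_family (Suc n) b'"
      using x(2) img[of n] by (simp add: indep_family_Suc) (simp add: b'_def)
    have sub': "b' ` {..<Suc n} \<subseteq> W" if W: "W \<in> C" "Suc n \<le> dim W" for W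
    proof -
      have "b' ` {..<n} \<subseteq> W" unfolding img[OF order_refl] using b(3) W by simp
      moreover have "b' n \<in> W" using UW[OF W(1)] W(2) x(1) by (auto simp: b'_def)
      ultimately show ?thesis by (simp add: lessThan_Suc)
    qed
    have "span (b' ` {..<dim W}) = W" if W: "W \<in> C" "dim W \<le> Suc n" for W
    proof (cases "dim W = Suc n")
      case True
      thus ?thesis using spans[of W b'] ind sub'[of W] W by simp
    qed (use W b(2) img in auto)
    thus ?case using ind sub' by blast
  qed
  from this[of "dim V"] obtain b where
    b: "indep_family (dim V) b" "\<And>W. W \<in> C \<Longrightarrow> dim W \<le> dim V \<Longrightarrow> span (b ` {..<dim W}) = W" by auto
  moreover have "dim W \<le> dim V" if "W \<in> C" for W using V(2)[OF that] by (rule fd.dim_subset)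
  ultimately show ?thesis by blast
qed

end

section \<open>Spans over the valuation ring\<close>

locale nonarch_space = lin_space scale + nonarch_field v
  for scale :: "'a::field \<Rightarrow> 'v::ab_group_add \<Rightarrow> 'v" and v :: "'a \<Rightarrow> real"
begin

definition Ospan :: "nat \<Rightarrow> (nat \<Rightarrow> 'v) \<Rightarrow> 'v set" where
  "Ospan n e = {(\<Sum>l<n. scale (c l) (e l)) | c. \<forall>l<n. v (c l) \<le> 1}"

lemma OspanI: "(\<And>l. l < n \<Longrightarrow> v (c l) \<le> 1) \<Longrightarrow> (\<Sum>l<n. scale (c l) (e l)) \<in> Ospan n e"
  unfolding Ospan_def by blast

lemma OspanE:
  assumes "x \<in> Ospan n e"
  obtains c where "x = (\<Sum>l<n. scale (c l) (e l))" "\<And>l. l < n \<Longrightarrow> v (c l) \<le> 1"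
  using assms unfolding Ospan_def by blast

lemma Ospan_subset_span: "Ospan n e \<subseteq> span (e ` {..<n})"
  by (auto simp: Ospan_def intro: sum_in_span)

lemma Ospan_zero: "0 \<in> Ospan n e"
  using OspanI[of n "\<lambda>_. 0" e] by simp

lemma Ospan_add: "x \<in> Ospan n e \<Longrightarrow> y \<in> Ospan n e \<Longrightarrow> x + y \<in> Ospan n e"
proof (elim OspanE)
  fix c c' assume "x = (\<Sum>l<n. scale (c l) (e l))" "\<And>l. l < n \<Longrightarrow> v (c l) \<le> 1"
    "y = (\<Sum>l<n. scale (c' l) (e l))" "\<And>l. l < n \<Longrightarrow> v (c' l) \<le> 1"
  thus ?thesis using OspanI[of n "\<lambda>l. c l + c' l" e] le_1_add
    by (simp add: scale_left_distrib sum.distrib)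
qed

lemma Ospan_scale: "x \<in> Ospan n e \<Longrightarrow> v a \<le> 1 \<Longrightarrow> scale a x \<in> Ospan n e"
proof (elim OspanE)
  fix c assume "v a \<le> 1" "x = (\<Sum>l<n. scale (c l) (e l))" "\<And>l. l < n \<Longrightarrow> v (c l) \<le> 1"
  thus ?thesis using OspanI[of n "\<lambda>l. a * c l" e] le_1_mult
    by (simp add: scale_sum_right)
qed

lemma Ospan_base: "l < n \<Longrightarrow> e l \<in> Ospan n e"
proof -
  assume l: "l < n"
  have "(\<Sum>m<n. scale (if m = l then 1 else 0) (e m)) = e l"
    using l by (subst sum.mono_neutral_right[of _ "{l}"]) auto
  thus ?thesis using OspanI[of n "\<lambda>m. if m = l then 1 else 0" e] by simp
qed

lemma Ospan_minimal:
  assumes "0 \<in> M" "\<And>x y. x \<in> M \<Longrightarrow> y \<in> M \<Longrightarrow> x + y \<in> M"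
    "\<And>a x. v a \<le> 1 \<Longrightarrow> x \<in> M \<Longrightarrow> scale a x \<in> M" "\<And>l. l < n \<Longrightarrow> e l \<in> M"
  shows "Ospan n e \<subseteq> M"
proof
  fix x assume "x \<in> Ospan n e"
  then obtain c where c: "x = (\<Sum>l<n. scale (c l) (e l))" "\<And>l. l < n \<Longrightarrow> v (c l) \<le> 1" by (auto elim: OspanE)
  have "(\<Sum>l<m. scale (c l) (e l)) \<in> M" if "m \<le> n" for m
    using that by (induction m) (use assms c in auto)
  thus "x \<in> M" using c by simp
qed

lemma Ospan_cong: "(\<And>l. l < n \<Longrightarrow> e l = e' l) \<Longrightarrow> Ospan n e = Ospan n e'"
proof -
  assume "\<And>l. l < n \<Longrightarrow> e l = e' l"
  hence "(\<Sum>l<n. scale (c l) (e l)) = (\<Sum>l<n. scale (c l) (e' l))" for c by simp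
  thus ?thesis by (simp add: Ospan_def)
qed

text \<open>Dividing a relation by its largest coefficient makes it integral with one coefficient
  equal to 1. Hence bases over the valuation ring are independent over the field.\<close>

lemma indep_family_integral:
  assumes "\<And>c. (\<And>l. l < n \<Longrightarrow> v (c l) \<le> 1) \<Longrightarrow> (\<Sum>l<n. scale (c l) (b l)) = 0 \<Longrightarrow> (\<forall>l<n. c l = 0)"
  shows "indep_family n b"
  unfolding indep_family_def
proof (intro allI impI, rule ccontr)
  fix c l assume c: "(\<Sum>l<n. scale (c l) (b l)) = 0" and l: "l < n" "c l \<noteq> 0"
  obtain m where m: "m < n" "\<And>l. l < n \<Longrightarrow> v (c l) \<le> v (c m)"
    using exists_argmax_below[OF l(1), of "\<lambda>l. v (c l)"] by blast
  have cm: "c m \<noteq> 0" using m(2)[OF l(1)] l(2) by (metis eq_0_iff nonneg order_antisym)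
  have "(\<Sum>l<n. scale (c l / c m) (b l)) = scale (1 / c m) (\<Sum>l<n. scale (c l) (b l))"
    by (simp add: scale_sum_right)
  hence "\<forall>l<n. c l / c m = 0"
    using c m cm by (intro assms) (auto simp: divide divide_le_eq)
  thus False using m(1) cm by auto
qed

text \<open>Induction on the length of the flag. The pivot \<open>g j\<close> becomes the last basis
  vector, and the cleared generators \<open>g'\<close> generate exactly the part of the lattice in
  the hyperplane \<open>H n\<close>. The pivot itself is cleared to 0 and stays in the list, so
  \<open>N\<close> does not change.\<close>

lemma lattice_basis_adapted_to_flag:
  assumes "indep_family n b" "\<And>l. l < N \<Longrightarrow> g l \<in> span (b ` {..<n})"
    "span (b ` {..<n}) \<subseteq> span (g ` {..<N})"
  shows "\<exists>e. indep_family n e \<and> (\<forall>m\<le>n. Ospan N g \<inter> span (b ` {..<m}) = Ospan m e \<and>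
    span (e ` {..<m}) = span (b ` {..<m}))"
  using assms
proof (induction n arbitrary: g)
  case 0
  show ?case using Ospan_zero[of N g] by (auto simp: Ospan_def)
next
  case (Suc n)
  define H where "H m = span (b ` {..<m})" for m
  have subH: "subspace (H m)" for m by (simp add: H_def)
  have HSuc: "H (Suc n) = span (insert (b n) (b ` {..<n}))" by (simp add: H_def lessThan_Suc)
  have Hmono: "H m \<subseteq> H m'" if "m \<le> m'" for m m'
    unfolding H_def using that by (intro span_mono image_mono) auto
  have ind: "indep_family n b" "b n \<notin> H n" using Suc.prems(1) by (auto simp: indep_family_Suc H_def)
  have "\<exists>a. g l - scale a (b n) \<in> H n" if "l < N" for l
    using Suc.prems(2)[OF that] unfolding H_def[symmetric] HSuc span_breakdown_eq by (simp add: H_def)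
  then obtain a where a: "\<And>l. l < N \<Longrightarrow> g l - scale (a l) (b n) \<in> H n" by metis
  have "\<exists>l<N. a l \<noteq> 0"
  proof (rule ccontr)
    assume "\<not> ?thesis"
    hence "g ` {..<N} \<subseteq> H n" using a by force
    hence "span (g ` {..<N}) \<subseteq> H n" using subH by (rule span_minimal)
    moreover have "b n \<in> H (Suc n)" by (simp add: HSuc span_base)
    ultimately show False using Suc.prems(3) ind(2) by (auto simp: H_def)
  qed
  then obtain l0 where l0: "l0 < N" "a l0 \<noteq> 0" by blast
  obtain j where j: "j < N" "\<And>l. l < N \<Longrightarrow> v (a l) \<le> v (a j)"
    using exists_argmax_below[OF l0(1), of "\<lambda>l. v (a l)"] by blast
  have aj: "a j \<noteq> 0" using j(2)[OF l0(1)] l0(2) by (metis eq_0_iff nonneg order_antisym)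
  define r where "r l = a l / a j" for l
  have r: "v (r l) \<le> 1" if "l < N" for l using j(2)[OF that] aj by (simp add: r_def divide divide_le_eq)
  define g' where "g' l = g l - scale (r l) (g j)" for l
  have g'H: "g' l \<in> H n" if "l < N" for l
  proof -
    have "g' l = (g l - scale (a l) (b n)) - scale (r l) (g j - scale (a j) (b n))"
      using aj by (simp add: g'_def r_def scale_right_diff_distrib)
    thus ?thesis using a that j(1) subH by (simp add: subspace_diff subspace_scale)
  qed
  have gjH: "s = 0" if "scale s (g j) \<in> H n" for s
  proof (rule ccontr)
    assume s: "s \<noteq> 0"
    have "scale (inverse s) (scale s (g j)) \<in> H n" using that subH by (rule subspace_scale[rotated])
    hence "g j \<in> H n" using s by simp
    hence "g j - (g j - scale (a j) (b n)) \<in> H n" using a[OF j(1)] by (rule subspace_diff[OF subH])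
    hence "scale (a j) (b n) \<in> H n" by simp
    hence "scale (inverse (a j)) (scale (a j) (b n)) \<in> H n" by (rule subspace_scale[OF subH])
    thus False using ind(2) aj by simp
  qed
  have split: "(\<Sum>l<N. scale (c l) (g l)) = (\<Sum>l<N. scale (c l) (g' l)) + scale (\<Sum>l<N. c l * r l) (g j)" for c
    by (simp add: g'_def scale_right_diff_distrib sum_subtractf scale_sum_left)
  have g'sum: "(\<Sum>l<N. scale (c l) (g' l)) \<in> H n" for c
    using g'H subH by (intro subspace_sum subspace_scale) auto
  \<comment> \<open>A combination inside \<open>H n\<close> has no pivot part. This identifies the
    intersection of the lattice with \<open>H n\<close> as the span of \<open>g'\<close>, with the
    same integral coefficients.\<close>
  have inH: "(\<Sum>l<N. scale (c l) (g l)) = (\<Sum>l<N. scale (c l) (g' l))" if "(\<Sum>l<N. scale (c l) (g l)) \<in> H n" for c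
  proof -
    have "(\<Sum>l<N. scale (c l) (g l)) - (\<Sum>l<N. scale (c l) (g' l)) \<in> H n"
      using that g'sum subH by (intro subspace_diff) auto
    hence "(\<Sum>l<N. c l * r l) = 0" using gjH unfolding split by simp
    thus ?thesis unfolding split by simp
  qed
  have "H n \<subseteq> span (g' ` {..<N})"
  proof
    fix h assume h: "h \<in> H n"
    hence "h \<in> span (g ` {..<N})" using Suc.prems(3) Hmono[of n "Suc n"] by (auto simp: H_def)
    then obtain c where "h = (\<Sum>l<N. scale (c l) (g l))" unfolding span_family by auto
    thus "h \<in> span (g' ` {..<N})" using inH[of c] h sum_in_span[of c g' N] by simp
  qed
  then obtain e where e: "indep_family n e"
    "\<And>m. m \<le> n \<Longrightarrow> Ospan N g' \<inter> H m = Ospan m e" "\<And>m. m \<le> n \<Longrightarrow> span (e ` {..<m}) = H m"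
    using Suc.IH[OF ind(1), of g'] g'H by (auto simp: H_def)
  have sub: "Ospan N g' \<subseteq> Ospan N g"
  proof (rule Ospan_minimal)
    fix l assume l: "l < N"
    have "g l + scale (- r l) (g j) \<in> Ospan N g"
      using l j(1) r by (intro Ospan_add Ospan_scale Ospan_base) auto
    thus "g' l \<in> Ospan N g" by (simp add: g'_def)
  qed (auto intro: Ospan_zero Ospan_add Ospan_scale)
  define e' where "e' = e(n := g j)"
  have img: "e' ` {..<m} = e ` {..<m}" if "m \<le> n" for m using that by (auto simp: e'_def)
  have Oe': "Ospan m e' = Ospan m e" if "m \<le> n" for m
    using that by (intro Ospan_cong) (auto simp: e'_def)
  have ind': "indep_family (Suc n) e'"
  proof -
    have "indep_family n e'" unfolding indep_family_def
    proof (intro allI impI)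
      fix c l assume "(\<Sum>l<n. scale (c l) (e' l)) = 0" "l < n"
      thus "c l = 0" using e(1) unfolding indep_family_def by (simp add: e'_def)
    qed
    moreover have "g j \<notin> H n" using gjH[of 1] by auto
    ultimately show ?thesis using e(3)[of n] img[of n] by (simp add: indep_family_Suc) (simp add: e'_def)
  qed
  have small: "Ospan N g \<inter> H m = Ospan m e'" if m: "m \<le> n" for m
  proof -
    have "Ospan N g \<inter> H m \<subseteq> Ospan N g'"
    proof
      fix x assume x: "x \<in> Ospan N g \<inter> H m"
      then obtain c where c: "x = (\<Sum>l<N. scale (c l) (g l))" "\<And>l. l < N \<Longrightarrow> v (c l) \<le> 1"
        by (auto elim: OspanE)
      have "x \<in> H n" using x Hmono[OF m] by auto
      hence "x = (\<Sum>l<N. scale (c l) (g' l))" using c(1) inH by simp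
      thus "x \<in> Ospan N g'" using OspanI[of N c g'] c(2) by simp
    qed
    thus ?thesis using sub e(2)[OF m] Oe'[OF m] by auto
  qed
  have top: "Ospan N g = Ospan (Suc n) e'"
  proof
    show "Ospan N g \<subseteq> Ospan (Suc n) e'"
    proof
      fix x assume "x \<in> Ospan N g"
      then obtain c where c: "x = (\<Sum>l<N. scale (c l) (g l))" "\<And>l. l < N \<Longrightarrow> v (c l) \<le> 1"
        by (auto elim: OspanE)
      have "(\<Sum>l<N. scale (c l) (g' l)) \<in> Ospan n e"
        using g'sum[of c] OspanI[of N c g'] c(2) e(2)[of n] by auto
      moreover have "Ospan n e \<subseteq> Ospan (Suc n) e'"
      proof (rule Ospan_minimal)
        fix l assume "l < n"
        thus "e l \<in> Ospan (Suc n) e'" using Ospan_base[of l "Suc n" e'] by (simp add: e'_def)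
      qed (auto intro: Ospan_zero Ospan_add Ospan_scale)
      moreover have "g j \<in> Ospan (Suc n) e'" using Ospan_base[of n "Suc n" e'] by (simp add: e'_def)
      moreover have "v (\<Sum>l<N. c l * r l) \<le> 1" using c(2) r by (intro sum_le le_1_mult) auto
      ultimately show "x \<in> Ospan (Suc n) e'"
        unfolding c(1) split by (intro Ospan_add Ospan_scale) auto
    qed
    show "Ospan (Suc n) e' \<subseteq> Ospan N g"
    proof (rule Ospan_minimal)
      fix l assume l: "l < Suc n"
      show "e' l \<in> Ospan N g"
      proof (cases "l = n")
        case True
        thus ?thesis using Ospan_base[OF j(1)] by (simp add: e'_def)
      next
        case False
        hence "e l \<in> Ospan n e" using l by (intro Ospan_base) auto
        thus ?thesis using False e(2)[of n] sub by (auto simp: e'_def)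
      qed
    qed (auto intro: Ospan_zero Ospan_add Ospan_scale)
  qed
  have gHS: "g l \<in> H (Suc n)" if "l < N" for l using Suc.prems(2)[OF that] by (simp add: H_def)
  have spn: "span (e' ` {..<Suc n}) = H (Suc n)"
  proof
    have "e ` {..<n} \<subseteq> H n" using e(3)[of n] span_superset[of "e ` {..<n}"] by simp
    hence "e' ` {..<Suc n} \<subseteq> H (Suc n)"
      using gHS[OF j(1)] Hmono[of n "Suc n"] unfolding lessThan_Suc image_insert img[OF order_refl]
      by (auto simp: e'_def)
    thus "span (e' ` {..<Suc n}) \<subseteq> H (Suc n)" using subH by (rule span_minimal)
    have Hn: "H n \<subseteq> span (e' ` {..<Suc n})"
      using e(3)[of n] span_mono[of "e' ` {..<n}" "e' ` {..<Suc n}"] img[of n]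
      by (simp add: lessThan_Suc subset_insertI)
    have "g j - (g j - scale (a j) (b n)) \<in> span (e' ` {..<Suc n})"
    proof (rule span_diff)
      show "g j \<in> span (e' ` {..<Suc n})" by (rule span_base) (auto simp: e'_def)
      show "g j - scale (a j) (b n) \<in> span (e' ` {..<Suc n})" using a[OF j(1)] Hn by blast
    qed
    hence "scale (a j) (b n) \<in> span (e' ` {..<Suc n})" by simp
    hence "scale (inverse (a j)) (scale (a j) (b n)) \<in> span (e' ` {..<Suc n})" by (rule span_scale)
    hence "b n \<in> span (e' ` {..<Suc n})" using aj by simp
    moreover have "b ` {..<n} \<subseteq> H n" unfolding H_def by (rule span_superset)
    ultimately show "H (Suc n) \<subseteq> span (e' ` {..<Suc n})"
      unfolding HSuc using Hn by (intro span_minimal subspace_span) auto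
  qed
  have "Ospan N g \<subseteq> H (Suc n)"
    using subH gHS by (intro Ospan_minimal) (auto intro: subspace_0 subspace_add subspace_scale)
  hence "Ospan N g \<inter> H m = Ospan m e' \<and> span (e' ` {..<m}) = H m" if "m \<le> Suc n" for m
    using that small[of m] top spn e(3)[of m] img[of m] by (cases "m = Suc n") auto
  thus ?case using ind' unfolding H_def by blast
qed

lemma lattice_basis_adapted_to_chain:
  assumes B: "finite B" "span B = UNIV"
    and sub: "\<And>W. W \<in> C \<Longrightarrow> subspace W"
    and chain: "\<And>W W'. W \<in> C \<Longrightarrow> W' \<in> C \<Longrightarrow> W \<subseteq> W' \<or> W' \<subseteq> W"
    and V: "V \<in> C" "\<And>W. W \<in> C \<Longrightarrow> W \<subseteq> V" "span (g ` {..<N}) = V"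
  shows "\<exists>e. indep_family (dim V) e \<and>
    (\<forall>W\<in>C. Ospan N g \<inter> W = Ospan (dim W) e \<and> span (e ` {..<dim W}) = W)"
proof -
  obtain E where "finite_dimensional_vector_space scale E" using finite_dimensional[OF B] by blast
  then interpret fd: finite_dimensional_vector_space scale E .
  obtain b where b: "indep_family (dim V) b" "\<And>W. W \<in> C \<Longrightarrow> span (b ` {..<dim W}) = W"
    using basis_adapted_to_chain[OF B sub chain V(1,2)] by blast
  have "\<exists>e. indep_family (dim V) e \<and> (\<forall>m\<le>dim V. Ospan N g \<inter> span (b ` {..<m}) = Ospan m e \<and>
    span (e ` {..<m}) = span (b ` {..<m}))"
    using b V span_superset[of "g ` {..<N}"] by (intro lattice_basis_adapted_to_flag) auto
  moreover have "dim W \<le> dim V" if "W \<in> C" for W using V(2)[OF that] by (rule fd.dim_subset)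
  ultimately show ?thesis using b(2) by metis
qed


text \<open>Generation of the lattice by the \<open>P powi - j\<close> multiples of \<phi>(Fil^j)
  becomes a matrix identity: writing each \<open>e' l\<close> in this way provides one column of an
  integral right inverse of \<open>M\<close>. Source and target bases are separate, so the lemma
  applies both between neighbouring components and to a whole module.\<close>

lemma divisibility_matrix_right_inverse:
  assumes linear: "Vector_Spaces.linear scale scale \<phi>" and P: "P \<noteq> 0" "v P \<le> 1"
    and M: "\<And>l m. l < n \<Longrightarrow> m < n \<Longrightarrow> v (M l m) \<le> 1"
    and phi_e: "\<And>m. m < n \<Longrightarrow> \<phi> (e m) = (\<Sum>l<n. scale (M l m * P powi \<kappa> m) (e' l))"
    and ind: "indep_family n e'"
    and r: "\<And>j m. m < r j \<Longrightarrow> m < n \<and> j \<le> \<kappa> m"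
    and gen: "\<And>l. l < n \<Longrightarrow> \<exists>J x. finite J \<and> (\<forall>j\<in>J. x j \<in> Ospan (r j) e) \<and>
      e' l = (\<Sum>j\<in>J. scale (P powi - j) (\<phi> (x j)))"
  shows "\<exists>N. (\<forall>m<n. \<forall>l<n. v (N m l) \<le> 1) \<and>
    (\<forall>l<n. \<forall>l'<n. (\<Sum>m<n. M l m * N m l') = (if l = l' then 1 else 0))"
proof -
  interpret \<phi>: Vector_Spaces.linear scale scale \<phi> by (rule linear)
  have "\<exists>N. (\<forall>m<n. v (N m) \<le> 1) \<and> (\<forall>l<n. (\<Sum>m<n. M l m * N m) = (if l = l' then 1 else 0))"
    if l': "l' < n" for l'
  proof -
    obtain J x where J: "finite J" "\<And>j. j \<in> J \<Longrightarrow> x j \<in> Ospan (r j) e"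
      "e' l' = (\<Sum>j\<in>J. scale (P powi - j) (\<phi> (x j)))" using gen[OF l'] by blast
    have "\<exists>c. x j = (\<Sum>m<n. scale (c m) (e m)) \<and> (\<forall>m<n. v (c m) \<le> 1 \<and> (c m \<noteq> 0 \<longrightarrow> j \<le> \<kappa> m))"
      if j: "j \<in> J" for j
    proof -
      obtain c where c: "x j = (\<Sum>m<r j. scale (c m) (e m))" "\<And>m. m < r j \<Longrightarrow> v (c m) \<le> 1"
        using J(2)[OF j] by (auto elim: OspanE)
      have "(\<Sum>m<n. scale (if m < r j then c m else 0) (e m)) = (\<Sum>m<r j. scale (c m) (e m))"
        using r[of n j] by (intro sum.mono_neutral_cong_right) (force, force, simp, simp)
      thus ?thesis using c r[of _ j] by (intro exI[of _ "\<lambda>m. if m < r j then c m else 0"]) auto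
    qed
    then obtain c where c: "\<And>j. j \<in> J \<Longrightarrow> x j = (\<Sum>m<n. scale (c j m) (e m))"
      "\<And>j m. j \<in> J \<Longrightarrow> m < n \<Longrightarrow> v (c j m) \<le> 1" "\<And>j m. j \<in> J \<Longrightarrow> m < n \<Longrightarrow> c j m \<noteq> 0 \<Longrightarrow> j \<le> \<kappa> m"
      by metis
    \<comment> \<open>The factor \<open>P powi \<kappa> m\<close> coming from \<phi> absorbs the
      denominator \<open>P powi j\<close>: the vectors of degree \<open>j\<close> involve only those
      \<open>e m\<close> with \<open>j \<le> \<kappa> m\<close>, so the exponent is nonnegative
      wherever \<open>c j m\<close> is nonzero.\<close>
    define N where "N m = (\<Sum>j\<in>J. c j m * P powi (\<kappa> m - j))" for m
    have N1: "v (N m) \<le> 1" if m: "m < n" for m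
      unfolding N_def
    proof (rule sum_le)
      fix j assume j: "j \<in> J"
      show "v (c j m * P powi (\<kappa> m - j)) \<le> 1"
      proof (cases "c j m = 0")
        case False
        hence "P powi (\<kappa> m - j) = P ^ nat (\<kappa> m - j)" using c(3)[OF j m] by (simp add: power_int_def)
        thus ?thesis using c(2)[OF j m] P(2) by (simp add: le_1_mult le_1_power)
      qed simp
    qed simp
    have "scale (P powi - j) (\<phi> (x j)) = (\<Sum>l<n. scale (\<Sum>m<n. M l m * (c j m * P powi (\<kappa> m - j))) (e' l))"
      if j: "j \<in> J" for j
    proof -
      have "scale (P powi - j) (\<phi> (x j))
          = (\<Sum>m<n. \<Sum>l<n. scale (P powi - j * (c j m * (M l m * P powi \<kappa> m))) (e' l))"
        unfolding c(1)[OF j] by (simp add: \<phi>.sum \<phi>.scale scale_sum_right phi_e)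
      also have "\<dots> = (\<Sum>l<n. \<Sum>m<n. scale (P powi - j * (c j m * (M l m * P powi \<kappa> m))) (e' l))"
        by (rule sum.swap)
      also have "\<dots> = (\<Sum>l<n. scale (\<Sum>m<n. M l m * (c j m * P powi (\<kappa> m - j))) (e' l))"
        using P(1) by (simp add: scale_sum_left power_int_diff power_int_minus field_simps)
      finally show ?thesis .
    qed
    hence "e' l' = (\<Sum>j\<in>J. \<Sum>l<n. scale (\<Sum>m<n. M l m * (c j m * P powi (\<kappa> m - j))) (e' l))"
      unfolding J(3) by (rule sum.cong[OF refl])
    also have "\<dots> = (\<Sum>l<n. scale (\<Sum>j\<in>J. \<Sum>m<n. M l m * (c j m * P powi (\<kappa> m - j))) (e' l))"
      by (subst sum.swap) (simp add: scale_sum_left)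
    also have "\<dots> = (\<Sum>l<n. scale (\<Sum>m<n. M l m * N m) (e' l))"
      by (subst sum.swap) (simp add: N_def sum_distrib_left)
    finally have eq: "(\<Sum>l<n. scale (if l = l' then 1 else 0) (e' l)) = (\<Sum>l<n. scale (\<Sum>m<n. M l m * N m) (e' l))"
      using l' by (subst sum.mono_neutral_right[of _ "{l'}"]) auto
    have "(if l = l' then 1 else 0) = (\<Sum>m<n. M l m * N m)" if "l < n" for l
      using indep_family_coeff_eq[OF ind eq that] .
    thus ?thesis using N1 by (intro exI[of _ N]) auto
  qed
  then obtain N where "\<And>l'. l' < n \<Longrightarrow> (\<forall>m<n. v (N l' m) \<le> 1) \<and>
      (\<forall>l<n. (\<Sum>m<n. M l m * N l' m) = (if l = l' then 1 else 0))" by metis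
  thus ?thesis by (intro exI[of _ "\<lambda>m l. N l m"]) auto
qed

end

section \<open>Adapted bases\<close>

context phi_module
begin

sublocale VO: nonarch_space "sF D" "absF S" ..

lemma is_basis_iff:
  "is_basis D (ringF S) M n b \<longleftrightarrow> M = VO.Ospan n b \<and> VF.indep_family n b"
proof -
  have *: "c ` {..<n} \<subseteq> ringF S \<longleftrightarrow> (\<forall>l<n. absF S (c l) \<le> 1)" for c
    by (auto simp: ringF_def)
  have "(\<forall>c. (\<forall>l<n. absF S (c l) \<le> 1) \<longrightarrow> (\<Sum>l<n. sF D (c l) (b l)) = 0 \<longrightarrow> (\<forall>l<n. c l = 0))
      \<longleftrightarrow> VF.indep_family n b"
    using VO.indep_family_integral[of n b] unfolding VF.indep_family_def by blast
  thus ?thesis unfolding is_basis_def * VO.Ospan_def by blast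
qed

lemma is_basis_UNIV_iff:
  "is_basis D UNIV W n b \<longleftrightarrow> W = VF.span (b ` {..<n}) \<and> VF.indep_family n b"
  unfolding is_basis_def VF.span_family VF.indep_family_def by simp

lemma chain_Fil:
  "Fil D j \<inter> U \<subseteq> Fil D j' \<inter> U \<or> Fil D j' \<inter> U \<subseteq> Fil D j \<inter> U"
  using Fil_mono[of j j'] Fil_mono[of j' j] linear[of j j'] by blast

lemma subspace_Fil: "VF.subspace (Fil D j)"
  using submod_Fil submod_iff_subspace by blast

text \<open>Common denominators without a uniformizer: a coefficient that is not integral has an
  integral inverse, and multiplying by that inverse clears it.\<close>

lemma scale_into_lattice:
  assumes "0 \<in> M" "\<And>x y. x \<in> M \<Longrightarrow> y \<in> M \<Longrightarrow> x + y \<in> M"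
    "\<And>a x. absF S a \<le> 1 \<Longrightarrow> x \<in> M \<Longrightarrow> sF D a x \<in> M" and x: "x \<in> VF.span M"
  shows "\<exists>a. a \<noteq> 0 \<and> absF S a \<le> 1 \<and> sF D a x \<in> M"
  using x
proof (induction rule: VF.span_induct_alt)
  case base
  show ?case using assms(1) by (intro exI[of _ 1]) auto
next
  case (step c x y)
  then obtain a where a: "a \<noteq> 0" "absF S a \<le> 1" "sF D a y \<in> M" by blast
  show ?case
  proof (cases "absF S c \<le> 1")
    case True
    have "sF D (a * c) x \<in> M" using step(1) a True by (intro assms(3) F.le_1_mult)
    hence "sF D (a * c) x + sF D a y \<in> M" using a(3) by (rule assms(2))
    thus ?thesis using a by (intro exI[of _ a]) (simp add: VF.scale_right_distrib)
  next
    case False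
    hence c0: "c \<noteq> 0" by auto
    have "absF S (inverse c) \<le> 1" using False by (simp add: F.inverse inverse_le_1_iff)
    moreover have "sF D a x + sF D (inverse c) (sF D a y) \<in> M"
      using assms(3)[OF a(2) step(1)] assms(3)[OF \<open>absF S (inverse c) \<le> 1\<close> a(3)] by (rule assms(2))
    moreover have "sF D (a * inverse c) (sF D c x + y) = sF D a x + sF D (inverse c) (sF D a y)"
      using c0 by (simp add: VF.scale_right_distrib mult.commute)
    ultimately show ?thesis using a c0 by (intro exI[of _ "a * inverse c"]) (auto intro: F.le_1_mult)
  qed
qed

end

section \<open>Lattices and their components\<close>

locale phi_lattice_module = phi_module S D
  for S :: "('q::field_char_0, 'a::field, 'k::field) coeff_data"
    and D :: "('a, 'k, 'v::ab_group_add) fil_phi_module" +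
  fixes L :: "'v set"
  assumes lattice: "phi_lattice S D L"
begin

lemma submod_L: "submod D (ringF S) (ringK S) L"
  and L_hull: "\<exists>B. finite B \<and> L = submod D (ringF S) (ringK S) hull B"
  and hull_L: "submod D UNIV UNIV hull L = UNIV"
  and phi_L: "x \<in> L \<Longrightarrow> phi D x \<in> L"
  using lattice by (auto simp: phi_lattice_def)

lemma L_zero: "0 \<in> L"
  and L_add: "x \<in> L \<Longrightarrow> y \<in> L \<Longrightarrow> x + y \<in> L"
  and L_sF: "absF S a \<le> 1 \<Longrightarrow> x \<in> L \<Longrightarrow> sF D a x \<in> L"
  and L_sK: "absK S b \<le> 1 \<Longrightarrow> x \<in> L \<Longrightarrow> sK D b x \<in> L"
  using submod_L by (auto simp: submod_def ringF_def ringK_def)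

lemma proj_L: "i < f \<Longrightarrow> x \<in> L \<Longrightarrow> proj i x \<in> L"
  using tensor_act_in[OF submod_L idem_spec(1)] .

lemma submod_FilL: "submod D (ringF S) (ringK S) (FilL D L j)"
  using submod_L submod_Fil[of j] by (auto simp: submod_def FilL_def)

lemma component_L: "i < f \<Longrightarrow> component S D i L = L \<inter> comp i"
  using submod_L by (rule component_eq) auto

lemma component_FilL: "i < f \<Longrightarrow> component S D i (FilL D L j) = Fil D j \<inter> L \<inter> comp i"
  using component_eq[OF submod_FilL] by (simp add: FilL_def)

text \<open>The hull allows scalars from \<open>F\<close> and \<open>K\<close>, but \<open>K\<close>
  acts on each projection of a lattice vector through \<open>F\<close>. So the span over
  \<open>F\<close> alone is already stable.\<close>

lemma span_L: "VF.span L = UNIV"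
proof -
  have "sK D b x \<in> VF.span L" if "x \<in> VF.span L" for b x
  proof -
    have "VF.span L \<subseteq> {x. sK D b x \<in> VF.span L}"
    proof (rule VF.span_minimal)
      show "L \<subseteq> {x. sK D b x \<in> VF.span L}"
      proof
        fix v assume v: "v \<in> L"
        have "sK D b v = (\<Sum>i<f. sF D (emb S i b) (proj i v))"
          by (subst sum_proj[of v, symmetric])
            (simp add: VKD.scale_sum_right comp_sK[OF proj_in_comp])
        also have "\<dots> \<in> VF.span L"
          using v by (intro VF.span_sum VF.span_scale VF.span_base proj_L) auto
        finally show "v \<in> {x. sK D b x \<in> VF.span L}" by simp
      qed
      show "VF.subspace {x. sK D b x \<in> VF.span L}"
        by (rule VF.subspaceI)
          (auto simp: VKD.scale_right_distrib sF_sK[symmetric] VF.span_zero VF.span_add VF.span_scale)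
    qed
    thus ?thesis using that by blast
  qed
  hence "submod D UNIV UNIV (VF.span L)" by (simp add: submod_iff_subspace)
  hence "submod D UNIV UNIV hull L \<subseteq> VF.span L" using VF.span_superset by (intro hull_minimal)
  thus ?thesis using hull_L by auto
qed

lemma saturation: "\<exists>a. a \<noteq> 0 \<and> absF S a \<le> 1 \<and> sF D a x \<in> L"
  using scale_into_lattice[of L x] L_zero L_add L_sF span_L by simp

text \<open>The projections of the generators of \<open>L\<close> suffice over the integers of
  \<open>F\<close> alone, because an integer of \<open>K\<close> acts on the component through its
  integral image under \<open>emb S i\<close>.\<close>

lemma component_generators:
  assumes i: "i < f"
  shows "\<exists>N g. L \<inter> comp i = VO.Ospan N g \<and> VF.span (g ` {..<N}) = comp i"
proof -
  obtain B where B: "finite B" "L = submod D (ringF S) (ringK S) hull B" using L_hull by blast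
  obtain N :: nat and g where g: "proj i ` B = g ` {l. l < N}"
    using finite_imp_nat_seg_image_inj_on[OF finite_imageI[OF B(1), of "proj i"]] by blast
  \<comment> \<open>The vectors whose projection lies in the candidate span form a submodule; it
    contains the generators and hence \<open>L\<close>.\<close>
  have "submod D (ringF S) (ringK S) {v. proj i v \<in> VO.Ospan N g}"
    unfolding submod_def
  proof (intro conjI ballI)
    fix x y assume xy: "x \<in> {v. proj i v \<in> VO.Ospan N g}"
    show "x + y \<in> {v. proj i v \<in> VO.Ospan N g}" if "y \<in> {v. proj i v \<in> VO.Ospan N g}"
      using xy that by (simp add: tensor_act_add VO.Ospan_add)
    have neg: "proj i (- x) = sF D (- 1) (proj i x)"
      using tensor_act_sF[of "idem S i" "- 1" x] by simp
    show "- x \<in> {v. proj i v \<in> VO.Ospan N g}"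
      using xy VO.Ospan_scale[of "proj i x" N g "- 1"] unfolding mem_Collect_eq neg by simp
  next
    fix a x assume "a \<in> ringF S" "x \<in> {v. proj i v \<in> VO.Ospan N g}"
    thus "sF D a x \<in> {v. proj i v \<in> VO.Ospan N g}"
      by (simp add: tensor_act_sF VO.Ospan_scale ringF_def)
  next
    fix b x assume b: "b \<in> ringK S" and x: "x \<in> {v. proj i v \<in> VO.Ospan N g}"
    have "tensor_act D t (sK D b x) = sK D b (tensor_act D t x)" for t
      by (induction t) (auto simp: VKD.scale_right_distrib sF_sK[symmetric] VKD.scale_left_commute)
    hence "proj i (sK D b x) = sF D (emb S i b) (proj i x)"
      using comp_sK[OF proj_in_comp[OF i]] by simp
    thus "sK D b x \<in> {v. proj i v \<in> VO.Ospan N g}"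
      using x b emb_integral by (simp add: VO.Ospan_scale ringK_def)
  qed (simp add: VO.Ospan_zero)
  moreover have "B \<subseteq> {v. proj i v \<in> VO.Ospan N g}"
  proof
    fix v assume "v \<in> B"
    then obtain l where "l < N" "proj i v = g l" using g by blast
    thus "v \<in> {v. proj i v \<in> VO.Ospan N g}" using VO.Ospan_base by simp
  qed
  ultimately have sub: "L \<subseteq> {v. proj i v \<in> VO.Ospan N g}" unfolding B(2) by (rule hull_minimal[rotated])
  have BL: "B \<subseteq> L" unfolding B(2) by (rule hull_subset)
  have gL: "g l \<in> L \<inter> comp i" if "l < N" for l
  proof -
    have "g l \<in> proj i ` B" using g that by blast
    thus ?thesis using proj_L[OF i] proj_in_comp[OF i] BL by auto
  qed
  have eq: "L \<inter> comp i = VO.Ospan N g"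
  proof
    show "L \<inter> comp i \<subseteq> VO.Ospan N g"
      using sub proj_comp[OF i i] by fastforce
    show "VO.Ospan N g \<subseteq> L \<inter> comp i"
      using gL subspace_comp[of i] L_zero L_add L_sF
      by (intro VO.Ospan_minimal)
        (auto intro: VF.subspace_0 VF.subspace_add VF.subspace_scale)
  qed
  have "comp i \<subseteq> VF.span (g ` {..<N})"
  proof
    fix x assume x: "x \<in> comp i"
    obtain a where a: "a \<noteq> 0" "sF D a x \<in> L" using saturation by blast
    have "sF D a x \<in> VO.Ospan N g"
      using eq a x subspace_comp[of i] by (auto intro: VF.subspace_scale)
    hence "sF D a x \<in> VF.span (g ` {..<N})" using VO.Ospan_subset_span by blast
    hence "sF D (inverse a) (sF D a x) \<in> VF.span (g ` {..<N})" by (rule VF.span_scale)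
    thus "x \<in> VF.span (g ` {..<N})" using a by simp
  qed
  moreover have "VF.span (g ` {..<N}) \<subseteq> comp i"
    using gL by (intro VF.span_minimal subspace_comp) auto
  ultimately show ?thesis using eq by blast
qed

lemma component_basis:
  assumes i: "i < f"
  shows "\<exists>e. VF.indep_family (VF.dim (comp i)) e \<and>
    (\<forall>j. Fil D j \<inter> L \<inter> comp i = VO.Ospan (VF.dim (Fil D j \<inter> comp i)) e)"
proof -
  obtain B where B: "finite B" "VF.span B = UNIV" using finite_span by blast
  obtain N g where g: "L \<inter> comp i = VO.Ospan N g" "VF.span (g ` {..<N}) = comp i"
    using component_generators[OF i] by blast
  obtain j0 where "Fil D j0 = UNIV" using Fil_UNIV by blast
  hence "comp i \<in> range (\<lambda>j. Fil D j \<inter> comp i)" by (auto intro: image_eqI[of _ _ j0])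
  hence "\<exists>e. VF.indep_family (VF.dim (comp i)) e \<and>
    (\<forall>W\<in>range (\<lambda>j. Fil D j \<inter> comp i). VO.Ospan N g \<inter> W = VO.Ospan (VF.dim W) e \<and>
      VF.span (e ` {..<VF.dim W}) = W)"
    using g(2) by (intro VO.lattice_basis_adapted_to_chain[OF B])
      (auto intro: VF.subspace_inter subspace_Fil subspace_comp, use chain_Fil in blast)
  then obtain e where e: "VF.indep_family (VF.dim (comp i)) e"
    "\<And>j. VO.Ospan N g \<inter> (Fil D j \<inter> comp i) = VO.Ospan (VF.dim (Fil D j \<inter> comp i)) e" by auto
  moreover have "VO.Ospan N g \<inter> (Fil D j \<inter> comp i) = Fil D j \<inter> L \<inter> comp i" for j
    using g(1) by blast
  ultimately show ?thesis by auto
qed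

text \<open>Every vector has a nonzero multiple in \<open>L\<close>, so intersecting with
  \<open>L\<close> does not change the span.\<close>

lemma dim_FilL: "VF.dim (Fil D j \<inter> L \<inter> comp i) = VF.dim (Fil D j \<inter> comp i)"
proof (rule VF.span_eq_dim, rule antisym)
  show "VF.span (Fil D j \<inter> L \<inter> comp i) \<subseteq> VF.span (Fil D j \<inter> comp i)" by (intro VF.span_mono) auto
  have "Fil D j \<inter> comp i \<subseteq> VF.span (Fil D j \<inter> L \<inter> comp i)"
  proof
    fix x assume x: "x \<in> Fil D j \<inter> comp i"
    obtain a where a: "a \<noteq> 0" "sF D a x \<in> L" using saturation by blast
    have "sF D a x \<in> Fil D j \<inter> L \<inter> comp i"
      using a x subspace_comp[of i] subspace_Fil[of j] by (auto intro: VF.subspace_scale)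
    hence "sF D (inverse a) (sF D a x) \<in> VF.span (Fil D j \<inter> L \<inter> comp i)"
      by (intro VF.span_scale VF.span_base)
    thus "x \<in> VF.span (Fil D j \<inter> L \<inter> comp i)" using a by simp
  qed
  thus "VF.span (Fil D j \<inter> comp i) \<subseteq> VF.span (Fil D j \<inter> L \<inter> comp i)"
    by (intro VF.span_minimal) auto
qed

end

section \<open>Jump counts and Hodge data\<close>

definition decreasing_upto :: "nat \<Rightarrow> (nat \<Rightarrow> int) \<Rightarrow> bool" where
  "decreasing_upto d h \<longleftrightarrow> (\<forall>m n. m \<le> n \<and> n < d \<longrightarrow> h n \<le> h m)"

lemma decreasing_set_eq_lessThan_card:
  assumes "decreasing_upto d h"
  shows "{m. m < d \<and> j \<le> h m} = {..<card {m. m < d \<and> j \<le> h m}}"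
proof -
  let ?A = "{m. m < d \<and> j \<le> h m}"
  have down: "m \<in> ?A" if "n \<in> ?A" "m \<le> n" for m n
    using assms that unfolding decreasing_upto_def by force
  have "n < card ?A" if "n \<in> ?A" for n
  proof -
    have "{..n} \<subseteq> ?A" using down[OF that] by blast
    hence "card {..n} \<le> card ?A" by (rule card_mono[rotated]) simp
    thus ?thesis by simp
  qed
  hence "?A \<subseteq> {..<card ?A}" by blast
  thus ?thesis by (intro card_subset_eq) auto
qed

text \<open>The expected dimension of the filtration step \<open>j\<close>. For decreasing jumps it
  is also the length of the initial segment of an adapted basis lying in that step.\<close>

definition jump_count :: "nat \<Rightarrow> (nat \<Rightarrow> int) \<Rightarrow> int \<Rightarrow> nat" where
  "jump_count d h j = card {m. m < d \<and> j \<le> h m}"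

lemma less_jump_count_iff:
  assumes "decreasing_upto d h"
  shows "m < jump_count d h j \<longleftrightarrow> m < d \<and> j \<le> h m"
  using decreasing_set_eq_lessThan_card[of d h j] assms unfolding jump_count_def by blast

lemma jump_count_Suc: "jump_count d h j = card {m. m < d \<and> h m = j} + jump_count d h (j + 1)"
proof -
  have "{m. m < d \<and> j \<le> h m} = {m. m < d \<and> h m = j} \<union> {m. m < d \<and> j + 1 \<le> h m}" by auto
  moreover have "{m. m < d \<and> h m = j} \<inter> {m. m < d \<and> j + 1 \<le> h m} = {}" by auto
  ultimately show ?thesis unfolding jump_count_def
    using card_Un_disjoint[of "{m. m < d \<and> h m = j}" "{m. m < d \<and> j + 1 \<le> h m}"] by simp
qed

locale hodge_lattice = phi_lattice_module S D L
  for S :: "('q::field_char_0, 'a::field, 'k::field) coeff_data"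
    and D :: "('a, 'k, 'v::ab_group_add) fil_phi_module" and L +
  fixes d :: nat and k :: "nat \<Rightarrow> nat \<Rightarrow> int"
  assumes hodge: "has_hodge_data S d k D"
    and decreasing: "\<forall>i<f. decreasing_upto d (k i)"
begin

abbreviation "r i j \<equiv> jump_count d (k i) j"

lemma hodge_jump:
  "i < f \<Longrightarrow> int (VF.dim (Fil D j \<inter> comp i)) - int (VF.dim (Fil D (j + 1) \<inter> comp i))
    = int (card {m. m < d \<and> k i m = j})"
  using hodge component_Fil by (simp add: has_hodge_data_def)

lemma zero_in_Fil: "0 \<in> Fil D j"
  using VF.subspace_0[OF subspace_Fil] .

text \<open>The Hodge data prescribe only differences of dimensions. In a degree where the
  filtration vanishes both sides are 0, and descending induction does the rest.\<close>

lemma dim_Fil_comp: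
  assumes i: "i < f"
  shows "VF.dim (Fil D j \<inter> comp i) = r i j"
proof -
  obtain j0 where j0: "Fil D j0 = {0}" using Fil_0 by blast
  have F0: "Fil D j \<inter> comp i = {0}" if "j0 \<le> j" for j
    using Fil_mono[OF that] j0 zero_in_Fil[of j] VF.subspace_0[OF subspace_comp, of i] by auto
  have high: "VF.dim (Fil D j \<inter> comp i) = 0 \<and> r i j = 0" if j: "j0 \<le> j" for j
  proof -
    have "card {m. m < d \<and> k i m = j'} = 0" if "j0 \<le> j'" for j'
      using hodge_jump[OF i, of j'] F0[of j'] F0[of "j' + 1"] that by simp
    hence "{m. m < d \<and> k i m = j'} = {}" if "j0 \<le> j'" for j' using that by simp
    hence none: "k i m \<noteq> j'" if "j0 \<le> j'" "m < d" for j' m using that by blast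
    have "m \<notin> {m. m < d \<and> j \<le> k i m}" for m using j none[of "k i m" m] by auto
    hence "{m. m < d \<and> j \<le> k i m} = {}" by blast
    moreover have "VF.dim {0} = 0" using VF.dim_eq_card_independent[of "{}"] VF.span_eq_dim[of "{}" "{0}"]
      by (simp add: VF.independent_empty VF.span_insert_0)
    ultimately show ?thesis using F0[OF j] unfolding jump_count_def by simp
  qed
  show ?thesis
  proof (cases "j0 \<le> j")
    case False
    hence "j \<le> j0" by simp
    thus ?thesis
    proof (induction j rule: int_le_induct)
      case base
      thus ?case using high[of j0] by simp
    next
      case (step j)
      thus ?case using hodge_jump[OF i, of "j - 1"] jump_count_Suc[of d "k i" "j - 1"] by simp
    qed
  qed (use high in auto)
qed

text \<open>A jump below \<open>j\<close> would be a drop of the filtration in a range where it is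
  still everything.\<close>

lemma r_eq_d:
  assumes i: "i < f" and j: "Fil D j = UNIV"
  shows "r i j = d"
proof -
  have "j \<le> k i m" if m: "m < d" for m
  proof (rule ccontr)
    assume "\<not> j \<le> k i m"
    hence "Fil D (k i m) = UNIV" "Fil D (k i m + 1) = UNIV"
      using Fil_mono[of "k i m" j] Fil_mono[of "k i m + 1" j] j by auto
    hence "card {n. n < d \<and> k i n = k i m} = 0" using hodge_jump[OF i, of "k i m"] by simp
    thus False using m by auto
  qed
  hence "{m. m < d \<and> j \<le> k i m} = {..<d}" by auto
  thus ?thesis by (simp add: jump_count_def)
qed

lemma less_r_iff: "i < f \<Longrightarrow> m < r i j \<longleftrightarrow> m < d \<and> j \<le> k i m"
  using less_jump_count_iff[of d "k i" m j] decreasing by blast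

lemma dim_comp: "i < f \<Longrightarrow> VF.dim (comp i) = d"
  using Fil_UNIV r_eq_d dim_Fil_comp by (metis inf_top_left)

lemma r_le_d: "i < f \<Longrightarrow> r i j \<le> d"
  using less_r_iff[of i d j] by (meson not_le less_irrefl)

text \<open>The condition on the lattice itself is the one for a degree in which the filtration is
  everything, and independence passes to initial segments.\<close>

lemma adapted_basis_iff:
  assumes i: "i < f"
  shows "adapted_basis S d D L i e \<longleftrightarrow>
    VF.indep_family d e \<and> (\<forall>j. Fil D j \<inter> L \<inter> comp i = VO.Ospan (r i j) e)"
proof -
  obtain j0 where j0: "Fil D j0 = UNIV" using Fil_UNIV by blast
  have "L \<inter> comp i = Fil D j0 \<inter> L \<inter> comp i" "r i j0 = d" using j0 r_eq_d[OF i] by auto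
  thus ?thesis unfolding adapted_basis_def is_basis_iff component_L[OF i] component_FilL[OF i]
      dim_FilL dim_Fil_comp[OF i]
    using VF.indep_family_mono[OF _ r_le_d[OF i]] by metis
qed

lemma adapted_basisD:
  assumes "i < f" "adapted_basis S d D L i e"
  shows "VF.indep_family d e" "Fil D j \<inter> L \<inter> comp i = VO.Ospan (r i j) e"
    "L \<inter> comp i = VO.Ospan d e" "m < d \<Longrightarrow> e m \<in> Fil D (k i m)" "m < d \<Longrightarrow> e m \<in> L"
    "m < d \<Longrightarrow> e m \<in> comp i"
proof -
  note * = assms(2)[unfolded adapted_basis_iff[OF assms(1)]]
  show "VF.indep_family d e" "Fil D j \<inter> L \<inter> comp i = VO.Ospan (r i j) e" using * by auto
  show L: "L \<inter> comp i = VO.Ospan d e"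
    using assms(2) unfolding adapted_basis_def is_basis_iff component_L[OF assms(1)] by blast
  show "e m \<in> L" "e m \<in> comp i" if "m < d" using L VO.Ospan_base[OF that, of e] by auto
  show "e m \<in> Fil D (k i m)" if "m < d"
    using * VO.Ospan_base[of m "r i (k i m)" e] that less_r_iff[OF assms(1)] by auto
qed

lemma adapted_basis_exists: "i < f \<Longrightarrow> \<exists>e. adapted_basis S d D L i e"
  using component_basis[of i] adapted_basis_iff[of i] dim_comp[of i] dim_Fil_comp[of i] by auto

end

section \<open>Integral and parabolic matrices\<close>

lemma jump_count_le: "jump_count d h j \<le> d"
  using card_mono[of "{..<d}" "{m. m < d \<and> j \<le> h m}"] by (auto simp: jump_count_def)

section \<open>Products, inverses and block triangular matrices\<close>

lemma index_mult_mat_sum: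
  assumes "A \<in> carrier_mat n m" "B \<in> carrier_mat m r" "i < n" "j < r"
  shows "(A * B) $$ (i, j) = (\<Sum>l<m. A $$ (i, l) * B $$ (l, j))"
  using assms by (simp add: scalar_prod_def atLeast0LessThan)

lemma minv_eq:
  fixes A :: "'x::field mat"
  assumes "A \<in> carrier_mat n n" "B \<in> carrier_mat n n" "A * B = 1\<^sub>m n"
  shows "minv A = B"
proof -
  have BA: "B * A = 1\<^sub>m n" using assms by (rule mat_mult_left_right_inverse)
  have "A \<in> Units (ring_mat TYPE('x) n ())"
    using assms BA unfolding Units_def by (auto simp: ring_mat_simps)
  then obtain B' where B': "mat_inverse A = Some B'"
    using mat_inverse(1)[OF assms(1), where b = "()"] by (cases "mat_inverse A") auto
  hence AB': "A * B' = 1\<^sub>m n" and B'c: "B' \<in> carrier_mat n n" using mat_inverse(2)[OF assms(1)] by auto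
  have "B' = (B * A) * B'" using BA B'c by simp
  also have "\<dots> = B * (A * B')" using assoc_mult_mat[OF assms(2,1) B'c] .
  also have "\<dots> = B" using AB' assms(2) by simp
  finally have "B' = B" .
  thus ?thesis using B' by simp
qed

lemma mat_inverse_apply:
  fixes x :: "nat \<Rightarrow> 'x::comm_ring_1"
  assumes "T \<in> carrier_mat d d" "U \<in> carrier_mat d d" "U * T = 1\<^sub>m d" "m < d"
  shows "(\<Sum>l<d. U $$ (m, l) * (\<Sum>j<d. T $$ (l, j) * x j)) = x m"
proof -
  have "(\<Sum>l<d. U $$ (m, l) * (\<Sum>j<d. T $$ (l, j) * x j)) = (\<Sum>l<d. \<Sum>j<d. U $$ (m, l) * T $$ (l, j) * x j)"
    by (simp add: sum_distrib_left mult.assoc)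
  also have "\<dots> = (\<Sum>j<d. (U * T) $$ (m, j) * x j)"
    using assms(1,2,4)
    by (subst sum.swap, intro sum.cong refl)
      (simp add: index_mult_mat_sum[of _ d d _ d] sum_distrib_right del: index_mult_mat)
  also have "\<dots> = x m"
    using assms(4) unfolding assms(3) by (subst sum.mono_neutral_right[of _ "{m}"]) auto
  finally show ?thesis .
qed

text \<open>The upper left block \<open>P\<close> of \<open>C\<close> is invertible, since a kernel
  vector of \<open>P\<close> extended by zeros would be one of \<open>C\<close>. A lower row of
  \<open>B\<close>, cut off at \<open>r\<close>, is annihilated by \<open>P\<close> from the right,
  hence zero.\<close>

lemma inverse_block_triangular:
  fixes C :: "'x::field mat"
  assumes C: "C \<in> carrier_mat d d" and B: "B \<in> carrier_mat d d" and BC: "B * C = 1\<^sub>m d" and r: "r \<le> d"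
    and zero: "\<And>a b. r \<le> a \<Longrightarrow> a < d \<Longrightarrow> b < r \<Longrightarrow> C $$ (a, b) = 0"
    and ab: "r \<le> a" "a < d" "b < r"
  shows "B $$ (a, b) = 0"
proof -
  define P where "P = mat r r (\<lambda>(i, j). C $$ (i, j))"
  have P: "P \<in> carrier_mat r r" by (simp add: P_def)
  have "det P \<noteq> 0"
  proof
    assume "det P = 0"
    then obtain x where x: "x \<in> carrier_vec r" "x \<noteq> 0\<^sub>v r" "P *\<^sub>v x = 0\<^sub>v r"
      using det_0_iff_vec_prod_zero_field[OF P] by blast
    define y where "y = vec d (\<lambda>i. if i < r then x $ i else 0)"
    have y: "y \<in> carrier_vec d" by (simp add: y_def)
    have "C *\<^sub>v y = 0\<^sub>v d"
    proof (rule eq_vecI)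
      fix i assume "i < dim_vec (0\<^sub>v d)"
      hence i: "i < d" by simp
      have "(C *\<^sub>v y) $ i = (\<Sum>l<d. C $$ (i, l) * y $ l)"
        using C y i by (simp add: scalar_prod_def atLeast0LessThan)
      also have "\<dots> = (\<Sum>l<r. C $$ (i, l) * x $ l)"
        using r by (intro sum.mono_neutral_cong_right) (auto simp: y_def)
      also have "\<dots> = 0"
      proof (cases "i < r")
        case True
        have "(P *\<^sub>v x) $ i = (\<Sum>l<r. C $$ (i, l) * x $ l)"
          using True x(1) by (simp add: P_def scalar_prod_def atLeast0LessThan)
        thus ?thesis using x(3) True by simp
      qed (use zero i in auto)
      finally show "(C *\<^sub>v y) $ i = 0\<^sub>v d $ i" using i by simp
    qed (use C in simp)
    hence "(B * C) *\<^sub>v y = 0\<^sub>v d" using assoc_mult_mat_vec[OF B C y] B by auto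
    hence y0: "y = 0\<^sub>v d" using BC y by simp
    have "x $ i = 0" if "i < r" for i
      using arg_cong[OF y0, of "\<lambda>z. z $ i"] that r by (simp add: y_def)
    hence "x = 0\<^sub>v r" using x(1) by (intro eq_vecI) auto
    thus False using x(2) by simp
  qed
  hence "det (transpose_mat P) \<noteq> 0" by (simp add: det_transpose[OF P])
  define z where "z = vec r (\<lambda>c. B $$ (a, c))"
  have "transpose_mat P *\<^sub>v z = 0\<^sub>v r"
  proof (rule eq_vecI)
    fix j assume "j < dim_vec (0\<^sub>v r)"
    hence j: "j < r" by simp
    have "(transpose_mat P *\<^sub>v z) $ j = (\<Sum>c<r. B $$ (a, c) * C $$ (c, j))"
      using j by (simp add: P_def z_def scalar_prod_def atLeast0LessThan mult.commute)
    also have "\<dots> = (\<Sum>c<d. B $$ (a, c) * C $$ (c, j))"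
      using r zero j by (intro sum.mono_neutral_left) auto
    also have "\<dots> = (B * C) $$ (a, j)" using index_mult_mat_sum[OF B C ab(2)] j r by simp
    also have "\<dots> = 0" unfolding BC using ab j r by simp
    finally show "(transpose_mat P *\<^sub>v z) $ j = 0\<^sub>v r $ j" using j by simp
  qed (simp add: P_def)
  moreover have "z \<in> carrier_vec r" by (simp add: z_def)
  ultimately have "z = 0\<^sub>v r"
    using det_0_iff_vec_prod_zero_field[of "transpose_mat P" r] \<open>det (transpose_mat P) \<noteq> 0\<close> P
    by auto
  from arg_cong[OF this, of "\<lambda>z. z $ b"] show ?thesis using ab(3) by (simp add: z_def)
qed

section \<open>Matrices over the integers of \<open>F\<close>\<close>

context coeff_ring
begin

definition integral_mat :: "nat \<Rightarrow> 'a mat \<Rightarrow> bool" where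
  "integral_mat n A \<longleftrightarrow> A \<in> carrier_mat n n \<and> (\<forall>i<n. \<forall>j<n. absF S (A $$ (i, j)) \<le> 1)"

lemma integral_mat_iff: "A \<in> carrier_mat n n \<and> elements_mat A \<subseteq> ringF S \<longleftrightarrow> integral_mat n A"
proof -
  have "elements_mat A \<subseteq> ringF S \<longleftrightarrow> (\<forall>i<n. \<forall>j<n. absF S (A $$ (i, j)) \<le> 1)" if A: "A \<in> carrier_mat n n"
  proof
    assume L: "elements_mat A \<subseteq> ringF S"
    show "\<forall>i<n. \<forall>j<n. absF S (A $$ (i, j)) \<le> 1"
      using elements_matI[OF A _ _ refl] L by (auto simp: ringF_def)
  next
    assume R: "\<forall>i<n. \<forall>j<n. absF S (A $$ (i, j)) \<le> 1"
    show "elements_mat A \<subseteq> ringF S"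
    proof
      fix a assume "a \<in> elements_mat A"
      then obtain i j where "i < n" "j < n" "a = A $$ (i, j)" using elements_matD[of a A] carrier_matD[OF A] by auto
      thus "a \<in> ringF S" using R by (simp add: ringF_def)
    qed
  qed
  thus ?thesis by (auto simp: integral_mat_def)
qed

lemma GLO_iff: "A \<in> GLO S n \<longleftrightarrow> integral_mat n A \<and> (\<exists>B. integral_mat n B \<and> A * B = 1\<^sub>m n)"
proof
  assume "A \<in> GLO S n"
  thus "integral_mat n A \<and> (\<exists>B. integral_mat n B \<and> A * B = 1\<^sub>m n)"
    unfolding GLO_def integral_mat_iff[symmetric] by blast
next
  assume *: "integral_mat n A \<and> (\<exists>B. integral_mat n B \<and> A * B = 1\<^sub>m n)"
  then obtain B where B: "integral_mat n B" "A * B = 1\<^sub>m n" by blast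
  have "B * A = 1\<^sub>m n"
    using mat_mult_left_right_inverse[of A n B] * B by (auto simp: integral_mat_def)
  thus "A \<in> GLO S n" using * B unfolding GLO_def integral_mat_iff[symmetric] by blast
qed

lemma GLO_carrier: "A \<in> GLO S n \<Longrightarrow> A \<in> carrier_mat n n"
  by (simp add: GLO_def)

lemma GLO_integral: "A \<in> GLO S n \<Longrightarrow> i < n \<Longrightarrow> j < n \<Longrightarrow> absF S (A $$ (i, j)) \<le> 1"
  by (simp add: GLO_iff integral_mat_def)

lemma GLO_minv:
  assumes "A \<in> GLO S n"
  shows "minv A \<in> GLO S n" "A * minv A = 1\<^sub>m n" "minv A * A = 1\<^sub>m n" "minv A \<in> carrier_mat n n"
proof -
  obtain B where B: "integral_mat n A" "integral_mat n B" "A * B = 1\<^sub>m n" using assms GLO_iff by blast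
  hence c: "A \<in> carrier_mat n n" "B \<in> carrier_mat n n" by (auto simp: integral_mat_def)
  have m: "minv A = B" using minv_eq[OF c B(3)] .
  have BA: "B * A = 1\<^sub>m n" using mat_mult_left_right_inverse[OF c B(3)] .
  show "minv A \<in> GLO S n" using B BA m GLO_iff by blast
  show "A * minv A = 1\<^sub>m n" "minv A * A = 1\<^sub>m n" "minv A \<in> carrier_mat n n" using m B BA c by auto
qed

lemma integral_mat_mult: "integral_mat n A \<Longrightarrow> integral_mat n B \<Longrightarrow> integral_mat n (A * B)"
  unfolding integral_mat_def
proof (intro conjI allI impI)
  fix i j assume *: "A \<in> carrier_mat n n \<and> (\<forall>i<n. \<forall>j<n. absF S (A $$ (i, j)) \<le> 1)"
    "B \<in> carrier_mat n n \<and> (\<forall>i<n. \<forall>j<n. absF S (B $$ (i, j)) \<le> 1)" "i < n" "j < n"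
  have "(A * B) $$ (i, j) = (\<Sum>l<n. A $$ (i, l) * B $$ (l, j))"
    using * by (intro index_mult_mat_sum[of A n n B n]) auto
  thus "absF S ((A * B) $$ (i, j)) \<le> 1" using * by (auto intro!: F.sum_le F.le_1_mult)
qed auto

lemma GLO_mult:
  assumes "A \<in> GLO S n" "B \<in> GLO S n"
  shows "A * B \<in> GLO S n"
proof -
  note c = GLO_carrier[OF assms(1)] GLO_carrier[OF assms(2)]
    GLO_minv(4)[OF assms(1)] GLO_minv(4)[OF assms(2)]
  have "(A * B) * (minv B * minv A) = A * (B * minv B) * minv A"
    using c by (simp add: assoc_mult_mat[of _ n n _ n _ n] mult_carrier_mat[of _ n n _ n])
  also have "\<dots> = 1\<^sub>m n" using c GLO_minv(2) assms by simp
  finally show ?thesis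
    using assms GLO_minv(1)[OF assms(1)] GLO_minv(1)[OF assms(2)] integral_mat_mult
    unfolding GLO_iff by blast
qed

lemma GLO_one: "1\<^sub>m n \<in> GLO S n"
  unfolding GLO_iff integral_mat_def by (intro conjI exI[of _ "1\<^sub>m n"]) auto

lemma det_integral: "integral_mat n A \<Longrightarrow> absF S (det A) \<le> 1"
proof -
  assume A: "integral_mat n A"
  hence d: "det A = (\<Sum>\<pi>\<in>{\<pi>. \<pi> permutes {0..<n}}. signof \<pi> * (\<Prod>i = 0..<n. A $$ (i, \<pi> i)))"
    unfolding integral_mat_def by (intro det_def') auto
  show ?thesis unfolding d
  proof (rule F.sum_le)
    fix \<pi> assume "\<pi> \<in> {\<pi>. \<pi> permutes {0..<n}}"
    hence p: "\<pi> i < n" if "i < n" for i using that permutes_in_image[of \<pi> "{0..<n}" i] by auto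
    have "absF S (\<Prod>i = 0..<n. A $$ (i, \<pi> i)) \<le> 1"
      unfolding F.prod using A p by (intro prod_le_1) (auto simp: integral_mat_def)
    moreover have "absF S (signof \<pi>) = 1" by (auto simp: sign_def)
    ultimately show "absF S (signof \<pi> * (\<Prod>i = 0..<n. A $$ (i, \<pi> i))) \<le> 1"
      by (simp add: F.mult)
  qed simp
qed

lemma of_nat_p_nonzero: "(of_nat p :: 'a) \<noteq> 0"
  using absF_p p_gt_1 F.zero by (metis divide_eq_0_iff not_one_less_zero of_nat_eq_0_iff zero_neq_one)

lemma Delta_carrier [simp]: "Delta S d h \<in> carrier_mat d d"
  by (simp add: Delta_def mat_diag_def)

lemma Delta_minv: "Delta S d h * minv (Delta S d h) = 1\<^sub>m d" "minv (Delta S d h) * Delta S d h = 1\<^sub>m d"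
    "minv (Delta S d h) \<in> carrier_mat d d"
proof -
  have 1: "Delta S d h * mat_diag d (\<lambda>m. of_nat p powi - h m) = 1\<^sub>m d"
    unfolding Delta_def mat_diag_diag using of_nat_p_nonzero
    by (simp add: power_int_minus mat_diag_one)
  have m: "minv (Delta S d h) = mat_diag d (\<lambda>m. of_nat p powi - h m)"
    by (rule minv_eq[OF Delta_carrier mat_diag_dim 1])
  show "Delta S d h * minv (Delta S d h) = 1\<^sub>m d" "minv (Delta S d h) \<in> carrier_mat d d"
    using 1 unfolding m by (auto simp: mat_diag_dim)
  from mat_mult_left_right_inverse[OF Delta_carrier this(2,1)]
  show "minv (Delta S d h) * Delta S d h = 1\<^sub>m d" .
qed

lemma mult_Delta_index:
  "A \<in> carrier_mat d d \<Longrightarrow> l < d \<Longrightarrow> m < d \<Longrightarrow>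
    (A * Delta S d h) $$ (l, m) = A $$ (l, m) * of_nat p powi h m"
  by (simp add: Delta_def mat_diag_mult_right)

text \<open>Without inverses the relation equates two matrices of the same shape, namely those
  expressing \<phi> after a change of source and of target basis. Computations with the relation use
  this form.\<close>

lemma twist_eq_iff:
  assumes "A \<in> carrier_mat d d" "B \<in> carrier_mat d d" "C \<in> GLO S d" "C' \<in> GLO S d"
  shows "B = C * A * Delta S d h * minv C' * minv (Delta S d h) \<longleftrightarrow>
    B * Delta S d h * C' = C * A * Delta S d h"
proof -
  let ?E = "Delta S d h"
  note c = assms(1,2) GLO_carrier[OF assms(3)] GLO_carrier[OF assms(4)] GLO_minv(4)[OF assms(4)]
    Delta_carrier[of d h] Delta_minv(3)[of d h]
  note a = assoc_mult_mat[of _ d d _ d _ d] mult_carrier_mat[of _ d d _ d]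
  show ?thesis
  proof
    assume B: "B = C * A * ?E * minv C' * minv ?E"
    have "B * ?E * C' = C * A * ?E * minv C' * (minv ?E * ?E) * C'" unfolding B using c by (simp add: a)
    also have "\<dots> = C * A * ?E * (minv C' * C')" using c Delta_minv(2) by (simp add: a)
    also have "\<dots> = C * A * ?E" using c GLO_minv(3)[OF assms(4)] by (simp add: a right_mult_one_mat[of _ d d])
    finally show "B * ?E * C' = C * A * ?E" .
  next
    assume B: "B * ?E * C' = C * A * ?E"
    have "C * A * ?E * minv C' * minv ?E = B * ?E * (C' * minv C') * minv ?E"
      unfolding B[symmetric] using c by (simp add: a)
    also have "\<dots> = B * (?E * minv ?E)" using c GLO_minv(2)[OF assms(4)] by (simp add: a)
    also have "\<dots> = B" using c Delta_minv(1)[of d h] by simp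
    finally show "B = C * A * ?E * minv C' * minv ?E" ..
  qed
qed

text \<open>The vanishing condition is rewritten from block bounds to comparisons of jumps.
  Invertibility of the diagonal blocks is proved from it: \<open>minv C\<close> is block triangular
  too, so its diagonal blocks invert those of \<open>C\<close>.\<close>

lemma parabolic_iff:
  assumes anti: "decreasing_upto d h"
  shows "C \<in> parabolic S d h \<longleftrightarrow> C \<in> GLO S d \<and> (\<forall>a<d. \<forall>b<d. h a < h b \<longrightarrow> C $$ (a, b) = 0)"
proof -
  have bb: "block_bound d h j = (if j = 0 then 0 else jump_count d h (h (j - 1)))" for j
    by (simp add: block_bound_def jump_count_def)
  have tri_iff: "(\<forall>j\<le>d. \<forall>a<d. \<forall>b<d. block_bound d h j \<le> a \<longrightarrow> b < block_bound d h j \<longrightarrow> C $$ (a, b) = 0)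
      \<longleftrightarrow> (\<forall>a<d. \<forall>b<d. h a < h b \<longrightarrow> C $$ (a, b) = 0)" (is "?L \<longleftrightarrow> ?R") for C :: "'a mat"
  proof
    assume L: ?L
    show ?R
    proof (intro allI impI)
      fix a b assume ab: "a < d" "b < d" "h a < h b"
      \<comment> \<open>The block containing column \<open>b\<close> ends here: the bound counts all
        positions whose jump is at least \<open>h b\<close>.\<close>
      have "block_bound d h (Suc b) = jump_count d h (h b)" by (simp add: bb)
      moreover have "jump_count d h (h b) \<le> a" "b < jump_count d h (h b)"
        using less_jump_count_iff[of d h a "h b"] less_jump_count_iff[of d h b "h b"] anti ab by auto
      ultimately show "C $$ (a, b) = 0" using L ab by (metis Suc_leI)
    qed
  next
    assume R: ?R
    show ?L
    proof (intro allI impI)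
      fix j a b assume *: "j \<le> d" "a < d" "b < d" "block_bound d h j \<le> a" "b < block_bound d h j"
      hence j: "j \<noteq> 0" using bb[of 0] by (intro notI) simp
      have "h (j - 1) \<le> h b" "\<not> h (j - 1) \<le> h a"
        using * j less_jump_count_iff[of d h a "h (j - 1)"] less_jump_count_iff[of d h b "h (j - 1)"] anti
        by (auto simp: bb)
      thus "C $$ (a, b) = 0" using R * by auto
    qed
  qed
  have blocks: "mat n n (\<lambda>(a, b). C $$ (r + a, r + b)) \<in> GLO S n"
    if C: "C \<in> GLO S d" and tri: "\<forall>a<d. \<forall>b<d. h a < h b \<longrightarrow> C $$ (a, b) = 0" and j: "j < d"
      and r: "r = block_bound d h j" and n: "n = block_bound d h (j + 1) - r" for j r n
  proof -
    let ?B = "minv C"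
    have bbd: "block_bound d h j' \<le> d" if "j' \<le> d" for j'
      using jump_count_le by (simp add: bb)
    have Ctri: "C $$ (a, b) = 0" if "block_bound d h j' \<le> a" "a < d" "b < block_bound d h j'" "j' \<le> d" for a b j'
      using tri[folded tri_iff, rule_format, OF that(4) that(2) less_le_trans[OF that(3) bbd[OF that(4)]] that(1,3)] .
    have Btri: "?B $$ (a, b) = 0" if "block_bound d h j' \<le> a" "a < d" "b < block_bound d h j'" "j' \<le> d" for a b j'
      using inverse_block_triangular[of C d ?B "block_bound d h j'" a b] GLO_minv[OF C] GLO_carrier[OF C]
        bbd[OF that(4)] Ctri[OF _ _ _ that(4)] that(1-3) by metis
    define X where "X = mat n n (\<lambda>(a, b). C $$ (r + a, r + b))"
    define Y where "Y = mat n n (\<lambda>(a, b). ?B $$ (r + a, r + b))"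
    have rn: "r + n \<le> d" using bbd[of "j + 1"] bbd[of j] j n r by auto
    have "X * Y = 1\<^sub>m n"
    proof (rule eq_matI)
      fix a b assume "a < dim_row (1\<^sub>m n)" "b < dim_col (1\<^sub>m n)"
      hence ab: "a < n" "b < n" by auto
      have top: "r + n = block_bound d h (j + 1)" using n ab by linarith
      have "(X * Y) $$ (a, b) = (\<Sum>c<n. C $$ (r + a, r + c) * ?B $$ (r + c, r + b))"
        using index_mult_mat_sum[of X n n Y n a b] ab by (simp add: X_def Y_def)
      also have "\<dots> = (\<Sum>c\<in>{r..<r + n}. C $$ (r + a, c) * ?B $$ (c, r + b))"
        by (rule sum.reindex_bij_witness[of _ "\<lambda>c. c - r" "\<lambda>c. r + c"]) auto
      \<comment> \<open>Indices before the block are killed by the zeros of \<open>C\<close>,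
        indices after it by those of the inverse; thus the product of the blocks is a block of the
        full product.\<close>
      also have "\<dots> = (\<Sum>c<d. C $$ (r + a, c) * ?B $$ (c, r + b))"
      proof (rule sum.mono_neutral_left)
        show "\<forall>c\<in>{..<d} - {r..<r + n}. C $$ (r + a, c) * ?B $$ (c, r + b) = 0"
        proof
          fix c assume c: "c \<in> {..<d} - {r..<r + n}"
          show "C $$ (r + a, c) * ?B $$ (c, r + b) = 0"
          proof (cases "c < r")
            case True
            thus ?thesis using Ctri[of j "r + a" c] ab rn j r by auto
          next
            case False
            hence "r + n \<le> c" "c < d" using c by auto
            thus ?thesis using Btri[of "j + 1" c "r + b"] ab j top by auto
          qed
        qed
      qed (use rn in auto)
      also have "\<dots> = (C * ?B) $$ (r + a, r + b)"
        using index_mult_mat_sum[of C d d ?B d "r + a" "r + b"] GLO_carrier[OF C] GLO_minv(4)[OF C] ab rn by simp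
      also have "\<dots> = 1\<^sub>m n $$ (a, b)" unfolding GLO_minv(2)[OF C] using ab rn by simp
      finally show "(X * Y) $$ (a, b) = 1\<^sub>m n $$ (a, b)" .
    qed (auto simp: X_def Y_def)
    moreover have "integral_mat n X" "integral_mat n Y"
      using GLO_integral[OF C] GLO_integral[OF GLO_minv(1)[OF C]] rn
      by (auto simp: integral_mat_def X_def Y_def)
    ultimately show ?thesis unfolding GLO_iff X_def[symmetric] by blast
  qed
  show ?thesis
    unfolding parabolic_def mem_Collect_eq tri_iff Let_def using blocks by blast
qed

section \<open>The parabolic matrices form a group\<close>

context
  fixes d :: nat and h :: "nat \<Rightarrow> int"
  assumes anti: "decreasing_upto d h"
begin

lemma parabolic_one: "1\<^sub>m d \<in> parabolic S d h"
  using GLO_one by (subst parabolic_iff[OF anti]) auto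

lemma parabolic_mult:
  assumes "C \<in> parabolic S d h" "C' \<in> parabolic S d h"
  shows "C * C' \<in> parabolic S d h"
proof -
  have P: "C \<in> GLO S d \<and> (\<forall>a<d. \<forall>b<d. h a < h b \<longrightarrow> C $$ (a, b) = 0)"
    "C' \<in> GLO S d \<and> (\<forall>a<d. \<forall>b<d. h a < h b \<longrightarrow> C' $$ (a, b) = 0)"
    using assms parabolic_iff[of d h] anti by blast+
  have "(C * C') $$ (a, b) = 0" if ab: "a < d" "b < d" "h a < h b" for a b
  proof -
    have "(C * C') $$ (a, b) = (\<Sum>c<d. C $$ (a, c) * C' $$ (c, b))"
      using P ab by (intro index_mult_mat_sum[of _ d d _ d]) (auto simp: GLO_carrier)
    also have "\<dots> = 0"
    proof (rule sum.neutral, rule ballI)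
      fix c assume "c \<in> {..<d}"
      thus "C $$ (a, c) * C' $$ (c, b) = 0" using P ab by (cases "h a < h c") auto
    qed
    finally show ?thesis .
  qed
  thus ?thesis using P GLO_mult by (subst parabolic_iff[OF anti]) auto
qed

lemma parabolic_minv:
  assumes "C \<in> parabolic S d h"
  shows "minv C \<in> parabolic S d h"
proof -
  have P: "C \<in> GLO S d \<and> (\<forall>a<d. \<forall>b<d. h a < h b \<longrightarrow> C $$ (a, b) = 0)"
    using assms parabolic_iff[of d h] anti by blast
  hence C: "C \<in> GLO S d" by blast
  have "minv C $$ (a, b) = 0" if ab: "a < d" "b < d" "h a < h b" for a b
  proof (rule inverse_block_triangular[OF GLO_carrier[OF C] GLO_minv(4)[OF C] GLO_minv(3)[OF C]])
    note r = less_jump_count_iff[of d h, OF anti]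
    show "jump_count d h (h b) \<le> d" "jump_count d h (h b) \<le> a" "b < jump_count d h (h b)"
      using r[of d "h b"] r[of a "h b"] r[of b "h b"] ab by auto
    show "C $$ (a', b') = 0" if "jump_count d h (h b) \<le> a'" "a' < d" "b' < jump_count d h (h b)" for a' b'
      using P that r[of a' "h b"] r[of b' "h b"] by auto
  qed (rule ab)
  thus ?thesis using GLO_minv(1)[OF C] by (subst parabolic_iff[OF anti]) auto
qed

end

end

section \<open>Presentations and change of basis\<close>

context coeff_ring
begin

lemma GLO_tuples_D: "A \<in> GLO_tuples S d \<Longrightarrow> i < f \<Longrightarrow> A i \<in> GLO S d"
  by (auto simp: GLO_tuples_def)

lemma parabolic_GLO: "C \<in> parabolic S d h \<Longrightarrow> C \<in> GLO S d"
  by (simp add: parabolic_def)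

lemma sim_iff:
  "(A, B) \<in> sim S d k \<longleftrightarrow> A \<in> GLO_tuples S d \<and> B \<in> GLO_tuples S d \<and>
    (\<exists>C. (\<forall>i<f. C i \<in> parabolic S d (k i)) \<and> (\<forall>i<f. B i * Delta S d (k (prev S i)) * C (prev S i) = C i * A i * Delta S d (k (prev S i))))"
proof -
  have "B i = C i * A i * Delta S d (k (prev S i)) * minv (C (prev S i)) * minv (Delta S d (k (prev S i))) \<longleftrightarrow>
      B i * Delta S d (k (prev S i)) * C (prev S i) = C i * A i * Delta S d (k (prev S i))"
    if "A \<in> GLO_tuples S d" "B \<in> GLO_tuples S d" "\<forall>i<f. C i \<in> parabolic S d (k i)" "i < f" for i C
    using that prev_less[of i] GLO_tuples_D parabolic_GLO
    by (intro twist_eq_iff) (auto intro: GLO_carrier)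
  thus ?thesis unfolding sim_def mem_Collect_eq prod.case by (metis (no_types, lifting))
qed

lemma equiv_sim:
  assumes anti: "\<forall>i<f. decreasing_upto d (k i)"
  shows "equiv (GLO_tuples S d) (sim S d k)"
proof (rule equivI)
  note as = assoc_mult_mat[of _ d d _ d _ d] mult_carrier_mat[of _ d d _ d]
  show "sim S d k \<subseteq> GLO_tuples S d \<times> GLO_tuples S d" by (auto simp: sim_def)
  show "refl_on (GLO_tuples S d) (sim S d k)"
  proof (rule refl_onI)
    fix A assume A: "A \<in> GLO_tuples S d"
    have "A i * Delta S d (k (prev S i)) * 1\<^sub>m d = 1\<^sub>m d * A i * Delta S d (k (prev S i))" if "i < f" for i
      using GLO_carrier[OF GLO_tuples_D[OF A that]]
      by (simp add: as right_mult_one_mat[of _ d d] left_mult_one_mat[of _ d d])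
    thus "(A, A) \<in> sim S d k"
      unfolding sim_iff using A parabolic_one anti by (intro conjI exI[of _ "\<lambda>_. 1\<^sub>m d"]) auto
  qed
  show "sym (sim S d k)"
  proof (rule symI)
    fix A B assume "(A, B) \<in> sim S d k"
    then obtain C where AB: "A \<in> GLO_tuples S d" "B \<in> GLO_tuples S d"
      and C: "\<And>i. i < f \<Longrightarrow> C i \<in> parabolic S d (k i)"
      and eq: "\<And>i. i < f \<Longrightarrow> B i * Delta S d (k (prev S i)) * C (prev S i) = C i * A i * Delta S d (k (prev S i))" unfolding sim_iff by blast
    have "A i * Delta S d (k (prev S i)) * minv (C (prev S i)) = minv (C i) * B i * Delta S d (k (prev S i))" if i: "i < f" for i
    proof -
      note G = parabolic_GLO[OF C[OF i]] parabolic_GLO[OF C[OF prev_less[of i]]]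
      note c = GLO_carrier[OF GLO_tuples_D[OF AB(1) i]] GLO_carrier[OF GLO_tuples_D[OF AB(2) i]]
        GLO_carrier[OF G(1)] GLO_carrier[OF G(2)] GLO_minv(4)[OF G(1)] GLO_minv(4)[OF G(2)]
      have "minv (C i) * (B i * Delta S d (k (prev S i)) * C (prev S i)) * minv (C (prev S i))
          = minv (C i) * B i * Delta S d (k (prev S i)) * (C (prev S i) * minv (C (prev S i)))" using c by (simp add: as)
      also have "\<dots> = minv (C i) * B i * Delta S d (k (prev S i))"
        using c GLO_minv(2)[OF G(2)] by (simp add: as right_mult_one_mat[of _ d d])
      finally have 1: "minv (C i) * (C i * A i * Delta S d (k (prev S i))) * minv (C (prev S i)) = minv (C i) * B i * Delta S d (k (prev S i))"
        unfolding eq[OF i] .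
      have "minv (C i) * (C i * A i * Delta S d (k (prev S i))) * minv (C (prev S i))
          = (minv (C i) * C i) * (A i * Delta S d (k (prev S i)) * minv (C (prev S i)))" using c by (simp add: as)
      also have "\<dots> = A i * Delta S d (k (prev S i)) * minv (C (prev S i))"
        using c GLO_minv(3)[OF G(1)] by (simp add: as left_mult_one_mat[of _ d d])
      finally show ?thesis using 1 by simp
    qed
    thus "(B, A) \<in> sim S d k" unfolding sim_iff using AB C parabolic_minv anti
      by (intro conjI exI[of _ "\<lambda>i. minv (C i)"]) auto
  qed
  show "trans (sim S d k)"
  proof (rule transI)
    fix A B D assume "(A, B) \<in> sim S d k" "(B, D) \<in> sim S d k"
    then obtain C C' where AB: "A \<in> GLO_tuples S d" "B \<in> GLO_tuples S d" "D \<in> GLO_tuples S d"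
      and C: "\<And>i. i < f \<Longrightarrow> C i \<in> parabolic S d (k i)"
      and eq: "\<And>i. i < f \<Longrightarrow> B i * Delta S d (k (prev S i)) * C (prev S i) = C i * A i * Delta S d (k (prev S i))"
      and C': "\<And>i. i < f \<Longrightarrow> C' i \<in> parabolic S d (k i)"
      and eq': "\<And>i. i < f \<Longrightarrow> D i * Delta S d (k (prev S i)) * C' (prev S i) = C' i * B i * Delta S d (k (prev S i))" unfolding sim_iff by blast
    have "D i * Delta S d (k (prev S i)) * (C' (prev S i) * C (prev S i)) = C' i * C i * A i * Delta S d (k (prev S i))" if i: "i < f" for i
    proof -
      note G = parabolic_GLO[OF C[OF i]] parabolic_GLO[OF C[OF prev_less[of i]]]
        parabolic_GLO[OF C'[OF i]] parabolic_GLO[OF C'[OF prev_less[of i]]]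
      note c = GLO_carrier[OF GLO_tuples_D[OF AB(1) i]] GLO_carrier[OF GLO_tuples_D[OF AB(2) i]]
        GLO_carrier[OF GLO_tuples_D[OF AB(3) i]] G[THEN GLO_carrier]
      have "D i * Delta S d (k (prev S i)) * (C' (prev S i) * C (prev S i)) = (D i * Delta S d (k (prev S i)) * C' (prev S i)) * C (prev S i)"
        using c by (simp add: as)
      also have "\<dots> = C' i * (B i * Delta S d (k (prev S i)) * C (prev S i))" unfolding eq'[OF i] using c by (simp add: as)
      also have "\<dots> = C' i * C i * A i * Delta S d (k (prev S i))" unfolding eq[OF i] using c by (simp add: as)
      finally show ?thesis .
    qed
    thus "(A, D) \<in> sim S d k" unfolding sim_iff using AB C C' parabolic_mult anti
      by (intro conjI exI[of _ "\<lambda>i. C' i * C i"]) auto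
  qed
qed

end

section \<open>Changing a basis by a matrix\<close>

context phi_module
begin

text \<open>The row of vectors \<open>e\<close> times the matrix \<open>T\<close>, so columns hold
  coordinates. Successive changes of basis then multiply on the right, as in
  \<open>comb_comb\<close>.\<close>

definition comb :: "nat \<Rightarrow> (nat \<Rightarrow> 'v) \<Rightarrow> 'a mat \<Rightarrow> nat \<Rightarrow> 'v" where
  "comb d e T m = (\<Sum>l<d. sF D (T $$ (l, m)) (e l))"

lemma comb_comb:
  assumes "T \<in> carrier_mat d d" "U \<in> carrier_mat d d" "m < d"
  shows "comb d (comb d e T) U m = comb d e (T * U) m"
proof -
  have "comb d (comb d e T) U m = (\<Sum>l<d. \<Sum>l'<d. sF D (T $$ (l', l) * U $$ (l, m)) (e l'))"
    by (simp add: comb_def VF.scale_sum_right mult.commute)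
  also have "\<dots> = (\<Sum>l'<d. sF D (\<Sum>l<d. T $$ (l', l) * U $$ (l, m)) (e l'))"
    by (subst sum.swap) (simp add: VF.scale_sum_left)
  also have "\<dots> = comb d e (T * U) m"
    unfolding comb_def using assms
    by (intro sum.cong refl) (simp add: index_mult_mat_sum[of _ d d _ d] del: index_mult_mat)
  finally show ?thesis .
qed

lemma comb_one: "m < d \<Longrightarrow> comb d e (1\<^sub>m d) m = e m"
  unfolding comb_def by (subst sum.mono_neutral_right[of _ "{m}"]) auto

lemma comb_cong: "(\<And>l. l < d \<Longrightarrow> e l = e' l) \<Longrightarrow> comb d e T m = comb d e' T m"
  unfolding comb_def by (intro sum.cong) auto

lemma comb_inj:
  assumes "VF.indep_family d e" "T \<in> carrier_mat d d" "U \<in> carrier_mat d d"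
    "\<And>m. m < d \<Longrightarrow> comb d e T m = comb d e U m"
  shows "T = U"
proof (rule eq_matI)
  fix l m assume "l < dim_row U" "m < dim_col U"
  hence "l < d" "m < d" using assms by auto
  thus "T $$ (l, m) = U $$ (l, m)"
    using VF.indep_family_coeff_eq[OF assms(1) assms(4)[unfolded comb_def]] by blast
qed (use assms in auto)

lemma phi_comb: "phi D (comb d e T m) = comb d (\<lambda>l. phi D (e l)) T m"
  by (simp add: comb_def phi.sum phi.scale)

lemma indep_comb:
  assumes "VF.indep_family d e" "T \<in> carrier_mat d d" "U \<in> carrier_mat d d" "U * T = 1\<^sub>m d"
  shows "VF.indep_family d (comb d e T)"
  unfolding VF.indep_family_def
proof (intro allI impI)
  fix c j assume c: "(\<Sum>m<d. sF D (c m) (comb d e T m)) = 0" and j: "j < d"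
  have "(\<Sum>m<d. sF D (c m) (comb d e T m)) = (\<Sum>l<d. sF D (\<Sum>m<d. T $$ (l, m) * c m) (e l))"
    by (simp add: comb_def VF.scale_sum_right VF.scale_sum_left mult.commute) (rule sum.swap)
  hence *: "(\<Sum>m<d. T $$ (l, m) * c m) = 0" if "l < d" for l
    using assms(1)[unfolded VF.indep_family_def, rule_format, of "\<lambda>l. \<Sum>m<d. T $$ (l, m) * c m"] c that
    by simp
  have "c j = (\<Sum>l<d. U $$ (j, l) * (\<Sum>m<d. T $$ (l, m) * c m))"
    using mat_inverse_apply[OF assms(2,3,4) j, of c] by simp
  also have "\<dots> = 0" using * by simp
  finally show "c j = 0" .
qed

end

context hodge_lattice
begin

abbreviation "\<Delta> i \<equiv> Delta S d (k (prev S i))"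

lemma parabolic_zero:
  assumes "i < f" "T \<in> parabolic S d (k i)" "a < d" "b < d" "k i a < k i b"
  shows "T $$ (a, b) = 0"
  using parabolic_iff[of d "k i" T] decreasing assms by blast

text \<open>Column \<open>m\<close> of a parabolic matrix involves only positions whose jump is at
  least \<open>k i m\<close>. So a vector in the initial segment of length \<open>r i j\<close> is
  built from that segment alone.\<close>

lemma Ospan_comb_subset:
  assumes i: "i < f" and T: "T \<in> parabolic S d (k i)"
  shows "VO.Ospan (r i j) (comb d e T) \<subseteq> VO.Ospan (r i j) e"
proof (rule VO.Ospan_minimal)
  fix m assume m: "m < r i j"
  hence md: "m < d" "j \<le> k i m" using less_r_iff[OF i] by auto
  have "comb d e T m = (\<Sum>l<r i j. sF D (T $$ (l, m)) (e l))"
    unfolding comb_def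
  proof (rule sum.mono_neutral_right)
    show "\<forall>l\<in>{..<d} - {..<r i j}. sF D (T $$ (l, m)) (e l) = 0"
    proof
      fix l assume "l \<in> {..<d} - {..<r i j}"
      hence "l < d" "k i l < k i m" using less_r_iff[OF i, of l j] md(2) by auto
      thus "sF D (T $$ (l, m)) (e l) = 0" using parabolic_zero[OF i T _ md(1)] by simp
    qed
  qed (use r_le_d[OF i] in auto)
  also have "\<dots> \<in> VO.Ospan (r i j) e"
    using GLO_integral[of T d] T r_le_d[OF i, of j] md(1)
    by (intro VO.OspanI) (auto simp: parabolic_def)
  finally show "comb d e T m \<in> VO.Ospan (r i j) e" .
qed (auto intro: VO.Ospan_zero VO.Ospan_add VO.Ospan_scale)

text \<open>The converse inclusion of spans is \<open>Ospan_comb_subset\<close> for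
  \<open>minv T\<close>, which is parabolic and undoes the change of basis.\<close>

lemma adapted_basis_comb:
  assumes i: "i < f" and T: "T \<in> parabolic S d (k i)" and e: "adapted_basis S d D L i e"
  shows "adapted_basis S d D L i (comb d e T)"
proof -
  have G: "T \<in> GLO S d" using T by (simp add: parabolic_def)
  note c = GLO_carrier[OF G] GLO_minv(2,3,4)[OF G]
  have "comb d (comb d e T) (minv T) m = e m" if "m < d" for m
    using comb_comb[OF c(1,4) that, of e] comb_one[OF that, of e] c(2) by simp
  hence "VO.Ospan (r i j) (comb d (comb d e T) (minv T)) = VO.Ospan (r i j) e" for j
    using r_le_d[OF i, of j] by (intro VO.Ospan_cong) auto
  moreover have "minv T \<in> parabolic S d (k i)" using parabolic_minv[of d "k i" T] decreasing i T by blast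
  ultimately have "VO.Ospan (r i j) (comb d e T) = VO.Ospan (r i j) e" for j
    using Ospan_comb_subset[OF i T, of j e] Ospan_comb_subset[OF i, of "minv T" j "comb d e T"] by auto
  moreover have "VF.indep_family d (comb d e T)"
    using indep_comb[OF adapted_basisD(1)[OF i e] c(1,4,3)] .
  ultimately show ?thesis using e unfolding adapted_basis_iff[OF i] by simp
qed

text \<open>The vector \<open>e m\<close> lies in the filtration step of its own jump, which an
  initial segment of \<open>e'\<close> generates; all later coordinates are zero.\<close>

lemma transition_matrix:
  assumes i: "i < f" and e: "adapted_basis S d D L i e" and e': "adapted_basis S d D L i e'"
  shows "\<exists>T. integral_mat d T \<and> (\<forall>a<d. \<forall>b<d. k i a < k i b \<longrightarrow> T $$ (a, b) = 0) \<and>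
    (\<forall>m<d. e m = comb d e' T m)"
proof -
  have "\<exists>c. e m = (\<Sum>l<d. sF D (c l) (e' l)) \<and> (\<forall>l<d. absF S (c l) \<le> 1 \<and> (k i l < k i m \<longrightarrow> c l = 0))"
    if m: "m < d" for m
  proof -
    have "e m \<in> VO.Ospan (r i (k i m)) e'"
      using adapted_basisD[OF i e] adapted_basisD(2)[OF i e', of "k i m"] m by blast
    then obtain c where c: "e m = (\<Sum>l<r i (k i m). sF D (c l) (e' l))"
      "\<And>l. l < r i (k i m) \<Longrightarrow> absF S (c l) \<le> 1" by (auto elim: VO.OspanE)
    have "(\<Sum>l<d. sF D (if l < r i (k i m) then c l else 0) (e' l)) = (\<Sum>l<r i (k i m). sF D (c l) (e' l))"
      using r_le_d[OF i, of "k i m"] by (intro sum.mono_neutral_cong_right) auto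
    thus ?thesis using c less_r_iff[OF i]
      by (intro exI[of _ "\<lambda>l. if l < r i (k i m) then c l else 0"]) auto
  qed
  then obtain c where c: "\<And>m. m < d \<Longrightarrow> e m = (\<Sum>l<d. sF D (c m l) (e' l))"
    "\<And>m l. m < d \<Longrightarrow> l < d \<Longrightarrow> absF S (c m l) \<le> 1 \<and> (k i l < k i m \<longrightarrow> c m l = 0)" by metis
  show ?thesis
    using c by (intro exI[of _ "mat d d (\<lambda>(l, m). c m l)"]) (auto simp: integral_mat_def comb_def)
qed

text \<open>The transition matrices in the two directions are integral, and uniqueness of
  coordinates makes them inverse to each other.\<close>

lemma transition_parabolic:
  assumes i: "i < f" and e: "adapted_basis S d D L i e" and e': "adapted_basis S d D L i e'"
  shows "\<exists>T \<in> parabolic S d (k i). \<forall>m<d. e m = comb d e' T m"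
proof -
  obtain T where T: "integral_mat d T" "\<forall>a<d. \<forall>b<d. k i a < k i b \<longrightarrow> T $$ (a, b) = 0"
    "\<And>m. m < d \<Longrightarrow> e m = comb d e' T m" using transition_matrix[OF i e e'] by blast
  obtain U where U: "integral_mat d U" "\<And>m. m < d \<Longrightarrow> e' m = comb d e U m"
    using transition_matrix[OF i e' e] by blast
  have c: "T \<in> carrier_mat d d" "U \<in> carrier_mat d d" using T U by (auto simp: integral_mat_def)
  have "T * U = 1\<^sub>m d"
  proof (rule comb_inj[OF adapted_basisD(1)[OF i e']])
    fix m assume m: "m < d"
    have "comb d e' (T * U) m = comb d (comb d e' T) U m" using comb_comb[OF c m] by simp
    also have "\<dots> = comb d e U m" using T(3) by (intro comb_cong) auto
    finally show "comb d e' (T * U) m = comb d e' (1\<^sub>m d) m" using U(2)[OF m] comb_one[OF m] by simp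
  qed (use c in auto)
  hence "T \<in> GLO S d" using T U unfolding GLO_iff by blast
  hence "T \<in> parabolic S d (k i)" using T(2) parabolic_iff[of d "k i" T] decreasing i by blast
  thus ?thesis using T(3) by blast
qed

lemma presented_by_iff:
  "presented_by S d k A (D, L) \<longleftrightarrow> (\<exists>e. (\<forall>i<f. adapted_basis S d D L i (e i)) \<and>
    (\<forall>i<f. \<forall>m<d. phi D (e (prev S i) m) = comb d (e i) (A i * \<Delta> i) m))"
  by (simp add: presented_by_def comb_def)

lemma presented_by_sim:
  assumes A: "presented_by S d k A (D, L)" and AB: "(A, B) \<in> sim S d k"
  shows "presented_by S d k B (D, L)"
proof -
  obtain e where e: "\<And>i. i < f \<Longrightarrow> adapted_basis S d D L i (e i)"
    "\<And>i m. i < f \<Longrightarrow> m < d \<Longrightarrow> phi D (e (prev S i) m) = comb d (e i) (A i * \<Delta> i) m"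
    using A unfolding presented_by_iff by blast
  \<comment> \<open>The bases changed by \<open>C\<close> have matrices \<open>B\<close> when
    \<open>A i * \<Delta> i * C (prev S i) = C i * B i * \<Delta> i\<close>, which is the relation
    read from \<open>B\<close> to \<open>A\<close>.\<close>
  have BA: "(B, A) \<in> sim S d k" using AB equiv_sim[OF decreasing] by (meson equivE symD)
  obtain C where ABt: "A \<in> GLO_tuples S d" "B \<in> GLO_tuples S d"
    and C: "\<And>i. i < f \<Longrightarrow> C i \<in> parabolic S d (k i)"
    and eq: "\<And>i. i < f \<Longrightarrow> A i * \<Delta> i * C (prev S i) = C i * B i * \<Delta> i"
    using BA unfolding sim_iff by blast
  have "phi D (comb d (e (prev S i)) (C (prev S i)) m) = comb d (comb d (e i) (C i)) (B i * \<Delta> i) m"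
    if i: "i < f" and m: "m < d" for i m
  proof -
    note c = GLO_carrier[OF GLO_tuples_D[OF ABt(1) i]] GLO_carrier[OF GLO_tuples_D[OF ABt(2) i]]
      GLO_carrier[OF parabolic_GLO[OF C[OF i]]]
      GLO_carrier[OF parabolic_GLO[OF C[OF prev_less[of i]]]]
    have "phi D (comb d (e (prev S i)) (C (prev S i)) m) = comb d (comb d (e i) (A i * \<Delta> i)) (C (prev S i)) m"
      unfolding phi_comb using e(2)[OF i] by (intro comb_cong) auto
    also have "\<dots> = comb d (e i) (A i * \<Delta> i * C (prev S i)) m" using c m by (intro comb_comb) auto
    also have "\<dots> = comb d (e i) (C i * (B i * \<Delta> i)) m"
      unfolding eq[OF i] using c by (simp add: assoc_mult_mat[of _ d d _ d _ d])
    also have "\<dots> = comb d (comb d (e i) (C i)) (B i * \<Delta> i) m"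
      using c m by (intro comb_comb[symmetric]) auto
    finally show ?thesis .
  qed
  thus ?thesis unfolding presented_by_iff
    using adapted_basis_comb[OF _ C e(1)] by (intro exI[of _ "\<lambda>i. comb d (e i) (C i)"]) auto
qed

text \<open>Expand \<phi>(\<open>e (prev S i) m\<close>) in the basis \<open>e' i\<close> in two
  ways: first change the basis and then apply \<phi>, or the reverse. Comparing coordinates is
  exactly the relation.\<close>

lemma presented_by_unique:
  assumes A: "A \<in> GLO_tuples S d" "presented_by S d k A (D, L)"
    and B: "B \<in> GLO_tuples S d" "presented_by S d k B (D, L)"
  shows "(A, B) \<in> sim S d k"
proof -
  obtain e where e: "\<And>i. i < f \<Longrightarrow> adapted_basis S d D L i (e i)"
    "\<And>i m. i < f \<Longrightarrow> m < d \<Longrightarrow> phi D (e (prev S i) m) = comb d (e i) (A i * \<Delta> i) m"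
    using A(2) unfolding presented_by_iff by blast
  obtain e' where e': "\<And>i. i < f \<Longrightarrow> adapted_basis S d D L i (e' i)"
    "\<And>i m. i < f \<Longrightarrow> m < d \<Longrightarrow> phi D (e' (prev S i) m) = comb d (e' i) (B i * \<Delta> i) m"
    using B(2) unfolding presented_by_iff by blast
  have "\<forall>i. \<exists>T. i < f \<longrightarrow> T \<in> parabolic S d (k i) \<and> (\<forall>m<d. e i m = comb d (e' i) T m)"
    using transition_parabolic e(1) e'(1) by meson
  then obtain C where C: "\<And>i. i < f \<Longrightarrow> C i \<in> parabolic S d (k i)"
    "\<And>i m. i < f \<Longrightarrow> m < d \<Longrightarrow> e i m = comb d (e' i) (C i) m" by metis
  have "B i * \<Delta> i * C (prev S i) = C i * A i * \<Delta> i" if i: "i < f" for i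
  proof (rule comb_inj[OF adapted_basisD(1)[OF i e'(1)[OF i]]])
    note c = GLO_carrier[OF GLO_tuples_D[OF A(1) i]] GLO_carrier[OF GLO_tuples_D[OF B(1) i]]
      GLO_carrier[OF parabolic_GLO[OF C(1)[OF i]]]
      GLO_carrier[OF parabolic_GLO[OF C(1)[OF prev_less[of i]]]]
    show "B i * \<Delta> i * C (prev S i) \<in> carrier_mat d d" "C i * A i * \<Delta> i \<in> carrier_mat d d"
      using c by (auto intro!: mult_carrier_mat[of _ d d _ d])
    fix m assume m: "m < d"
    have "comb d (e' i) (B i * \<Delta> i * C (prev S i)) m = comb d (comb d (e' i) (B i * \<Delta> i)) (C (prev S i)) m"
      using c m by (intro comb_comb[symmetric]) auto
    also have "\<dots> = phi D (comb d (e' (prev S i)) (C (prev S i)) m)"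
      unfolding phi_comb using e'(2)[OF i] by (intro comb_cong) auto
    also have "\<dots> = phi D (e (prev S i) m)" using C(2)[OF prev_less m] by simp
    also have "\<dots> = comb d (comb d (e' i) (C i)) (A i * \<Delta> i) m"
      unfolding e(2)[OF i m] using C(2)[OF i] by (intro comb_cong) auto
    also have "\<dots> = comb d (e' i) (C i * (A i * \<Delta> i)) m" using c m by (intro comb_comb) auto
    finally show "comb d (e' i) (B i * \<Delta> i * C (prev S i)) m = comb d (e' i) (C i * A i * \<Delta> i) m"
      using c by (simp add: assoc_mult_mat[of _ d d _ d _ d])
  qed
  thus ?thesis unfolding sim_iff using A B C(1) by blast
qed

end

section \<open>Matrices and coordinates of a strongly divisible lattice\<close>

context hodge_lattice
begin

lemma adapted_family_exists: "\<exists>e. \<forall>i<f. adapted_basis S d D L i (e i)"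
  using adapted_basis_exists by meson

lemma presentation_exists:
  assumes sd: "strongly_divisible S D L"
  shows "\<exists>A \<in> GLO_tuples S d. presented_by S d k A (D, L)"
proof -
  define P where "P = (of_nat p :: 'a)"
  have P: "P \<noteq> 0" "absF S P \<le> 1"
    using of_nat_p_nonzero F.of_nat_le_1 by (auto simp: P_def)
  obtain e where e: "\<And>i. i < f \<Longrightarrow> adapted_basis S d D L i (e i)" using adapted_family_exists by blast
  have div: "phi D x \<in> scale_p S D j ` L" if "x \<in> FilL D L j" for x j
    using sd that unfolding strongly_divisible_def by blast
  have gen: "\<exists>J x. finite J \<and> (\<forall>j\<in>J. x j \<in> FilL D L j) \<and>
      y = (\<Sum>j\<in>J. scale_p S D (- j) (phi D (x j)))" if "y \<in> L" for y
  proof -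
    have "y \<in> {(\<Sum>j\<in>J. scale_p S D (- j) (phi D (x j))) | J x. finite J \<and> (\<forall>j\<in>J. x j \<in> FilL D L j)}"
      using sd that unfolding strongly_divisible_def by simp
    thus ?thesis by blast
  qed
  have "\<exists>c. phi D (e (prev S i) m) = (\<Sum>l<d. sF D (c l * P powi k (prev S i) m) (e i l)) \<and>
      (\<forall>l<d. absF S (c l) \<le> 1)" if i: "i < f" and m: "m < d" for i m
  proof -
    let ?j = "k (prev S i) m" and ?x = "e (prev S i) m"
    note b = adapted_basisD[OF prev_less[of i] e[OF prev_less[of i]]]
    \<comment> \<open>A basis vector lies in the filtration step of its own jump, so its image is
      divisible by that power of \<open>p\<close>; the quotient \<open>y\<close> stays in component
      \<open>i\<close> and has integral coordinates.\<close>
    have "?x \<in> FilL D L ?j" using b(4,5)[OF m] by (simp add: FilL_def)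
    then obtain y where y: "y \<in> L" "phi D ?x = sF D (P powi ?j) y"
      using div by (auto simp: scale_p_def P_def)
    have "y = sF D (inverse (P powi ?j)) (phi D ?x)" using y(2) P(1) by simp
    moreover have "phi D ?x \<in> comp i" using phi_comp[OF i b(6)[OF m]] .
    ultimately have "y \<in> comp i" using subspace_comp VF.subspace_scale by metis
    hence "y \<in> VO.Ospan d (e i)" using y(1) adapted_basisD(3)[OF i e[OF i]] by blast
    then obtain c where c: "y = (\<Sum>l<d. sF D (c l) (e i l))" "\<And>l. l < d \<Longrightarrow> absF S (c l) \<le> 1"
      by (auto elim: VO.OspanE)
    thus ?thesis using y(2) by (intro exI[of _ c]) (auto simp: VF.scale_sum_right mult.commute)
  qed
  moreover define Q where "Q i m c \<longleftrightarrow> phi D (e (prev S i) m) = (\<Sum>l<d. sF D (c l * P powi k (prev S i) m) (e i l)) \<and>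
      (\<forall>l<d. absF S (c l) \<le> 1)" for i m c
  ultimately have "\<forall>i m. \<exists>c. i < f \<longrightarrow> m < d \<longrightarrow> Q i m c" by blast
  then obtain c where "\<And>i m. i < f \<Longrightarrow> m < d \<Longrightarrow> Q i m (c i m)" by metis
  hence c: "\<And>i m. i < f \<Longrightarrow> m < d \<Longrightarrow>
      phi D (e (prev S i) m) = (\<Sum>l<d. sF D (c i m l * P powi k (prev S i) m) (e i l))"
    "\<And>i m l. i < f \<Longrightarrow> m < d \<Longrightarrow> l < d \<Longrightarrow> absF S (c i m l) \<le> 1" unfolding Q_def by auto
  define A where "A = restrict (\<lambda>i. mat d d (\<lambda>(l, m). c i m l)) {..<f}"
  have A: "A i \<in> GLO S d" if i: "i < f" for i
  proof -
    have "\<exists>N. (\<forall>m<d. \<forall>l<d. absF S (N m l) \<le> 1) \<and>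
      (\<forall>l<d. \<forall>l'<d. (\<Sum>m<d. c i m l * N m l') = (if l = l' then 1 else 0))"
    proof (rule VO.divisibility_matrix_right_inverse[OF phi_linear P, where e = "e (prev S i)"
          and e' = "e i" and \<kappa> = "k (prev S i)" and r = "r (prev S i)"])
      show "VF.indep_family d (e i)" using adapted_basisD(1)[OF i e[OF i]] .
      fix l assume l: "l < d"
      have el: "e i l \<in> L" "e i l \<in> comp i" using adapted_basisD(5,6)[OF i e[OF i] l] .
      obtain J x where J: "finite J" "\<And>j. j \<in> J \<Longrightarrow> x j \<in> FilL D L j"
        "e i l = (\<Sum>j\<in>J. scale_p S D (- j) (phi D (x j)))" using gen[OF el(1)] by blast
      \<comment> \<open>Projecting turns a generating sum in the whole lattice into one whose terms
        come from the preceding component only.\<close>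
      have "e i l = proj i (e i l)" using proj_comp[OF i i el(2)] by simp
      also have "\<dots> = (\<Sum>j\<in>J. sF D (P powi - j) (phi D (proj (prev S i) (x j))))"
        unfolding J(3) scale_p_def P_def[symmetric]
        by (simp add: tensor_act_sum tensor_act_sF proj_phi[OF i])
      finally have "e i l = (\<Sum>j\<in>J. sF D (P powi - j) (phi D (proj (prev S i) (x j))))" .
      moreover have "proj (prev S i) (x j) \<in> VO.Ospan (r (prev S i) j) (e (prev S i))" if "j \<in> J" for j
      proof -
        have "proj (prev S i) (x j) \<in> FilL D L j"
          using tensor_act_in[OF submod_FilL idem_spec(1)[OF prev_less] J(2)[OF that]] .
        hence "proj (prev S i) (x j) \<in> Fil D j \<inter> L \<inter> comp (prev S i)"
          using proj_in_comp[OF prev_less] by (auto simp: FilL_def)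
        thus ?thesis using adapted_basisD(2)[OF prev_less e[OF prev_less]] by blast
      qed
      ultimately show "\<exists>J x. finite J \<and> (\<forall>j\<in>J. x j \<in> VO.Ospan (r (prev S i) j) (e (prev S i))) \<and>
          e i l = (\<Sum>j\<in>J. sF D (P powi - j) (phi D (x j)))"
        using J(1) by (intro exI[of _ J] exI[of _ "\<lambda>j. proj (prev S i) (x j)"]) auto
    qed (use c i less_r_iff[OF prev_less] in auto)
    then obtain N where N: "\<And>m l. m < d \<Longrightarrow> l < d \<Longrightarrow> absF S (N m l) \<le> 1"
      "\<And>l l'. l < d \<Longrightarrow> l' < d \<Longrightarrow> (\<Sum>m<d. c i m l * N m l') = (if l = l' then 1 else 0)" by blast
    define B where "B = mat d d (\<lambda>(m, l). N m l)"
    have "A i * B = 1\<^sub>m d"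
    proof (rule eq_matI)
      fix a b assume "a < dim_row (1\<^sub>m d)" "b < dim_col (1\<^sub>m d)"
      hence ab: "a < d" "b < d" by auto
      have "(A i * B) $$ (a, b) = (\<Sum>m<d. A i $$ (a, m) * B $$ (m, b))"
        using ab i by (intro index_mult_mat_sum[of _ d d _ d]) (auto simp: A_def B_def)
      also have "\<dots> = (\<Sum>m<d. c i m a * N m b)" using ab i by (simp add: A_def B_def)
      finally show "(A i * B) $$ (a, b) = 1\<^sub>m d $$ (a, b)" using N(2)[OF ab] ab by simp
    qed (use i in \<open>auto simp: A_def B_def\<close>)
    moreover have "integral_mat d (A i)" "integral_mat d B"
      using c(2)[OF i] N(1) i by (auto simp: integral_mat_def A_def B_def)
    ultimately show ?thesis unfolding GLO_iff by blast
  qed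
  have "phi D (e (prev S i) m) = comb d (e i) (A i * \<Delta> i) m" if i: "i < f" and m: "m < d" for i m
    unfolding comb_def c(1)[OF i m]
  proof (rule sum.cong[OF refl])
    fix l assume "l \<in> {..<d}"
    thus "sF D (c i m l * P powi k (prev S i) m) (e i l) = sF D ((A i * \<Delta> i) $$ (l, m)) (e i l)"
      using mult_Delta_index[OF GLO_carrier[OF A[OF i]], of l m] m i by (simp add: A_def P_def)
  qed
  hence "presented_by S d k A (D, L)" using e unfolding presented_by_iff by blast
  moreover have "A \<in> GLO_tuples S d" using A by (auto simp: GLO_tuples_def A_def)
  ultimately show ?thesis by blast
qed

text \<open>The vector with coordinates \<open>c\<close> in all components at once. The filtration,
  the lattice, the action of \<open>K\<close> and \<phi> are then expressed through coordinates,
  jumps and matrices, independently of the module.\<close>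

definition mk :: "(nat \<Rightarrow> nat \<Rightarrow> 'v) \<Rightarrow> (nat \<Rightarrow> nat \<Rightarrow> 'a) \<Rightarrow> 'v" where
  "mk e c = (\<Sum>i<f. \<Sum>m<d. sF D (c i m) (e i m))"

lemma mk_cong: "(\<And>i m. i < f \<Longrightarrow> m < d \<Longrightarrow> c i m = c' i m) \<Longrightarrow> mk e c = mk e c'"
  unfolding mk_def by (intro sum.cong) auto

lemma mk_add: "mk e (\<lambda>i m. c i m + c' i m) = mk e c + mk e c'"
  by (simp add: mk_def VF.scale_left_distrib sum.distrib)

lemma mk_scale: "mk e (\<lambda>i m. a * c i m) = sF D a (mk e c)"
  by (simp add: mk_def VF.scale_sum_right)

context
  fixes e assumes e: "\<And>i. i < f \<Longrightarrow> adapted_basis S d D L i (e i)"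
begin

lemma part_in_comp: "i < f \<Longrightarrow> (\<Sum>m<d. sF D (c m) (e i m)) \<in> comp i"
  using adapted_basisD(6)[OF _ e]
  by (intro VF.subspace_sum[OF subspace_comp] VF.subspace_scale[OF subspace_comp]) auto

lemma proj_mk: "i < f \<Longrightarrow> proj i (mk e c) = (\<Sum>m<d. sF D (c i m) (e i m))"
proof -
  assume i: "i < f"
  have "proj i (mk e c) = (\<Sum>i'<f. if i' = i then (\<Sum>m<d. sF D (c i' m) (e i' m)) else 0)"
    unfolding mk_def tensor_act_sum[of _ _ "{..<f}"]
    using i by (intro sum.cong refl proj_comp part_in_comp) auto
  thus ?thesis using i by simp
qed

lemma span_adapted: "i < f \<Longrightarrow> VF.span (e i ` {..<d}) = comp i"
proof (rule antisym)
  assume i: "i < f"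
  note b = adapted_basisD[OF i e[OF i]]
  show "VF.span (e i ` {..<d}) \<subseteq> comp i" using b(6) by (intro VF.span_minimal subspace_comp) auto
  show "comp i \<subseteq> VF.span (e i ` {..<d})"
  proof
    fix x assume x: "x \<in> comp i"
    obtain a where a: "a \<noteq> 0" "sF D a x \<in> L" using saturation by blast
    have "sF D a x \<in> VO.Ospan d (e i)"
      using b(3) a x subspace_comp[of i] by (auto intro: VF.subspace_scale)
    hence "sF D a x \<in> VF.span (e i ` {..<d})" using VO.Ospan_subset_span by blast
    hence "sF D (inverse a) (sF D a x) \<in> VF.span (e i ` {..<d})" by (rule VF.span_scale)
    thus "x \<in> VF.span (e i ` {..<d})" using a by simp
  qed
qed

lemma mk_surj: "\<exists>c. x = mk e c"
proof -
  have "\<exists>c. proj i x = (\<Sum>m<d. sF D (c m) (e i m))" if "i < f" for i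
    using proj_in_comp[OF that, of x] unfolding span_adapted[OF that, symmetric] VF.span_family by blast
  hence "\<exists>c. i < f \<longrightarrow> proj i x = (\<Sum>m<d. sF D (c m) (e i m))" for i by blast
  then obtain c where "\<And>i. i < f \<Longrightarrow> proj i x = (\<Sum>m<d. sF D (c i m) (e i m))" by metis
  hence "mk e c = (\<Sum>i<f. proj i x)" unfolding mk_def by (intro sum.cong) auto
  thus ?thesis using sum_proj[of x] by auto
qed

lemma mk_inj: "mk e c = mk e c' \<Longrightarrow> i < f \<Longrightarrow> m < d \<Longrightarrow> c i m = c' i m"
  using VF.indep_family_coeff_eq[OF adapted_basisD(1)[OF _ e], of i "c i" "c' i" m]
    proj_mk[of i c] proj_mk[of i c'] by simp

lemma mk_in_Fil_L_iff:
  "mk e c \<in> FilL D L j \<longleftrightarrow> (\<forall>i<f. \<forall>m<d. absF S (c i m) \<le> 1 \<and> (c i m \<noteq> 0 \<longrightarrow> j \<le> k i m))"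
proof
  assume x: "mk e c \<in> FilL D L j"
  show "\<forall>i<f. \<forall>m<d. absF S (c i m) \<le> 1 \<and> (c i m \<noteq> 0 \<longrightarrow> j \<le> k i m)"
  proof (intro allI impI)
    fix i m assume i: "i < f" and m: "m < d"
    note b = adapted_basisD[OF i e[OF i]]
    have "proj i (mk e c) \<in> FilL D L j" using tensor_act_in[OF submod_FilL idem_spec(1)[OF i] x] .
    hence "proj i (mk e c) \<in> VO.Ospan (r i j) (e i)"
      using b(2) proj_in_comp[OF i] by (auto simp: FilL_def)
    then obtain c' where c': "(\<Sum>m<d. sF D (c i m) (e i m)) = (\<Sum>m<r i j. sF D (c' m) (e i m))"
      "\<And>m. m < r i j \<Longrightarrow> absF S (c' m) \<le> 1" unfolding proj_mk[OF i] by (auto elim: VO.OspanE)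
    have "(\<Sum>m<d. sF D (if m < r i j then c' m else 0) (e i m)) = (\<Sum>m<r i j. sF D (c' m) (e i m))"
      using r_le_d[OF i, of j] by (intro sum.mono_neutral_cong_right) auto
    from VF.indep_family_coeff_eq[OF b(1) trans[OF c'(1) this[symmetric]] m]
    have "c i m = (if m < r i j then c' m else 0)" .
    thus "absF S (c i m) \<le> 1 \<and> (c i m \<noteq> 0 \<longrightarrow> j \<le> k i m)"
      using c'(2) less_r_iff[OF i, of m j] by auto
  qed
next
  assume c: "\<forall>i<f. \<forall>m<d. absF S (c i m) \<le> 1 \<and> (c i m \<noteq> 0 \<longrightarrow> j \<le> k i m)"
  have sums: "(\<Sum>i\<in>I. h i) \<in> FilL D L j" if "\<And>i. i \<in> I \<Longrightarrow> h i \<in> FilL D L j" for I :: "nat set" and h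
    using that submod_FilL[of j]
    by (induction I rule: infinite_finite_induct) (auto simp: submod_def)
  have "sF D (c i m) (e i m) \<in> FilL D L j" if i: "i < f" and m: "m < d" for i m
  proof (cases "c i m = 0")
    case True
    thus ?thesis using submod_FilL[of j] by (simp add: submod_def)
  next
    case False
    hence "j \<le> k i m" "absF S (c i m) \<le> 1" using c i m by auto
    moreover have "e i m \<in> FilL D L j"
      using adapted_basisD(4,5)[OF i e[OF i] m] Fil_mono[OF \<open>j \<le> k i m\<close>] by (auto simp: FilL_def)
    ultimately show ?thesis using submod_FilL[of j] by (simp add: submod_def ringF_def)
  qed
  thus "mk e c \<in> FilL D L j" unfolding mk_def by (intro sums) auto
qed

lemma mk_in_L_iff: "mk e c \<in> L \<longleftrightarrow> (\<forall>i<f. \<forall>m<d. absF S (c i m) \<le> 1)"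
proof -
  obtain j0 where j0: "Fil D j0 = UNIV" using Fil_UNIV by blast
  have "j0 \<le> k i m" if "i < f" "m < d" for i m
    using r_eq_d[OF that(1) j0] less_r_iff[OF that(1), of m j0] that by simp
  thus ?thesis using mk_in_Fil_L_iff[of c j0] j0 by (auto simp: FilL_def)
qed

lemma sK_mk: "sK D b (mk e c) = mk e (\<lambda>i m. emb S i b * c i m)"
proof -
  have "sK D b (sF D (c i m) (e i m)) = sF D (emb S i b * c i m) (e i m)" if "i < f" "m < d" for i m
    using comp_sK[OF adapted_basisD(6)[OF that(1) e[OF that(1)] that(2)]]
    by (simp add: sF_sK[symmetric] mult.commute)
  thus ?thesis by (simp add: mk_def VKD.scale_sum_right)
qed

lemma phi_mk:
  assumes "\<And>i m. i < f \<Longrightarrow> m < d \<Longrightarrow> phi D (e (prev S i) m) = comb d (e i) (M i) m"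
  shows "phi D (mk e c) = mk e (\<lambda>i l. \<Sum>m<d. M i $$ (l, m) * c (prev S i) m)"
proof -
  have "phi D (mk e c) = (\<Sum>i<f. \<Sum>m<d. sF D (c i m) (phi D (e i m)))"
    by (simp add: mk_def phi.sum phi.scale)
  also have "\<dots> = (\<Sum>i<f. \<Sum>m<d. sF D (c (prev S i) m) (phi D (e (prev S i) m)))"
    using sum.reindex_bij_betw[OF bij_prev, of "\<lambda>i. \<Sum>m<d. sF D (c i m) (phi D (e i m))"] by simp
  also have "\<dots> = (\<Sum>i<f. \<Sum>m<d. \<Sum>l<d. sF D (M i $$ (l, m) * c (prev S i) m) (e i l))"
    using assms by (simp add: comb_def VF.scale_sum_right mult.commute)
  also have "\<dots> = (\<Sum>i<f. \<Sum>l<d. \<Sum>m<d. sF D (M i $$ (l, m) * c (prev S i) m) (e i l))"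
    by (intro sum.cong refl sum.swap)
  finally show ?thesis by (simp add: mk_def VF.scale_sum_left)
qed

end

end

context coeff_ring
begin

text \<open>The isomorphism keeps coordinates with respect to the two families of adapted bases. It
  is compatible with every structure because each is determined by coordinates, the jumps
  \<open>k\<close> and the matrices \<open>M\<close>.\<close>

lemma same_presentation_iso:
  fixes D D' :: "('a, 'k, 'v::ab_group_add) fil_phi_module"
  assumes X: "hodge_lattice S D L d k" and Y: "hodge_lattice S D' L' d k"
    and A: "presented_by S d k A (D, L)" "presented_by S d k A (D', L')"
  shows "\<exists>h. lattice_iso S (D, L) (D', L') h"
proof -
  interpret X: hodge_lattice S D L d k by (rule X)
  interpret Y: hodge_lattice S D' L' d k by (rule Y)
  define M where "M i = A i * Delta S d (k (prev S i))" for i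
  obtain e where e: "\<And>i. i < f \<Longrightarrow> adapted_basis S d D L i (e i)"
    "\<And>i m. i < f \<Longrightarrow> m < d \<Longrightarrow> phi D (e (prev S i) m) = X.comb d (e i) (M i) m"
    using A(1) unfolding X.presented_by_iff M_def by blast
  obtain e' where e': "\<And>i. i < f \<Longrightarrow> adapted_basis S d D' L' i (e' i)"
    "\<And>i m. i < f \<Longrightarrow> m < d \<Longrightarrow> phi D' (e' (prev S i) m) = Y.comb d (e' i) (M i) m"
    using A(2) unfolding Y.presented_by_iff M_def by blast
  have "\<exists>h. \<forall>x. x = X.mk e (h x)" using X.mk_surj[OF e(1)] by metis
  then obtain co where co: "\<And>x. x = X.mk e (co x)" by blast
  define h where "h x = Y.mk e' (co x)" for x
  \<comment> \<open>The chosen coordinates \<open>co\<close> are determined only for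
    \<open>i < f\<close> and \<open>m < d\<close>, and \<open>mk\<close> depends on nothing
    else.\<close>
  have h: "h (X.mk e c) = Y.mk e' c" for c
    unfolding h_def using X.mk_inj[OF e(1) co[of "X.mk e c"]] by (intro Y.mk_cong) simp
  have FilL: "h ` FilL D L j = FilL D' L' j" for j
  proof
    show "h ` FilL D L j \<subseteq> FilL D' L' j"
    proof (rule image_subsetI)
      fix x assume "x \<in> FilL D L j"
      hence "X.mk e (co x) \<in> FilL D L j" using co[of x] by simp
      thus "h x \<in> FilL D' L' j"
        using X.mk_in_Fil_L_iff[of e, OF e(1)] Y.mk_in_Fil_L_iff[of e', OF e'(1)] unfolding h_def by blast
    qed
    show "FilL D' L' j \<subseteq> h ` FilL D L j"
    proof
      fix y assume y: "y \<in> FilL D' L' j"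
      obtain c where c: "y = Y.mk e' c" using Y.mk_surj[OF e'(1)] by blast
      have "X.mk e c \<in> FilL D L j"
        using y X.mk_in_Fil_L_iff[of e, OF e(1)] Y.mk_in_Fil_L_iff[of e', OF e'(1)] unfolding c by blast
      thus "y \<in> h ` FilL D L j" using c h by (metis imageI)
    qed
  qed
  have img: "h ` L = L'"
  proof
    show "h ` L \<subseteq> L'"
    proof (rule image_subsetI)
      fix x assume "x \<in> L"
      hence "X.mk e (co x) \<in> L" using co[of x] by simp
      thus "h x \<in> L'" 
        using X.mk_in_L_iff[of e, OF e(1)] Y.mk_in_L_iff[of e', OF e'(1)] unfolding h_def by blast
    qed
    show "L' \<subseteq> h ` L"
    proof
      fix y assume y: "y \<in> L'"
      obtain c where c: "y = Y.mk e' c" using Y.mk_surj[OF e'(1)] by blast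
      have "X.mk e c \<in> L" 
        using y X.mk_in_L_iff[of e, OF e(1)] Y.mk_in_L_iff[of e', OF e'(1)] unfolding c by blast
      thus "y \<in> h ` L" using c h by (metis imageI)
    qed
  qed
  have "inj h"
  proof (rule injI)
    fix x y assume "h x = h y"
    hence "co x i m = co y i m" if "i < f" "m < d" for i m
      using Y.mk_inj[OF e'(1)] that unfolding h_def by blast
    hence "X.mk e (co x) = X.mk e (co y)" by (rule X.mk_cong)
    thus "x = y" using co[of x] co[of y] by simp
  qed
  hence bij: "bij_betw h L L'" using img by (auto simp: bij_betw_def intro: inj_on_subset)
  have "h (x + y) = h x + h y" for x y
    using h[of "\<lambda>i m. co x i m + co y i m"] co[of x] co[of y]
    by (simp add: X.mk_add Y.mk_add h_def[of x] h_def[of y])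
  moreover have "h (sF D a x) = sF D' a (h x)" for a x
    using h[of "\<lambda>i m. a * co x i m"] co[of x] by (simp add: X.mk_scale Y.mk_scale h_def[of x])
  moreover have "h (sK D b x) = sK D' b (h x)" for b x
    using h[of "\<lambda>i m. emb S i b * co x i m"] co[of x] X.sK_mk[OF e(1), of b "co x"]
      Y.sK_mk[OF e'(1), of b "co x"] by (simp add: h_def[of x])
  moreover have "h (phi D x) = phi D' (h x)" for x
    using h[of "\<lambda>i l. \<Sum>m<d. M i $$ (l, m) * co x (prev S i) m"] co[of x]
      X.phi_mk[OF e(1) e(2), of "co x"] Y.phi_mk[OF e'(1) e'(2), of "co x"] by (simp add: h_def[of x])
  ultimately show ?thesis using bij FilL
    by (intro exI[of _ h]) (simp add: lattice_iso_def)
qed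

end

section \<open>Isomorphisms\<close>

text \<open>The map \<open>h\<close> is constrained only on \<open>L\<close> and only for integral
  scalars, so every combination it is applied to has to be integral.\<close>

locale lattice_isomorphism =
  X: phi_lattice_module S D L + Y: phi_lattice_module S D' L'
  for S :: "('q::field_char_0, 'a::field, 'k::field) coeff_data"
    and D :: "('a, 'k, 'v::ab_group_add) fil_phi_module" and L
    and D' :: "('a, 'k, 'v) fil_phi_module" and L' +
  fixes h :: "'v \<Rightarrow> 'v"
  assumes iso: "lattice_iso S (D, L) (D', L') h"
begin

lemma bij_h: "bij_betw h L L'"
  and h_add: "x \<in> L \<Longrightarrow> y \<in> L \<Longrightarrow> h (x + y) = h x + h y"
  and h_sF: "absF S a \<le> 1 \<Longrightarrow> x \<in> L \<Longrightarrow> h (sF D a x) = sF D' a (h x)"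
  and h_sK: "absK S b \<le> 1 \<Longrightarrow> x \<in> L \<Longrightarrow> h (sK D b x) = sK D' b (h x)"
  and h_phi: "x \<in> L \<Longrightarrow> h (phi D x) = phi D' (h x)"
  and h_FilL: "h ` FilL D L j = FilL D' L' j"
  using iso by (auto simp: lattice_iso_def ringF_def ringK_def)

lemma h_inj: "x \<in> L \<Longrightarrow> y \<in> L \<Longrightarrow> h x = h y \<longleftrightarrow> x = y"
  using bij_h by (auto simp: bij_betw_def inj_on_def)

lemma h_zero: "h 0 = 0"
  using h_add[OF X.L_zero X.L_zero] by simp

lemma L_lincomb:
  "(\<And>l. l < (n::nat) \<Longrightarrow> absF S (c l) \<le> 1) \<Longrightarrow> (\<And>l. l < n \<Longrightarrow> b l \<in> L) \<Longrightarrow> (\<Sum>l<n. sF D (c l) (b l)) \<in> L"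
  by (induction n) (auto intro: X.L_zero X.L_add X.L_sF)

lemma h_lincomb:
  "(\<And>l. l < (n::nat) \<Longrightarrow> absF S (c l) \<le> 1) \<Longrightarrow> (\<And>l. l < n \<Longrightarrow> b l \<in> L) \<Longrightarrow>
    h (\<Sum>l<n. sF D (c l) (b l)) = (\<Sum>l<n. sF D' (c l) (h (b l)))"
  by (induction n) (auto simp: h_zero h_add h_sF X.L_sF L_lincomb)

lemma h_Ospan:
  assumes "\<And>l. l < n \<Longrightarrow> b l \<in> L"
  shows "h ` X.VO.Ospan n b = Y.VO.Ospan n (\<lambda>l. h (b l))"
proof
  show "h ` X.VO.Ospan n b \<subseteq> Y.VO.Ospan n (\<lambda>l. h (b l))"
  proof (rule image_subsetI)
    fix x assume "x \<in> X.VO.Ospan n b"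
    then obtain c where "x = (\<Sum>l<n. sF D (c l) (b l))" "\<And>l. l < n \<Longrightarrow> absF S (c l) \<le> 1"
      by (auto elim: X.VO.OspanE)
    thus "h x \<in> Y.VO.Ospan n (\<lambda>l. h (b l))"
      using h_lincomb[of n c b] assms Y.VO.OspanI[of n c "\<lambda>l. h (b l)"] by simp
  qed
  show "Y.VO.Ospan n (\<lambda>l. h (b l)) \<subseteq> h ` X.VO.Ospan n b"
  proof
    fix y assume "y \<in> Y.VO.Ospan n (\<lambda>l. h (b l))"
    then obtain c where c: "y = (\<Sum>l<n. sF D' (c l) (h (b l)))" "\<And>l. l < n \<Longrightarrow> absF S (c l) \<le> 1"
      by (auto elim: Y.VO.OspanE)
    have "y = h (\<Sum>l<n. sF D (c l) (b l))" using h_lincomb[of n c b] assms c by simp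
    thus "y \<in> h ` X.VO.Ospan n b" using X.VO.OspanI[of n c b] c(2) by blast
  qed
qed

text \<open>Here \<open>indep_family_integral\<close> is essential: only integral relations can be
  pulled back along \<open>h\<close>.\<close>

lemma h_indep:
  assumes "X.VF.indep_family n b" "\<And>l. l < n \<Longrightarrow> b l \<in> L"
  shows "Y.VF.indep_family n (\<lambda>l. h (b l))"
proof (rule Y.VO.indep_family_integral)
  fix c assume c: "\<And>l. l < n \<Longrightarrow> absF S (c l) \<le> 1" "(\<Sum>l<n. sF D' (c l) (h (b l))) = 0"
  have "h (\<Sum>l<n. sF D (c l) (b l)) = h 0" using h_lincomb[of n c b] c assms(2) h_zero by simp
  hence "(\<Sum>l<n. sF D (c l) (b l)) = 0" using h_inj[OF L_lincomb X.L_zero] c(1) assms(2) by blast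
  thus "\<forall>l<n. c l = 0" using assms(1) unfolding X.VF.indep_family_def by blast
qed

lemma h_tensor_act:
  assumes "x \<in> L" "set t \<subseteq> ringF S \<times> ringK S"
  shows "h (tensor_act D t x) = tensor_act D' t (h x)"
  using assms(2)
proof (induction t)
  case (Cons xy t)
  obtain a b where ab: "xy = (a, b)" by force
  have a: "absF S a \<le> 1" and b: "absK S b \<le> 1" and t: "set t \<subseteq> ringF S \<times> ringK S"
    using Cons.prems by (auto simp: ab ringF_def ringK_def)
  have "h (sF D a (sK D b x) + tensor_act D t x) = h (sF D a (sK D b x)) + h (tensor_act D t x)"
    using a b assms(1) X.tensor_act_in[OF X.submod_L t assms(1)]
    by (intro h_add X.L_sF X.L_sK) auto
  thus ?case using Cons.IH[OF t] a b assms(1) by (simp add: ab h_sF h_sK X.L_sK)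
qed (simp add: h_zero)

lemma h_component:
  assumes "M \<subseteq> L" "i < res_deg S"
  shows "component S D' i (h ` M) = h ` component S D i M"
  unfolding component_def image_image
  using assms h_tensor_act[OF _ X.idem_spec(1)[OF assms(2)]] by (intro image_cong) auto

end

section \<open>Isomorphism classes and the map \<open>Theta\<close>\<close>

context coeff_ring
begin

lemma SDL_hodge_lattice:
  assumes "(D, L) \<in> SDL S d k" "\<forall>i<f. decreasing_upto d (k i)"
  shows "hodge_lattice S D L d k"
  using assms datum
  by unfold_locales
    (auto simp: SDL_def strongly_divisible_def weakly_admissible_def)

text \<open>Adapted bases are carried over by \<open>h\<close>. Since the jumps are nonnegative,
  \<open>A i * \<Delta> i\<close> is integral, and \<open>h\<close> may be applied to the expansion
  of \<phi> of a basis vector.\<close>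

lemma presented_by_iso:
  fixes D D' :: "('a, 'k, 'v::ab_group_add) fil_phi_module"
  assumes k: "\<forall>i<f. decreasing_upto d (k i)" "\<forall>i<f. \<forall>m<d. 0 \<le> k i m"
    and X: "(D, L) \<in> SDL S d k" and Y: "(D', L') \<in> SDL S d k"
    and iso: "lattice_iso S (D, L) (D', L') h"
    and A: "A \<in> GLO_tuples S d" "presented_by S d k A (D, L)"
  shows "presented_by S d k A (D', L')"
proof -
  interpret X: hodge_lattice S D L d k by (rule SDL_hodge_lattice[OF X k(1)])
  interpret Y: hodge_lattice S D' L' d k by (rule SDL_hodge_lattice[OF Y k(1)])
  interpret H: lattice_isomorphism S D L D' L' h by unfold_locales (rule iso)
  obtain e where e: "\<And>i. i < f \<Longrightarrow> adapted_basis S d D L i (e i)"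
    "\<And>i m. i < f \<Longrightarrow> m < d \<Longrightarrow> phi D (e (prev S i) m) = X.comb d (e i) (A i * X.\<Delta> i) m"
    using A(2) unfolding X.presented_by_iff by blast
  have eL: "e i m \<in> L" if "i < f" "m < d" for i m
    using X.adapted_basisD(5)[OF that(1) e(1)[OF that(1)] that(2)] .
  have "adapted_basis S d D' L' i (\<lambda>m. h (e i m))" if i: "i < f" for i
    unfolding Y.adapted_basis_iff[OF i]
  proof (intro conjI allI)
    note b = X.adapted_basisD[OF i e(1)[OF i]]
    show "Y.VF.indep_family d (\<lambda>m. h (e i m))" using H.h_indep[OF b(1)] eL[OF i] by blast
    fix j
    have "Fil D' j \<inter> L' \<inter> Y.comp i = component S D' i (h ` FilL D L j)"
      using Y.component_FilL[OF i] H.h_FilL by simp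
    also have "\<dots> = h ` component S D i (FilL D L j)"
      using i by (intro H.h_component) (auto simp: FilL_def)
    also have "\<dots> = h ` X.VO.Ospan (jump_count d (k i) j) (e i)"
      using X.component_FilL[OF i] b(2) by simp
    also have "\<dots> = Y.VO.Ospan (jump_count d (k i) j) (\<lambda>m. h (e i m))"
      using eL[OF i] X.r_le_d[OF i, of j] by (intro H.h_Ospan) auto
    finally show "Fil D' j \<inter> L' \<inter> Y.comp i = Y.VO.Ospan (jump_count d (k i) j) (\<lambda>m. h (e i m))" .
  qed
  moreover have "phi D' (h (e (prev S i) m)) = Y.comb d (\<lambda>m. h (e i m)) (A i * X.\<Delta> i) m"
    if i: "i < f" and m: "m < d" for i m
  proof -
    note G = GLO_tuples_D[OF A(1) i]
    have "absF S ((A i * X.\<Delta> i) $$ (l, m)) \<le> 1" if l: "l < d" for l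
    proof -
      have "of_nat p powi k (prev S i) m = (of_nat p :: 'a) ^ nat (k (prev S i) m)"
        using k(2) prev_less m by (simp add: power_int_def)
      thus ?thesis using mult_Delta_index[OF GLO_carrier[OF G] l m] GLO_integral[OF G l m]
          F.le_1_power[OF F.of_nat_le_1] by (auto intro!: F.le_1_mult)
    qed
    hence "h (X.comb d (e i) (A i * X.\<Delta> i) m) = Y.comb d (\<lambda>m. h (e i m)) (A i * X.\<Delta> i) m"
      unfolding X.comb_def Y.comb_def using eL[OF i] by (rule H.h_lincomb)
    thus ?thesis using H.h_phi[OF eL[OF prev_less m], of i] e(2)[OF i m] by simp
  qed
  ultimately show ?thesis unfolding Y.presented_by_iff by (intro exI[of _ "\<lambda>i m. h (e i m)"]) auto
qed

lemma lattice_iso_inverse: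
  assumes "lattice_isomorphism S D L D' L' h"
  shows "lattice_iso S (D', L') (D, L) (inv_into L h)"
proof -
  interpret H: lattice_isomorphism S D L D' L' h by (rule assms)
  let ?g = "inv_into L h"
  have gL: "?g y \<in> L" and hg: "h (?g y) = y" if "y \<in> L'" for y
    using that H.bij_h by (auto simp: bij_betw_def inv_into_into f_inv_into_f)
  have gh: "?g (h x) = x" if "x \<in> L" for x
    using that H.bij_h by (simp add: bij_betw_def)
  have g: "?g y = x" if "x \<in> L" "h x = y" for x y using gh that by auto
  show ?thesis unfolding lattice_iso_def prod.case
  proof (intro conjI ballI allI)
    show "bij_betw ?g L' L" using H.bij_h by (rule bij_betw_inv_into)
    show "?g (x + y) = ?g x + ?g y" if "x \<in> L'" "y \<in> L'" for x y
      using that gL hg by (intro g) (auto simp: H.h_add H.X.L_add)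
    show "?g (sF D' a x) = sF D a (?g x)" if "a \<in> ringF S" "x \<in> L'" for a x
      using that gL hg by (intro g) (auto simp: H.h_sF H.X.L_sF ringF_def)
    show "?g (sK D' a x) = sK D a (?g x)" if "a \<in> ringK S" "x \<in> L'" for a x
      using that gL hg by (intro g) (auto simp: H.h_sK H.X.L_sK ringK_def)
    show "?g (phi D' x) = phi D (?g x)" if "x \<in> L'" for x
      using that gL hg by (intro g) (auto simp: H.h_phi H.X.phi_L)
    show "?g ` FilL D' L' j = FilL D L j" for j
      unfolding H.h_FilL[symmetric] image_image using gh by (force simp: FilL_def)
  qed
qed

lemma lattice_iso_comp:
  assumes "lattice_iso S (D, L) (D', L') g" "lattice_iso S (D', L') (D'', L'') h"
  shows "lattice_iso S (D, L) (D'', L'') (h \<circ> g)"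
proof -
  have g: "g x \<in> L'" if "x \<in> L" for x using assms(1) that by (auto simp: lattice_iso_def bij_betw_def)
  have bij: "bij_betw (h \<circ> g) L L''"
    using assms by (auto simp: lattice_iso_def intro: bij_betw_trans)
  have "(h \<circ> g) ` FilL D L j = FilL D'' L'' j" for j
    using assms unfolding lattice_iso_def prod.case image_comp[symmetric] by metis
  thus ?thesis using assms bij g unfolding lattice_iso_def prod.case by simp
qed

lemma iso_rel_equiv:
  assumes k: "\<forall>i<f. decreasing_upto d (k i)"
  shows "equiv (SDL S d k :: (('a, 'k, 'v::ab_group_add) fil_phi_module \<times> 'v set) set) (iso_rel S d k)"
proof (rule equivI)
  show "iso_rel S d k \<subseteq> (SDL S d k :: (('a, 'k, 'v) fil_phi_module \<times> 'v set) set) \<times> SDL S d k"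
    by (auto simp: iso_rel_def)
  show "refl_on (SDL S d k :: (('a, 'k, 'v) fil_phi_module \<times> 'v set) set) (iso_rel S d k)"
  proof (rule refl_onI)
    fix X :: "('a, 'k, 'v) fil_phi_module \<times> 'v set" assume "X \<in> SDL S d k"
    moreover have "lattice_iso S X X id" by (cases X) (simp add: lattice_iso_def)
    ultimately show "(X, X) \<in> iso_rel S d k" by (auto simp: iso_rel_def)
  qed
  show "sym (iso_rel S d k :: ((('a, 'k, 'v) fil_phi_module \<times> 'v set) \<times> _) set)"
  proof (rule symI)
    fix X Y :: "('a, 'k, 'v) fil_phi_module \<times> 'v set" assume "(X, Y) \<in> iso_rel S d k"
    then obtain h where XY: "X \<in> SDL S d k" "Y \<in> SDL S d k" "lattice_iso S X Y h"
      by (auto simp: iso_rel_def)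
    obtain D L D' L' where eq: "X = (D, L)" "Y = (D', L')" by fastforce
    interpret X: hodge_lattice S D L d k using SDL_hodge_lattice[OF _ k] XY(1) eq by blast
    interpret Y: hodge_lattice S D' L' d k using SDL_hodge_lattice[OF _ k] XY(2) eq by blast
    have "lattice_isomorphism S D L D' L' h" by unfold_locales (use XY(3) eq in simp)
    from lattice_iso_inverse[OF this] show "(Y, X) \<in> iso_rel S d k"
      using XY(1,2) unfolding eq iso_rel_def by blast
  qed
  show "trans (iso_rel S d k :: ((('a, 'k, 'v) fil_phi_module \<times> 'v set) \<times> _) set)"
  proof (rule transI)
    fix X Y Z :: "('a, 'k, 'v) fil_phi_module \<times> 'v set"
    assume "(X, Y) \<in> iso_rel S d k" "(Y, Z) \<in> iso_rel S d k"
    thus "(X, Z) \<in> iso_rel S d k" using lattice_iso_comp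
      by (cases X; cases Y; cases Z) (fastforce simp: iso_rel_def)
  qed
qed

text \<open>\<open>Theta\<close> collects the lattices presented by any member of a class. Change of
  basis reduces every member to \<open>A\<close>; equal matrices give isomorphic lattices, and
  isomorphisms transport presentations.\<close>

lemma Theta_class:
  fixes X :: "('a, 'k, 'v::ab_group_add) fil_phi_module \<times> 'v set"
  assumes k: "\<forall>i<f. decreasing_upto d (k i)" "\<forall>i<f. \<forall>m<d. 0 \<le> k i m"
    and A: "A \<in> GLO_tuples S d" and X: "X \<in> SDL S d k" "presented_by S d k A X"
  shows "Theta S d k (sim S d k `` {A}) = iso_rel S d k `` {X}"
proof -
  obtain D L where DL: "X = (D, L)" by fastforce
  have HX: "hodge_lattice S D L d k" using SDL_hodge_lattice[OF _ k(1)] X DL by blast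
  show ?thesis
  proof
    show "Theta S d k (sim S d k `` {A}) \<subseteq> iso_rel S d k `` {X}"
    proof
      fix Y :: "('a, 'k, 'v) fil_phi_module \<times> 'v set"
      assume "Y \<in> Theta S d k (sim S d k `` {A})"
      then obtain B where B: "Y \<in> SDL S d k" "(A, B) \<in> sim S d k" "presented_by S d k B Y"
        by (auto simp: Theta_def)
      obtain D' L' where Y: "Y = (D', L')" by fastforce
      have HY: "hodge_lattice S D' L' d k" using SDL_hodge_lattice[OF _ k(1)] B(1) Y by blast
      have "presented_by S d k B (D, L)"
        using hodge_lattice.presented_by_sim[OF HX] X(2) B(2) DL by blast
      then obtain h where "lattice_iso S (D, L) (D', L') h"
        using same_presentation_iso[OF HX HY] B(3) Y by blast
      thus "Y \<in> iso_rel S d k `` {X}" using X(1) B(1) DL Y by (auto simp: iso_rel_def)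
    qed
    show "iso_rel S d k `` {X} \<subseteq> Theta S d k (sim S d k `` {A})"
    proof
      fix Y :: "('a, 'k, 'v) fil_phi_module \<times> 'v set"
      assume "Y \<in> iso_rel S d k `` {X}"
      then obtain h where h: "Y \<in> SDL S d k" "lattice_iso S X Y h" by (auto simp: iso_rel_def)
      obtain D' L' where Y: "Y = (D', L')" by fastforce
      have "presented_by S d k A Y"
        using presented_by_iso[OF k, of D L D' L' h A] X h A DL Y by blast
      moreover have "(A, A) \<in> sim S d k" using equiv_sim[OF k(1)] A by (meson equivE refl_onD)
      ultimately show "Y \<in> Theta S d k (sim S d k `` {A})" using h(1) by (auto simp: Theta_def)
    qed
  qed
qed

text \<open>Existence of a presented lattice for each tuple enters as the hypothesis
  \<open>ex\<close>, to be supplied by the standard lattice; it makes the values of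
  \<open>Theta\<close> single classes instead of the empty set.\<close>

lemma Theta_bij:
  assumes k: "\<forall>i<f. decreasing_upto d (k i)" "\<forall>i<f. \<forall>m<d. 0 \<le> k i m"
    and ex: "\<And>A. A \<in> GLO_tuples S d \<Longrightarrow>
      \<exists>X \<in> (SDL S d k :: (('a, 'k, 'v::ab_group_add) fil_phi_module \<times> 'v set) set). presented_by S d k A X"
  shows "bij_betw (Theta S d k) (GLO_tuples S d // sim S d k)
    ((SDL S d k :: (('a, 'k, 'v) fil_phi_module \<times> 'v set) set) // iso_rel S d k)"
proof -
  note eqs = equiv_sim[OF k(1)] and eqi = iso_rel_equiv[OF k(1), where 'v = 'v]
  note cls = Theta_class[OF k, where 'v = 'v]
  have hodge: "hodge_lattice S D L d k" if "(D, L) \<in> SDL S d k" for D :: "('a, 'k, 'v) fil_phi_module" and L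
    using SDL_hodge_lattice[OF that k(1)] .
  show ?thesis unfolding bij_betw_def
  proof
    show "inj_on (Theta S d k :: _ \<Rightarrow> (('a, 'k, 'v) fil_phi_module \<times> 'v set) set) (GLO_tuples S d // sim S d k)"
    proof (rule inj_onI)
      fix T U assume T: "T \<in> GLO_tuples S d // sim S d k" and U: "U \<in> GLO_tuples S d // sim S d k"
        and eq: "(Theta S d k T :: (('a, 'k, 'v) fil_phi_module \<times> 'v set) set) = Theta S d k U"
      obtain A where A: "A \<in> GLO_tuples S d" "T = sim S d k `` {A}" using T by (rule quotientE)
      obtain B where B: "B \<in> GLO_tuples S d" "U = sim S d k `` {B}" using U by (rule quotientE)
      obtain X :: "('a, 'k, 'v) fil_phi_module \<times> 'v set" where X: "X \<in> SDL S d k" "presented_by S d k A X"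
        using ex[OF A(1)] by blast
      have "X \<in> iso_rel S d k `` {X}" using eqi X(1) by (rule equiv_class_self)
      \<comment> \<open>One lattice is now presented by \<open>A\<close> and by a tuple equivalent
        to \<open>B\<close>, so uniqueness of the presentation applies.\<close>
      hence "X \<in> Theta S d k U" using cls[OF A(1) X] A(2) eq by blast
      then obtain B' where B': "(B, B') \<in> sim S d k" "presented_by S d k B' X"
        unfolding B(2) by (auto simp: Theta_def)
      have "B' \<in> GLO_tuples S d" using B'(1) by (simp add: sim_iff)
      hence "(A, B') \<in> sim S d k"
        using hodge_lattice.presented_by_unique[OF hodge, of "fst X" "snd X" A B'] X A(1) B'(2) by simp
      hence "(A, B) \<in> sim S d k" using B'(1) eqs by (meson equivE symD transD)
      thus "T = U" unfolding A(2) B(2) using eqs by (simp add: equiv_class_eq)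
    qed
    show "Theta S d k ` (GLO_tuples S d // sim S d k)
        = (SDL S d k :: (('a, 'k, 'v) fil_phi_module \<times> 'v set) set) // iso_rel S d k"
    proof
      show "Theta S d k ` (GLO_tuples S d // sim S d k)
        \<subseteq> (SDL S d k :: (('a, 'k, 'v) fil_phi_module \<times> 'v set) set) // iso_rel S d k"
      proof (rule image_subsetI)
        fix T assume "T \<in> GLO_tuples S d // sim S d k"
        then obtain A where A: "A \<in> GLO_tuples S d" "T = sim S d k `` {A}" by (rule quotientE)
        obtain X :: "('a, 'k, 'v) fil_phi_module \<times> 'v set" where X: "X \<in> SDL S d k" "presented_by S d k A X"
          using ex[OF A(1)] by blast
        show "Theta S d k T \<in> (SDL S d k :: (('a, 'k, 'v) fil_phi_module \<times> 'v set) set) // iso_rel S d k"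
          unfolding A(2) cls[OF A(1) X] using X(1) by (rule quotientI)
      qed
      show "(SDL S d k :: (('a, 'k, 'v) fil_phi_module \<times> 'v set) set) // iso_rel S d k
        \<subseteq> Theta S d k ` (GLO_tuples S d // sim S d k)"
      proof
        fix T assume "T \<in> (SDL S d k :: (('a, 'k, 'v) fil_phi_module \<times> 'v set) set) // iso_rel S d k"
        then obtain X :: "('a, 'k, 'v) fil_phi_module \<times> 'v set"
          where X: "X \<in> SDL S d k" "T = iso_rel S d k `` {X}" by (rule quotientE)
        obtain D L where DL: "X = (D, L)" by fastforce
        have "strongly_divisible S D L" using X(1) DL by (simp add: SDL_def)
        then obtain A where A: "A \<in> GLO_tuples S d" "presented_by S d k A X"
          using hodge_lattice.presentation_exists[OF hodge] X(1) DL by blast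
        show "T \<in> Theta S d k ` (GLO_tuples S d // sim S d k)"
          unfolding X(2) cls[OF A(1) X(1) A(2), symmetric] using A(1) by (intro imageI quotientI)
      qed
    qed
  qed
qed

end

section \<open>Weak admissibility\<close>

lemma det_mat_diag: "det (mat_diag n g) = (\<Prod>i<n. g i :: 'x::comm_ring_1)"
proof -
  have c: "mat_diag n g \<in> carrier_mat n n" by (rule mat_diag_dim)
  have "upper_triangular (mat_diag n g)" by (auto simp: mat_diag_def)
  hence "det (mat_diag n g) = prod_list (diag_mat (mat_diag n g))"
    using c by (rule det_upper_triangular)
  also have "diag_mat (mat_diag n g) = map g [0..<n]"
    by (auto simp: diag_mat_def mat_diag_def intro!: map_cong)
  also have "prod_list (map g [0..<n]) = (\<Prod>i<n. g i)"
    by (simp add: prod.distinct_set_conv_list[symmetric] atLeast0LessThan)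
  finally show ?thesis .
qed

section \<open>The determinant of \<phi> and its valuation\<close>

context phi_module
begin

lemma family_comb:
  assumes "\<And>m. m < n \<Longrightarrow> x m \<in> VF.span (b ` {..<n})"
  shows "\<exists>T \<in> carrier_mat n n. \<forall>m<n. x m = comb n b T m"
proof -
  have "\<forall>m. \<exists>c. m < n \<longrightarrow> x m = (\<Sum>l<n. sF D (c l) (b l))"
    using assms unfolding VF.span_family by blast
  then obtain c where c: "\<And>m. m < n \<Longrightarrow> x m = (\<Sum>l<n. sF D (c m l) (b l))" by metis
  have "x m = comb n b (mat n n (\<lambda>(l, m). c m l)) m" if "m < n" for m
    unfolding comb_def c[OF that] using that by (intro sum.cong) auto
  thus ?thesis by (intro bexI[of _ "mat n n (\<lambda>(l, m). c m l)"]) auto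
qed

text \<open>Well-definedness behind the definite description in \<open>det_phi\<close>: two bases
  have equal length, and their matrices are conjugate by mutually inverse transition
  matrices.\<close>

lemma det_phi_eq:
  assumes b: "VF.indep_family n b" and W: "W = VF.span (b ` {..<n})" and M: "M \<in> carrier_mat n n"
    and phi_b: "\<And>m. m < n \<Longrightarrow> phi D (b m) = comb n b M m"
  shows "det_phi D W = det M"
  unfolding det_phi_def
proof (rule the_equality)
  show "\<exists>n b M'. is_basis D UNIV W n b \<and> M' \<in> carrier_mat n n \<and>
      (\<forall>m<n. phi D (b m) = (\<Sum>l<n. sF D (M' $$ (l, m)) (b l))) \<and> det M = det M'"
    using assms unfolding is_basis_UNIV_iff comb_def by blast
next
  fix \<delta> assume "\<exists>n b M. is_basis D UNIV W n b \<and> M \<in> carrier_mat n n \<and>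
      (\<forall>m<n. phi D (b m) = (\<Sum>l<n. sF D (M $$ (l, m)) (b l))) \<and> \<delta> = det M"
  then obtain n' b' M' where b': "VF.indep_family n' b'" "W = VF.span (b' ` {..<n'})"
    and M': "M' \<in> carrier_mat n' n'" "\<delta> = det M'"
    and phi_b': "\<And>m. m < n' \<Longrightarrow> phi D (b' m) = comb n' b' M' m"
    unfolding is_basis_UNIV_iff comb_def by blast
  have n': "n' = n" using VF.dim_indep_family[OF b] VF.dim_indep_family[OF b'(1)] W b'(2) by metis
  note b' = b'[unfolded n'] and M' = M'[unfolded n'] and phi_b' = phi_b'[unfolded n']
  have "b' m \<in> VF.span (b ` {..<n})" "b m \<in> VF.span (b' ` {..<n})" if "m < n" for m
    using VF.span_base[of "b' m" "b' ` {..<n}"] VF.span_base[of "b m" "b ` {..<n}"] that W b'(2) by auto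
  then obtain T U where T: "T \<in> carrier_mat n n" "\<And>m. m < n \<Longrightarrow> b' m = comb n b T m"
    and U: "U \<in> carrier_mat n n" "\<And>m. m < n \<Longrightarrow> b m = comb n b' U m"
    using family_comb[of n b' b] family_comb[of n b b'] by blast
  have UT: "U * T = 1\<^sub>m n"
  proof (rule comb_inj[OF b'(1)])
    fix m assume m: "m < n"
    have "comb n b' (U * T) m = comb n (comb n b' U) T m" using comb_comb[OF U(1) T(1) m] by simp
    also have "\<dots> = comb n b T m" using U(2) by (intro comb_cong) auto
    finally show "comb n b' (U * T) m = comb n b' (1\<^sub>m n) m" using T(2)[OF m] comb_one[OF m] by simp
  qed (use T U in auto)
  have "M' = U * M * T"
  proof (rule comb_inj[OF b'(1) M'(1)])
    show "U * M * T \<in> carrier_mat n n" using T(1) U(1) M by auto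
    fix m assume m: "m < n"
    have "comb n b' M' m = phi D (comb n b T m)" using phi_b' T(2) m by simp
    also have "\<dots> = comb n (comb n b M) T m"
      unfolding phi_comb using phi_b by (intro comb_cong) auto
    also have "\<dots> = comb n b (M * T) m" using M T(1) m by (intro comb_comb)
    also have "\<dots> = comb n (comb n b' U) (M * T) m" using U(2) by (intro comb_cong) auto
    also have "\<dots> = comb n b' (U * (M * T)) m" using M T(1) U(1) m by (intro comb_comb) auto
    also have "U * (M * T) = U * M * T" using M T(1) U(1) by (simp add: assoc_mult_mat[of _ n n _ n _ n])
    finally show "comb n b' M' m = comb n b' (U * M * T) m" .
  qed
  hence "det M' = det U * det M * det T"
    using det_mult[of "U * M" n T] det_mult[OF U(1) M] T(1) U(1) M by auto
  moreover have "det U * det T = 1" using det_mult[OF U(1) T(1)] UT by simp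
  ultimately show "\<delta> = det M" using M'(2) by (simp add: mult.commute mult.left_commute)
qed

text \<open>Injectivity of \<phi> is used here because \<open>ordF\<close> is additive only on
  nonzero elements.\<close>

lemma det_phi_nonzero:
  assumes b: "VF.indep_family n b" and M: "M \<in> carrier_mat n n"
    and phi_b: "\<And>m. m < n \<Longrightarrow> phi D (b m) = comb n b M m"
  shows "det M \<noteq> 0"
proof
  assume "det M = 0"
  then obtain x where x: "x \<in> carrier_vec n" "x \<noteq> 0\<^sub>v n" "M *\<^sub>v x = 0\<^sub>v n"
    using det_0_iff_vec_prod_zero_field[OF M] by blast
  have "phi D (\<Sum>m<n. sF D (x $ m) (b m)) = (\<Sum>m<n. \<Sum>l<n. sF D (M $$ (l, m) * x $ m) (b l))"
    using phi_b by (simp add: phi.sum phi.scale comb_def VF.scale_sum_right mult.commute)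
  also have "\<dots> = (\<Sum>l<n. sF D ((M *\<^sub>v x) $ l) (b l))"
    using M x(1) by (subst sum.swap) (simp add: VF.scale_sum_left scalar_prod_def atLeast0LessThan)
  also have "\<dots> = 0" unfolding x(3) by simp
  finally have "phi D (\<Sum>m<n. sF D (x $ m) (b m)) = phi D 0" by simp
  hence "(\<Sum>m<n. sF D (x $ m) (b m)) = 0" by (rule injD[OF bij_is_inj[OF bij_phi]])
  hence "x $ m = 0" if "m < n" for m using b that unfolding VF.indep_family_def by blast
  hence "x = 0\<^sub>v n" using x(1) by (intro eq_vecI) auto
  thus False using x(2) by simp
qed

lemma ordF_mult: "x \<noteq> 0 \<Longrightarrow> y \<noteq> 0 \<Longrightarrow> ordF S (x * y) = ordF S x + ordF S y"
  by (simp add: ordF_def F.mult log_mult)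

lemma ordF_prod_powi: "ordF S (\<Prod>m<(n::nat). of_nat p powi \<kappa> m) = real_of_int (\<Sum>m<n. \<kappa> m)"
proof -
  have "ordF S (of_nat p powi j) = real_of_int j" for j
  proof -
    have "absF S (of_nat p powi j) = real p powr (- real_of_int j)"
      unfolding F.powi absF_p using p_gt_1
      by (simp add: powr_minus powr_real_of_int' power_int_divide_distrib field_simps)
    thus ?thesis using p_gt_1 by (simp add: ordF_def)
  qed
  thus ?thesis
    by (induction n) (auto simp: ordF_mult of_nat_p_nonzero, simp add: ordF_def)
qed

lemma ordF_nonneg: "x \<noteq> 0 \<Longrightarrow> absF S x \<le> 1 \<Longrightarrow> 0 \<le> ordF S x"
  using p_gt_1 by (simp add: ordF_def)

end

text \<open>The two divisibility conditions for a finitely generated lattice, without weak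
  admissibility. This is what is known of the standard lattice at the stage where weak admissibility
  has to be derived.\<close>

locale divisible_lattice = phi_module S D
  for S :: "('q::field_char_0, 'a::field, 'k::field) coeff_data"
    and D :: "('a, 'k, 'v::ab_group_add) fil_phi_module" +
  fixes L :: "'v set" and N :: nat and g :: "nat \<Rightarrow> 'v"
  assumes L_Ospan: "L = VO.Ospan N g" and span_g: "VF.span (g ` {..<N}) = UNIV"
    and divisible: "\<And>j x. x \<in> FilL D L j \<Longrightarrow> phi D x \<in> scale_p S D j ` L"
    and generated: "\<And>y. y \<in> L \<Longrightarrow> \<exists>J x. finite J \<and> (\<forall>j\<in>J. x j \<in> FilL D L j) \<and>
      y = (\<Sum>j\<in>J. scale_p S D (- j) (phi D (x j)))"
begin

text \<open>The basis is adapted to all Fil^j \<inter> \<open>W\<close> and to \<open>W\<close>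
  itself, so its initial segment of length \<open>n\<close> is a basis of
  \<open>L \<inter> W\<close>. The number \<open>\<kappa> m\<close> is the largest degree whose step
  in \<open>W\<close> contains the \<open>m\<close>-th vector.\<close>

lemma subobject_basis:
  assumes W: "VF.subspace W"
  shows "\<exists>n e \<kappa> q. VF.indep_family n e \<and> W = VF.span (e ` {..<n}) \<and> L \<inter> W = VO.Ospan n e \<and>
    (\<forall>j. Fil D j \<inter> L \<inter> W = VO.Ospan (q j) e) \<and> (\<forall>j m. m < q j \<longleftrightarrow> m < n \<and> j \<le> \<kappa> m) \<and>
    hodge_number D W = (\<Sum>m<n. \<kappa> m)"
proof -
  obtain B where B: "finite B" "VF.span B = UNIV" using finite_span by blast
  obtain E where "finite_dimensional_vector_space (sF D) E" using VF.finite_dimensional[OF B] by blast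
  then interpret fd: finite_dimensional_vector_space "sF D" E .
  \<comment> \<open>The whole space is added because the generators \<open>g\<close> span it and the
    chain needs a largest member; \<open>W\<close> itself is the intersection with an early
    filtration step.\<close>
  define Ch where "Ch = insert UNIV (range (\<lambda>j. Fil D j \<inter> W))"
  have "\<exists>e. VF.indep_family (VF.dim (UNIV :: 'v set)) e \<and>
    (\<forall>U\<in>Ch. VO.Ospan N g \<inter> U = VO.Ospan (VF.dim U) e \<and> VF.span (e ` {..<VF.dim U}) = U)"
  proof (rule VO.lattice_basis_adapted_to_chain[OF B])
    show "VF.subspace U" if "U \<in> Ch" for U
      using that W subspace_Fil by (auto simp: Ch_def intro: VF.subspace_inter)
    show "U \<subseteq> U' \<or> U' \<subseteq> U" if "U \<in> Ch" "U' \<in> Ch" for U U'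
      using that unfolding Ch_def by (elim insertE rangeE) (simp, simp, simp, simp only: chain_Fil)
  qed (use span_g in \<open>auto simp: Ch_def\<close>)
  then obtain e where e: "VF.indep_family (VF.dim (UNIV :: 'v set)) e"
    and *: "\<forall>U\<in>Ch. VO.Ospan N g \<inter> U = VO.Ospan (VF.dim U) e \<and> VF.span (e ` {..<VF.dim U}) = U"
    by (elim exE conjE)
  have eU: "L \<inter> U = VO.Ospan (VF.dim U) e" "VF.span (e ` {..<VF.dim U}) = U" if "U \<in> Ch" for U
    using bspec[OF * that] by (simp_all add: L_Ospan)
  define n where "n = VF.dim W"
  define q where "q j = VF.dim (Fil D j \<inter> W)" for j
  obtain j0 where j0: "Fil D j0 = UNIV" using Fil_UNIV by blast
  obtain j1 where j1: "Fil D j1 = {0}" using Fil_0 by blast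
  have WC: "W \<in> Ch" using j0 by (auto simp: Ch_def intro: image_eqI[of _ _ j0])
  have FC: "Fil D j \<inter> W \<in> Ch" for j by (simp add: Ch_def)
  have q_anti: "q j' \<le> q j" if "j \<le> j'" for j j'
    unfolding q_def using Fil_mono[OF that] by (intro fd.dim_subset) auto
  have q_le: "q j \<le> n" for j unfolding q_def n_def by (intro fd.dim_subset) auto
  have q0: "q j = n" if "j \<le> j0" for j
    using Fil_mono[OF that] j0 by (simp add: q_def n_def top.extremum_unique)
  have q1: "q j = 0" if "j1 \<le> j" for j
    using q_anti[OF that] j1 VF.subspace_0[OF W] by (simp add: q_def)
  \<comment> \<open>The dimensions \<open>q\<close> fall from \<open>n\<close> at \<open>j0\<close>
    to 0 at \<open>j1\<close>, so the degrees \<open>j\<close> with \<open>m < q j\<close> form a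
    ray bounded above, and \<open>\<kappa> m\<close> is its end.\<close>
  have "\<exists>\<kappa>. \<forall>j. m < q j \<longleftrightarrow> j \<le> \<kappa>" if m: "m < n" for m
  proof -
    define Js where "Js = {j \<in> {j0..j1}. m < q j}"
    have fin: "finite Js" by (rule finite_subset[of _ "{j0..j1}"]) (auto simp: Js_def)
    have lt: "j < j1" if "m < q j" for j using q1[of j] that by force
    have "j0 \<in> Js" using q0[of j0] m lt[of j0] by (simp add: Js_def)
    hence ne: "Js \<noteq> {}" by blast
    have K: "Max Js \<in> Js" using Max_in[OF fin ne] .
    have "m < q j \<longleftrightarrow> j \<le> Max Js" for j
    proof
      assume "m < q j"
      show "j \<le> Max Js"
      proof (cases "j0 \<le> j")
        case True
        thus ?thesis using \<open>m < q j\<close> lt[of j] by (intro Max_ge[OF fin]) (simp add: Js_def)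
      next
        case False
        thus ?thesis using Max_ge[OF fin \<open>j0 \<in> Js\<close>] by simp
      qed
    next
      assume "j \<le> Max Js"
      thus "m < q j" using q_anti[of j "Max Js"] K by (simp add: Js_def)
    qed
    thus ?thesis by blast
  qed
  hence "\<forall>m. \<exists>\<kappa>. m < n \<longrightarrow> (\<forall>j. m < q j \<longleftrightarrow> j \<le> \<kappa>)" by blast
  then obtain \<kappa> where \<kappa>: "\<And>m j. m < n \<Longrightarrow> m < q j \<longleftrightarrow> j \<le> \<kappa> m" by metis
  have qk: "m < q j \<longleftrightarrow> m < n \<and> j \<le> \<kappa> m" for m j using \<kappa>[of m j] q_le[of j] by auto
  have q_count: "q j = jump_count n \<kappa> j" for j
  proof -
    have "{m. m < n \<and> j \<le> \<kappa> m} = {..<q j}" using qk by auto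
    thus ?thesis by (simp add: jump_count_def)
  qed
  have q_diff: "int (q j) - int (q (j + 1)) = int (card {m. m < n \<and> \<kappa> m = j})" for j
    unfolding q_count by (subst jump_count_Suc) simp
  have "Fil D j \<inter> W \<noteq> Fil D (j + 1) \<inter> W \<longleftrightarrow> q j \<noteq> q (j + 1)" for j
    using eU(2)[OF FC, of j] eU(2)[OF FC, of "j + 1"] unfolding q_def by metis
  also have "q j \<noteq> q (j + 1) \<longleftrightarrow> j \<in> \<kappa> ` {..<n}" for j
  proof -
    have "q j \<noteq> q (j + 1) \<longleftrightarrow> card {m. m < n \<and> \<kappa> m = j} \<noteq> 0" using q_diff[of j] by linarith
    also have "\<dots> \<longleftrightarrow> {m. m < n \<and> \<kappa> m = j} \<noteq> {}" by (subst card_0_eq) auto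
    also have "\<dots> \<longleftrightarrow> j \<in> \<kappa> ` {..<n}" by auto
    finally show ?thesis .
  qed
  finally have "{j. Fil D j \<inter> W \<noteq> Fil D (j + 1) \<inter> W} = \<kappa> ` {..<n}" by blast
  \<comment> \<open>The Hodge number sums over distinct jumps with multiplicity; grouping the
    positions \<open>m\<close> by the value of \<open>\<kappa>\<close> turns it into a sum over the
    basis.\<close>
  hence "hodge_number D W = (\<Sum>j\<in>\<kappa> ` {..<n}. j * int (card {m. m < n \<and> \<kappa> m = j}))"
    unfolding hodge_number_def by (simp add: q_diff[unfolded q_def])
  also have "\<dots> = (\<Sum>j\<in>\<kappa> ` {..<n}. \<Sum>m\<in>{m \<in> {..<n}. \<kappa> m = j}. \<kappa> m)"
  proof (rule sum.cong[OF refl])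
    fix j
    have "(\<Sum>m\<in>{m \<in> {..<n}. \<kappa> m = j}. \<kappa> m) = (\<Sum>m\<in>{m \<in> {..<n}. \<kappa> m = j}. j)" by (intro sum.cong) auto
    thus "j * int (card {m. m < n \<and> \<kappa> m = j}) = (\<Sum>m\<in>{m \<in> {..<n}. \<kappa> m = j}. \<kappa> m)" by simp
  qed
  also have "\<dots> = (\<Sum>m<n. \<kappa> m)" by (rule sum.image_gen[symmetric]) simp
  finally have "hodge_number D W = (\<Sum>m<n. \<kappa> m)" .
  moreover have "VF.indep_family n e"
    using e by (rule VF.indep_family_mono) (unfold n_def, rule fd.dim_subset[OF subset_UNIV])
  moreover have "Fil D j \<inter> L \<inter> W = VO.Ospan (q j) e" for j
    using eU(1)[OF FC, of j] unfolding q_def by blast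
  ultimately show ?thesis using eU[OF WC] qk unfolding n_def[symmetric]
    by (intro exI[of _ n] exI[of _ e] exI[of _ \<kappa>] exI[of _ q]) auto
qed

lemma newton_ge_hodge:
  assumes W: "VF.subspace W" and stable: "phi D ` W \<subseteq> W"
  shows "real_of_int (hodge_number D W) \<le> newton_number S D W"
    and "W = UNIV \<Longrightarrow> real_of_int (hodge_number D W) = newton_number S D W"
proof -
  define P where "P = (of_nat p :: 'a)"
  have P: "P \<noteq> 0" "absF S P \<le> 1"
    using of_nat_p_nonzero F.of_nat_le_1 by (auto simp: P_def)
  obtain n e \<kappa> q where e: "VF.indep_family n e" and We: "W = VF.span (e ` {..<n})"
    and LW: "L \<inter> W = VO.Ospan n e" and FLW: "\<And>j. Fil D j \<inter> L \<inter> W = VO.Ospan (q j) e"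
    and q: "\<And>j m. m < q j \<longleftrightarrow> m < n \<and> j \<le> \<kappa> m" and hodge: "hodge_number D W = (\<Sum>m<n. \<kappa> m)"
    using subobject_basis[OF W] by blast
  have "\<exists>c. phi D (e m) = (\<Sum>l<n. sF D (c l * P powi \<kappa> m) (e l)) \<and> (\<forall>l<n. absF S (c l) \<le> 1)"
    if m: "m < n" for m
  proof -
    have em: "e m \<in> Fil D (\<kappa> m) \<inter> L \<inter> W"
      unfolding FLW using q[of m "\<kappa> m"] m by (intro VO.Ospan_base) simp
    then obtain y where y: "y \<in> L" "phi D (e m) = sF D (P powi \<kappa> m) y"
      using divisible[of "e m" "\<kappa> m"] by (auto simp: FilL_def scale_p_def P_def)
    have "y = sF D (inverse (P powi \<kappa> m)) (phi D (e m))" using y(2) P(1) by simp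
    moreover have "phi D (e m) \<in> W" using em stable by blast
    ultimately have "y \<in> W" using VF.subspace_scale[OF W] by metis
    hence "y \<in> VO.Ospan n e" using y(1) LW by blast
    then obtain c where "y = (\<Sum>l<n. sF D (c l) (e l))" "\<And>l. l < n \<Longrightarrow> absF S (c l) \<le> 1"
      by (auto elim: VO.OspanE)
    thus ?thesis using y(2) by (intro exI[of _ c]) (auto simp: VF.scale_sum_right mult.commute)
  qed
  moreover define Q where "Q m c \<longleftrightarrow> phi D (e m) = (\<Sum>l<n. sF D (c l * P powi \<kappa> m) (e l)) \<and>
      (\<forall>l<n. absF S (c l) \<le> 1)" for m c
  ultimately have "\<forall>m. \<exists>c. m < n \<longrightarrow> Q m c" by blast
  then obtain c where "\<And>m. m < n \<Longrightarrow> Q m (c m)" by metis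
  hence c: "\<And>m. m < n \<Longrightarrow> phi D (e m) = (\<Sum>l<n. sF D (c m l * P powi \<kappa> m) (e l))"
    "\<And>m l. m < n \<Longrightarrow> l < n \<Longrightarrow> absF S (c m l) \<le> 1" unfolding Q_def by auto
  define T where "T = mat n n (\<lambda>(l, m). c m l)"
  have T: "integral_mat n T" using c(2) by (auto simp: T_def integral_mat_def)
  hence Tc: "T \<in> carrier_mat n n" by (simp add: integral_mat_def)
  define M where "M = T * Delta S n \<kappa>"
  have M: "M \<in> carrier_mat n n" using Tc Delta_carrier[of n \<kappa>] by (auto simp: M_def)
  have phi_e: "phi D (e m) = comb n e M m" if m: "m < n" for m
    unfolding comb_def c(1)[OF m] M_def
    using mult_Delta_index[OF Tc _ m] m by (intro sum.cong refl) (simp add: T_def P_def)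
  have det: "det M = det T * (\<Prod>m<n. of_nat p powi \<kappa> m)"
    unfolding M_def det_mult[OF Tc Delta_carrier] by (simp add: Delta_def det_mat_diag)
  have "det M \<noteq> 0" using det_phi_nonzero[OF e M phi_e] .
  hence T0: "det T \<noteq> 0" using det by auto
  have "newton_number S D W = ordF S (det M)"
    unfolding newton_number_def by (subst det_phi_eq[OF e We M phi_e]) auto
  also have "\<dots> = ordF S (det T) + ordF S (\<Prod>m<n. of_nat p powi \<kappa> m)"
    unfolding det using T0 of_nat_p_nonzero by (intro ordF_mult) auto
  finally have newton: "newton_number S D W = ordF S (det T) + real_of_int (hodge_number D W)"
    unfolding ordF_prod_powi hodge .
  show "real_of_int (hodge_number D W) \<le> newton_number S D W"
    using newton ordF_nonneg[OF T0 det_integral[OF T]] by simp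
  assume U: "W = UNIV"
  \<comment> \<open>On the whole space the generation condition gives the integral factor
    \<open>T\<close> an integral right inverse, so \<open>det T\<close> is a unit and contributes
    nothing to the Newton number.\<close>
  have "\<exists>N. (\<forall>m<n. \<forall>l<n. absF S (N m l) \<le> 1) \<and>
    (\<forall>l<n. \<forall>l'<n. (\<Sum>m<n. c m l * N m l') = (if l = l' then 1 else 0))"
  proof (rule VO.divisibility_matrix_right_inverse[OF phi_linear P, where e = e and e' = e and r = q])
    fix l assume "l < n"
    hence "e l \<in> L" using VO.Ospan_base[of l n e] LW by blast
    then obtain J x where J: "finite J" "\<forall>j\<in>J. x j \<in> FilL D L j"
      "e l = (\<Sum>j\<in>J. scale_p S D (- j) (phi D (x j)))" using generated by blast
    have "x j \<in> VO.Ospan (q j) e" if "j \<in> J" for j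
      using J(2) that FLW[of j] U by (auto simp: FilL_def)
    thus "\<exists>J x. finite J \<and> (\<forall>j\<in>J. x j \<in> VO.Ospan (q j) e) \<and> e l = (\<Sum>j\<in>J. sF D (P powi - j) (phi D (x j)))"
      using J by (intro exI[of _ J] exI[of _ x]) (auto simp: scale_p_def P_def)
  qed (use c e q in auto)
  then obtain N where N: "\<And>m l. m < n \<Longrightarrow> l < n \<Longrightarrow> absF S (N m l) \<le> 1"
    "\<And>l l'. l < n \<Longrightarrow> l' < n \<Longrightarrow> (\<Sum>m<n. c m l * N m l') = (if l = l' then 1 else 0)" by blast
  define V where "V = mat n n (\<lambda>(m, l). N m l)"
  have V: "integral_mat n V" using N(1) by (auto simp: V_def integral_mat_def)
  have "T * V = 1\<^sub>m n"
  proof (rule eq_matI)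
    fix a b assume "a < dim_row (1\<^sub>m n)" "b < dim_col (1\<^sub>m n)"
    hence ab: "a < n" "b < n" by auto
    have "(T * V) $$ (a, b) = (\<Sum>m<n. T $$ (a, m) * V $$ (m, b))"
      using ab Tc by (intro index_mult_mat_sum[of _ n n _ n]) (auto simp: V_def)
    also have "\<dots> = (\<Sum>m<n. c m a * N m b)" using ab by (simp add: T_def V_def)
    finally show "(T * V) $$ (a, b) = 1\<^sub>m n $$ (a, b)" using N(2)[OF ab] ab by simp
  qed (auto simp: T_def V_def)
  moreover have "V \<in> carrier_mat n n" by (simp add: V_def)
  ultimately have "det T * det V = 1" using det_mult[OF Tc] by (metis det_one)
  hence "absF S (det T) * absF S (det V) = 1" by (metis F.mult F.one)
  hence "absF S (det T) = 1"
    using det_integral[OF T] det_integral[OF V] F.nonneg[of "det T"] F.nonneg[of "det V"]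
    by (metis mult.right_neutral mult_left_le order_antisym)
  thus "real_of_int (hodge_number D W) = newton_number S D W" using newton by (simp add: ordF_def)
qed

lemma weakly_admissible: "weakly_admissible S D"
  unfolding weakly_admissible_def
  using fpm newton_ge_hodge(2)[OF VF.subspace_UNIV] newton_ge_hodge(1) submod_iff_subspace by auto

end

section \<open>The standard lattice\<close>

text \<open>The basis \<open>e\<close> is indexed by component and position, and the coordinate
  function \<open>co\<close> is fixed along with it, so that all structure can be defined on
  coordinates.\<close>

locale standard_lattice = coeff_ring S + lin_space s
  for S :: "('q::field_char_0, 'a::field, 'k::field) coeff_data"
    and s :: "'a \<Rightarrow> 'v::ab_group_add \<Rightarrow> 'v" +
  fixes d :: nat and k :: "nat \<Rightarrow> nat \<Rightarrow> int" and A :: "nat \<Rightarrow> 'a mat"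
    and e :: "nat \<Rightarrow> nat \<Rightarrow> 'v" and co :: "'v \<Rightarrow> nat \<Rightarrow> nat \<Rightarrow> 'a"
  assumes k_decreasing: "\<forall>i<f. decreasing_upto d (k i)"
    and k_nonneg: "\<And>i m. i < f \<Longrightarrow> m < d \<Longrightarrow> 0 \<le> k i m"
    and A: "A \<in> GLO_tuples S d"
    and expand: "(\<Sum>i<f. \<Sum>m<d. s (co v i m) (e i m)) = v"
    and co_sum: "i < f \<Longrightarrow> m < d \<Longrightarrow> co (\<Sum>i<f. \<Sum>m<d. s (c i m) (e i m)) i m = c i m"
begin

definition mk :: "(nat \<Rightarrow> nat \<Rightarrow> 'a) \<Rightarrow> 'v" where
  "mk c = (\<Sum>i<f. \<Sum>m<d. s (c i m) (e i m))"

lemma mk_co [simp]: "mk (co v) = v"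
  by (simp add: mk_def expand)

lemma co_mk [simp]: "i < f \<Longrightarrow> m < d \<Longrightarrow> co (mk c) i m = c i m"
  by (simp add: mk_def co_sum)

lemma mk_cong: "(\<And>i m. i < f \<Longrightarrow> m < d \<Longrightarrow> c i m = c' i m) \<Longrightarrow> mk c = mk c'"
  unfolding mk_def by (intro sum.cong) auto

lemma co_eqI: "(\<And>i m. i < f \<Longrightarrow> m < d \<Longrightarrow> co v i m = co w i m) \<Longrightarrow> v = w"
  using mk_cong[of "co v" "co w"] by simp

lemma co_add [simp]: "i < f \<Longrightarrow> m < d \<Longrightarrow> co (v + w) i m = co v i m + co w i m"
proof -
  have "v + w = mk (\<lambda>i m. co v i m + co w i m)"
    by (simp add: mk_def scale_left_distrib sum.distrib expand)
  thus "i < f \<Longrightarrow> m < d \<Longrightarrow> co (v + w) i m = co v i m + co w i m" by simp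
qed

lemma co_scale [simp]: "i < f \<Longrightarrow> m < d \<Longrightarrow> co (s a v) i m = a * co v i m"
proof -
  have "s a v = mk (\<lambda>i m. a * co v i m)"
    using arg_cong[OF expand[of v], of "s a"] by (simp add: mk_def scale_sum_right)
  thus "i < f \<Longrightarrow> m < d \<Longrightarrow> co (s a v) i m = a * co v i m" by simp
qed

lemma co_zero [simp]: "i < f \<Longrightarrow> m < d \<Longrightarrow> co 0 i m = 0"
  using co_scale[of i m 0 0] by simp

lemma co_minus [simp]: "i < f \<Longrightarrow> m < d \<Longrightarrow> co (- v) i m = - co v i m"
  using co_scale[of i m "- 1" v] by simp

lemma co_sum_set: "i < f \<Longrightarrow> m < d \<Longrightarrow> co (sum h J) i m = (\<Sum>x\<in>J. co (h x) i m)"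
  by (induction J rule: infinite_finite_induct) auto

lemma co_e [simp]:
  assumes "i < f" "m < d" "i' < f" "m' < d"
  shows "co (e i' m') i m = (if i = i' \<and> m = m' then 1 else 0)"
proof -
  have "mk (\<lambda>i m. if i = i' \<and> m = m' then 1 else 0)
      = (\<Sum>i<f. \<Sum>m<d. if i = i' then if m = m' then e i m else 0 else 0)"
    unfolding mk_def by (intro sum.cong) auto
  also have "\<dots> = (\<Sum>i<f. if i = i' then \<Sum>m<d. if m = m' then e i m else 0 else 0)"
    by (intro sum.cong) auto
  also have "\<dots> = e i' m'" using assms by simp
  finally show ?thesis using co_mk[OF assms(1,2), of "\<lambda>i m. if i = i' \<and> m = m' then 1 else 0"] by simp
qed

section \<open>The structure maps of the standard lattice\<close>

abbreviation "\<Delta> i \<equiv> Delta S d (k (prev S i))"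

definition M :: "nat \<Rightarrow> 'a mat" where "M i = A i * \<Delta> i"

lemma A_GLO: "i < f \<Longrightarrow> A i \<in> GLO S d"
  using GLO_tuples_D[OF A] .

lemma M_carrier: "i < f \<Longrightarrow> M i \<in> carrier_mat d d"
  unfolding M_def using mult_carrier_mat[OF GLO_carrier[OF A_GLO] Delta_carrier] .

lemma M_index:
  "i < f \<Longrightarrow> l < d \<Longrightarrow> m < d \<Longrightarrow> M i $$ (l, m) = A i $$ (l, m) * of_nat p powi k (prev S i) m"
  unfolding M_def using mult_Delta_index[OF GLO_carrier[OF A_GLO]] .

lemma p_powi_integral: "0 \<le> j \<Longrightarrow> absF S (of_nat p powi j) \<le> 1"
  using F.le_1_power[OF F.of_nat_le_1] by (simp add: power_int_def)

text \<open>Every field is forced by the aim that the \<open>e i\<close> be adapted bases with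
  matrices \<open>M i\<close>: \<open>K\<close> acts on component \<open>i\<close> through
  \<open>emb S i\<close>, and a position lies in the filtration up to its jump.\<close>

definition D :: "('a, 'k, 'v) fil_phi_module" where
  "D = \<lparr>sF = s, sK = (\<lambda>b v. mk (\<lambda>i m. emb S i b * co v i m)),
    phi = (\<lambda>v. mk (\<lambda>i l. \<Sum>m<d. M i $$ (l, m) * co v (prev S i) m)),
    Fil = (\<lambda>j. {v. \<forall>i<f. \<forall>m<d. co v i m \<noteq> 0 \<longrightarrow> j \<le> k i m})\<rparr>"

definition L :: "'v set" where "L = {v. \<forall>i<f. \<forall>m<d. absF S (co v i m) \<le> 1}"

lemma D_simps [simp]:
  "sF D = s" "sK D b v = mk (\<lambda>i m. emb S i b * co v i m)"
  "phi D v = mk (\<lambda>i l. \<Sum>m<d. M i $$ (l, m) * co v (prev S i) m)"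
  "v \<in> Fil D j \<longleftrightarrow> (\<forall>i<f. \<forall>m<d. co v i m \<noteq> 0 \<longrightarrow> j \<le> k i m)"
  by (auto simp: D_def)

lemma bij_phi: "bij (phi D)"
proof -
  define U where "U i = minv (\<Delta> i) * minv (A i)" for i
  have U: "U i \<in> carrier_mat d d" "M i * U i = 1\<^sub>m d" "U i * M i = 1\<^sub>m d" if i: "i < f" for i
  proof -
    note c = GLO_carrier[OF A_GLO[OF i]] GLO_minv(4)[OF A_GLO[OF i]] Delta_carrier[of d "k (prev S i)"]
      Delta_minv(3)[of d "k (prev S i)"]
    show Uc: "U i \<in> carrier_mat d d" unfolding U_def using c by auto
    have "M i * U i = A i * (\<Delta> i * minv (\<Delta> i)) * minv (A i)"
      unfolding M_def U_def using c by (simp add: assoc_mult_mat[of _ d d _ d _ d] mult_carrier_mat[of _ d d _ d])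
    also have "\<dots> = 1\<^sub>m d" using c Delta_minv(1)[of d "k (prev S i)"] GLO_minv(2)[OF A_GLO[OF i]] by simp
    finally show "M i * U i = 1\<^sub>m d" .
    from mat_mult_left_right_inverse[OF M_carrier[OF i] Uc this] show "U i * M i = 1\<^sub>m d" .
  qed
  \<comment> \<open>Frobenius fills component \<open>nxt i\<close> from component \<open>i\<close>,
    so its inverse reads component \<open>nxt i\<close>.\<close>
  define \<psi> where "\<psi> v = mk (\<lambda>i m. \<Sum>l<d. U (nxt i) $$ (m, l) * co v (nxt i) l)" for v
  show ?thesis
  proof (rule o_bij)
    show "\<psi> \<circ> phi D = id"
    proof
      fix v
      have "\<psi> (phi D v) = v"
      proof (rule co_eqI)
        fix i m assume im: "i < f" "m < d"
        show "co (\<psi> (phi D v)) i m = co v i m"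
          using im mat_inverse_apply[OF M_carrier U(1,3) im(2), OF nxt_less nxt_less nxt_less, of i "co v i"]
          by (simp add: \<psi>_def nxt_less prev_nxt)
      qed
      thus "(\<psi> \<circ> phi D) v = id v" by simp
    qed
    show "phi D \<circ> \<psi> = id"
    proof
      fix v
      have "phi D (\<psi> v) = v"
      proof (rule co_eqI)
        fix i l assume il: "i < f" "l < d"
        show "co (phi D (\<psi> v)) i l = co v i l"
          using il mat_inverse_apply[OF U(1) M_carrier U(2) il(2), OF il(1) il(1) il(1), of "co v i"]
          by (simp add: \<psi>_def prev_less nxt_prev)
      qed
      thus "(phi D \<circ> \<psi>) v = id v" by simp
    qed
  qed
qed

lemma submod_Fil: "submod D UNIV UNIV (Fil D j)"
  unfolding submod_def by (auto simp del: D_simps(3)) (metis add.right_neutral)+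

lemma Fil_top: "Fil D 0 = UNIV"
  using k_nonneg by (auto simp: D_def)

lemma Fil_bot: "\<exists>j. Fil D j = {0}"
proof -
  \<comment> \<open>The jumps are nonnegative, so each is at most their sum; adding 1 passes beyond
    all of them.\<close>
  define K where "K = (\<Sum>i<f. \<Sum>m<d. k i m) + 1"
  have "k i m < K" if im: "i < f" "m < d" for i m
  proof -
    have "k i m \<le> (\<Sum>m<d. k i m)" using im k_nonneg by (intro member_le_sum) auto
    also have "\<dots> \<le> (\<Sum>i<f. \<Sum>m<d. k i m)"
      using im k_nonneg by (intro member_le_sum[of i "{..<f}" "\<lambda>i. \<Sum>m<d. k i m"] sum_nonneg) auto
    finally show ?thesis by (simp add: K_def)
  qed
  hence K: "\<not> K \<le> k i m" if "i < f" "m < d" for i m using that by force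
  have "v \<in> Fil D K \<longleftrightarrow> v = 0" for v
  proof
    assume v: "v \<in> Fil D K"
    show "v = 0"
    proof (rule co_eqI)
      fix i m assume "i < f" "m < d"
      thus "co v i m = co 0 i m" using v K[of i m] by auto
    qed
  qed simp
  hence "Fil D K = {0}" by (auto simp del: D_simps(4))
  thus ?thesis ..
qed

lemma filtered_phi_module:
  assumes "finite B" "span B = UNIV"
  shows "filtered_phi_module S D"
  unfolding filtered_phi_module_def
proof (intro conjI allI)
  have vs: "Vector_Spaces.vector_space s" by unfold_locales
  show "Vector_Spaces.vector_space (sF D)" using vs by simp
  show "Vector_Spaces.vector_space (sK D)"
    by unfold_locales (auto intro!: co_eqI simp: emb.hom_add emb.hom_mult algebra_simps)
  show "\<exists>B. finite B \<and> Modules.module.span (sF D) B = UNIV" using assms by auto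
  show "Vector_Spaces.linear (sF D) (sF D) (phi D)"
    unfolding Vector_Spaces.linear_iff D_simps(1) using vs prev_less
    by (auto intro!: co_eqI simp: distrib_left sum.distrib sum_distrib_left mult.left_commute)
  show "\<exists>j. Fil D j = UNIV" using Fil_top by blast
  show "\<exists>j. Fil D j = {0}" by (rule Fil_bot)
  show "submod D UNIV UNIV (Fil D j)" for j by (rule submod_Fil)
  show "Fil D (j + 1) \<subseteq> Fil D j" for j by (force simp del: D_simps(3))
  show "sF D a (sK D b x) = sK D b (sF D a x)" for a b x
    by (auto intro!: co_eqI simp: mult.left_commute)
  show "sF D (inclF S q) x = sK D (inclK S q) x" for q x
    by (auto intro!: co_eqI simp: emb_inclK)
  show "phi D (sK D b x) = sK D (frob S b) (phi D x)" for b x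
    using prev_less by (auto intro!: co_eqI simp: emb_frob sum_distrib_left mult.left_commute)
  show "bij (phi D)" by (rule bij_phi)
qed

section \<open>Strong divisibility of the standard lattice\<close>

lemma L_submod: "submod D (ringF S) (ringK S) L"
  unfolding submod_def L_def
  by (auto simp: ringF_def ringK_def intro!: F.le_1_add F.le_1_mult emb_integral)

lemma L_sum: "(\<And>x. x \<in> J \<Longrightarrow> h x \<in> L) \<Longrightarrow> sum h J \<in> L"
  by (induction J rule: infinite_finite_induct) (use L_submod in \<open>auto simp: submod_def\<close>)

text \<open>Membership from the basis expansion, for any \<open>T\<close> containing 0 and closed
  under addition; it is applied to submodules, integral spans and linear spans.\<close>

lemma L_lincomb: "(\<And>i m. i < f \<Longrightarrow> m < d \<Longrightarrow> co v i m \<noteq> 0 \<Longrightarrow> s (co v i m) (e i m) \<in> T) \<Longrightarrow>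
    0 \<in> T \<Longrightarrow> (\<And>x y. x \<in> T \<Longrightarrow> y \<in> T \<Longrightarrow> x + y \<in> T) \<Longrightarrow> v \<in> T"
proof -
  assume T: "\<And>i m. i < f \<Longrightarrow> m < d \<Longrightarrow> co v i m \<noteq> 0 \<Longrightarrow> s (co v i m) (e i m) \<in> T"
    "0 \<in> T" "\<And>x y. x \<in> T \<Longrightarrow> y \<in> T \<Longrightarrow> x + y \<in> T"
  have sums: "sum h I \<in> T" if "\<And>i. i \<in> I \<Longrightarrow> h i \<in> T" for I :: "nat set" and h
    using that by (induction I rule: infinite_finite_induct) (auto intro: T)
  have "s (co v i m) (e i m) \<in> T" if "i < f" "m < d" for i m
    using T(1)[OF that] T(2) by (cases "co v i m = 0") auto
  hence "(\<Sum>i<f. \<Sum>m<d. s (co v i m) (e i m)) \<in> T" by (intro sums) auto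
  thus "v \<in> T" by (simp add: expand)
qed

lemma e_in_L: "i < f \<Longrightarrow> m < d \<Longrightarrow> e i m \<in> L"
  by (simp add: L_def)

lemma phi_lattice: "phi_lattice S D L"
  unfolding phi_lattice_def
proof (intro conjI)
  show "submod D (ringF S) (ringK S) L" by (rule L_submod)
  define B where "B = (\<lambda>(i, m). e i m) ` ({..<f} \<times> {..<d})"
  have "finite B" by (simp add: B_def)
  moreover have "L = submod D (ringF S) (ringK S) hull B"
  proof
    show "submod D (ringF S) (ringK S) hull B \<subseteq> L"
      using L_submod e_in_L by (intro hull_minimal) (auto simp: B_def)
    show "L \<subseteq> submod D (ringF S) (ringK S) hull B"
    proof (rule subsetI, unfold hull_def, rule InterI)
      fix v T assume v: "v \<in> L" and T: "T \<in> {T. submod D (ringF S) (ringK S) T \<and> B \<subseteq> T}"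
      have "e i m \<in> T" if "i < f" "m < d" for i m
        using T that by (auto simp: B_def)
      thus "v \<in> T" using T v
        by (intro L_lincomb[of v T]) (simp_all add: submod_def L_def ringF_def)
    qed
  qed
  ultimately show "\<exists>B. finite B \<and> L = submod D (ringF S) (ringK S) hull B" by blast
  show "submod D UNIV UNIV hull L = UNIV"
  proof (rule equalityI[OF subset_UNIV], rule subsetI, unfold hull_def, rule InterI)
    fix v T assume T: "T \<in> {T. submod D UNIV UNIV T \<and> L \<subseteq> T}"
    have "e i m \<in> T" if "i < f" "m < d" for i m using T e_in_L[OF that] by blast
    thus "v \<in> T" using T by (intro L_lincomb[of v T]) (simp_all add: submod_def)
  qed
  show "phi D ` L \<subseteq> L"
  proof (rule image_subsetI)
    fix v assume v: "v \<in> L"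
    have "absF S (M i $$ (l, m)) \<le> 1" if "i < f" "l < d" "m < d" for i l m
      using that GLO_integral[OF A_GLO] p_powi_integral k_nonneg[OF prev_less]
      by (auto simp: M_index intro!: F.le_1_mult)
    thus "phi D v \<in> L" using v prev_less by (auto simp: L_def intro!: F.sum_le F.le_1_mult)
  qed
qed

lemma divisible:
  assumes x: "x \<in> FilL D L j"
  shows "phi D x \<in> scale_p S D j ` L"
proof -
  define P where "P = (of_nat p :: 'a)"
  have P: "P \<noteq> 0" using of_nat_p_nonzero by (simp add: P_def)
  have "absF S (co (s (P powi - j) (phi D x)) i l) \<le> 1" if il: "i < f" "l < d" for i l
  proof -
    have "absF S (P powi - j * (M i $$ (l, m) * co x (prev S i) m)) \<le> 1" if m: "m < d" for m
    proof (cases "co x (prev S i) m = 0")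
      case False
      hence jx: "j \<le> k (prev S i) m" "absF S (co x (prev S i) m) \<le> 1"
        using x prev_less m by (auto simp: FilL_def L_def)
      \<comment> \<open>A nonzero coordinate in degree \<open>j\<close> has jump at least
        \<open>j\<close>, so the power of \<open>p\<close> that remains after cancellation is
        nonnegative.\<close>
      have eq: "P powi - j * (M i $$ (l, m) * co x (prev S i) m)
          = A i $$ (l, m) * P powi (k (prev S i) m - j) * co x (prev S i) m"
        using P M_index[OF il m] by (simp add: P_def[symmetric] power_int_diff power_int_minus field_simps)
      show ?thesis unfolding eq
        using GLO_integral[OF A_GLO[OF il(1)] il(2) m] p_powi_integral[of "k (prev S i) m - j"] jx
        by (intro F.le_1_mult) (simp_all add: P_def)
    qed simp
    thus ?thesis using il by (auto simp: sum_distrib_left intro!: F.sum_le)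
  qed
  hence "s (P powi - j) (phi D x) \<in> L" by (simp add: L_def del: D_simps(3))
  moreover have "phi D x = scale_p S D j (s (P powi - j) (phi D x))"
    using P by (simp add: scale_p_def P_def[symmetric] power_int_minus del: D_simps(3))
  ultimately show ?thesis by blast
qed

lemma generated:
  assumes y: "y \<in> L"
  shows "\<exists>J x. finite J \<and> (\<forall>j\<in>J. x j \<in> FilL D L j) \<and> y = (\<Sum>j\<in>J. scale_p S D (- j) (phi D (x j)))"
proof -
  define P where "P = (of_nat p :: 'a)"
  have P: "P \<noteq> 0" using of_nat_p_nonzero by (simp add: P_def)
  \<comment> \<open>The coordinates of \<open>y\<close> multiplied by the inverse of
    \<open>A i\<close>; they are integral because \<open>A i\<close> is invertible over the
    integers.\<close>
  define c where "c i m = (\<Sum>l<d. minv (A i) $$ (m, l) * co y i l)" for i m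
  have c1: "absF S (c i m) \<le> 1" if "i < f" "m < d" for i m
    using y that GLO_integral[OF GLO_minv(1)[OF A_GLO]]
    unfolding c_def by (auto simp: L_def intro!: F.sum_le F.le_1_mult)
  define J where "J = (\<lambda>(i, m). k i m) ` ({..<f} \<times> {..<d})"
  \<comment> \<open>The part of the preimage on positions of jump exactly \<open>j\<close>, where
    dividing by the \<open>j\<close>-th power of \<open>p\<close> cancels \<open>\<Delta>\<close>
    and leaves \<open>A\<close> times \<open>c\<close>. The index is \<open>nxt i\<close> because
    component \<open>i\<close> feeds component \<open>nxt i\<close>.\<close>
  define x where "x j = mk (\<lambda>i m. if k i m = j then c (nxt i) m else 0)" for j
  have "x j \<in> FilL D L j" for j
    using c1 nxt_less by (auto simp: FilL_def L_def x_def)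
  moreover have "y = (\<Sum>j\<in>J. scale_p S D (- j) (phi D (x j)))"
  proof (rule co_eqI)
    fix i l assume il: "i < f" "l < d"
    let ?h = "k (prev S i)"
    have J: "finite J" "m < d \<Longrightarrow> ?h m \<in> J" for m
      using prev_less[of i] by (auto simp: J_def intro!: image_eqI[of _ _ "(prev S i, m)"])
    have "co (\<Sum>j\<in>J. scale_p S D (- j) (phi D (x j))) i l
        = (\<Sum>j\<in>J. \<Sum>m<d. P powi - j * (M i $$ (l, m) * (if ?h m = j then c i m else 0)))"
      using il prev_less[of i] nxt_prev[OF il(1)]
      by (simp add: co_sum_set scale_p_def P_def[symmetric] x_def sum_distrib_left cong: if_cong)
    also have "\<dots> = (\<Sum>m<d. \<Sum>j\<in>J. P powi - j * (M i $$ (l, m) * (if ?h m = j then c i m else 0)))"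
      by (rule sum.swap)
    also have "\<dots> = (\<Sum>m<d. A i $$ (l, m) * c i m)"
    proof (rule sum.cong[OF refl])
      fix m assume "m \<in> {..<d}"
      hence m: "m < d" by simp
      have "(\<Sum>j\<in>J. P powi - j * (M i $$ (l, m) * (if ?h m = j then c i m else 0)))
          = (\<Sum>j\<in>J. if ?h m = j then P powi - ?h m * (M i $$ (l, m) * c i m) else 0)"
        by (intro sum.cong) auto
      also have "\<dots> = P powi - ?h m * (M i $$ (l, m) * c i m)" using J m by simp
      also have "\<dots> = A i $$ (l, m) * c i m"
        using P M_index[OF il m] by (simp add: P_def[symmetric] power_int_minus)
      finally show "(\<Sum>j\<in>J. P powi - j * (M i $$ (l, m) * (if ?h m = j then c i m else 0))) = A i $$ (l, m) * c i m" .
    qed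
    also have "\<dots> = co y i l"
      using mat_inverse_apply[OF GLO_minv(4) GLO_carrier GLO_minv(2) il(2), of "A i" "co y i"] A_GLO[OF il(1)]
      by (simp add: c_def)
    finally show "co y i l = co (\<Sum>j\<in>J. scale_p S D (- j) (phi D (x j))) i l" ..
  qed
  moreover have "finite J" by (simp add: J_def)
  ultimately show ?thesis by blast
qed

text \<open>The grid of basis vectors is listed as one family \<open>g\<close> generating
  \<open>L\<close>, which makes \<open>divisible_lattice\<close> available and with it weak
  admissibility.\<close>

lemma strongly_divisible:
  assumes B: "finite B" "span B = UNIV"
  shows "strongly_divisible S D L"
proof -
  interpret D: phi_module S D by unfold_locales (rule filtered_phi_module[OF B])
  have "finite ((\<lambda>(i, m). e i m) ` ({..<f} \<times> {..<d}))" by simp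
  then obtain N :: nat and g where g: "(\<lambda>(i, m). e i m) ` ({..<f} \<times> {..<d}) = g ` {l. l < N}"
    using finite_imp_nat_seg_image_inj_on[of "(\<lambda>(i, m). e i m) ` ({..<f} \<times> {..<d})"] by blast
  have ge: "\<exists>l<N. e i m = g l" if "i < f" "m < d" for i m
  proof -
    have "e i m \<in> (\<lambda>(i, m). e i m) ` ({..<f} \<times> {..<d})" using that by force
    thus ?thesis unfolding g by auto
  qed
  have L: "L = D.VO.Ospan N g"
  proof
    show "L \<subseteq> D.VO.Ospan N g"
    proof
      fix v assume v: "v \<in> L"
      show "v \<in> D.VO.Ospan N g"
      proof (rule L_lincomb)
        fix i m assume im: "i < f" "m < d"
        then obtain l where "l < N" "e i m = g l" using ge by blast
        thus "s (co v i m) (e i m) \<in> D.VO.Ospan N g"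
          using D.VO.Ospan_scale[OF D.VO.Ospan_base[of l N g], of "co v i m"] v im by (simp add: L_def)
      qed (rule D.VO.Ospan_zero, rule D.VO.Ospan_add)
    qed
    show "D.VO.Ospan N g \<subseteq> L"
    proof (rule D.VO.Ospan_minimal)
      fix l assume "l < N"
      hence "g l \<in> (\<lambda>(i, m). e i m) ` ({..<f} \<times> {..<d})" using g by blast
      thus "g l \<in> L" using e_in_L by auto
    qed (use L_submod in \<open>auto simp: submod_def ringF_def\<close>)
  qed
  have span: "D.VF.span (g ` {..<N}) = UNIV"
  proof (rule equalityI[OF subset_UNIV], rule subsetI)
    fix v
    show "v \<in> D.VF.span (g ` {..<N})"
    proof (rule L_lincomb)
      fix i m assume "i < f" "m < d"
      then obtain l where "l < N" "e i m = g l" using ge by blast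
      thus "s (co v i m) (e i m) \<in> D.VF.span (g ` {..<N})"
        using D.VF.span_scale[OF D.VF.span_base[of "g l" "g ` {..<N}"], of "co v i m"] by simp
    qed (rule D.VF.span_zero, rule D.VF.span_add)
  qed
  interpret divisible_lattice S D L N g
    using L span divisible generated by unfold_locales
  have "(\<Sum>j\<in>J. scale_p S D (- j) (phi D (x j))) \<in> L" if x: "\<forall>j\<in>J. x j \<in> FilL D L j" for J x
  proof -
    have "scale_p S D (- j) (phi D (x j)) \<in> L" if j: "j \<in> J" for j
    proof -
      obtain y where "y \<in> L" "phi D (x j) = scale_p S D j y" using divisible[of "x j" j] x j by blast
      thus ?thesis using of_nat_p_nonzero by (simp add: scale_p_def power_int_minus del: D_simps(3))
    qed
    thus ?thesis by (rule L_sum)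
  qed
  moreover have "y \<in> {(\<Sum>j\<in>J. scale_p S D (- j) (phi D (x j))) | J x. finite J \<and> (\<forall>j\<in>J. x j \<in> FilL D L j)}"
    if "y \<in> L" for y using generated[OF that] by blast
  ultimately have "{(\<Sum>j\<in>J. scale_p S D (- j) (phi D (x j))) | J x. finite J \<and> (\<forall>j\<in>J. x j \<in> FilL D L j)} = L"
    by (intro equalityI subsetI) auto
  thus ?thesis unfolding strongly_divisible_def
    using weakly_admissible phi_lattice divisible by blast
qed

lemma presents:
  assumes B: "finite B" "span B = UNIV"
  shows "(D, L) \<in> SDL S d k" "presented_by S d k A (D, L)"
proof -
  interpret D: phi_module S D by unfold_locales (rule filtered_phi_module[OF B])
  have comp_iff: "v \<in> D.comp i \<longleftrightarrow> (\<forall>i'<f. \<forall>m<d. i' \<noteq> i \<longrightarrow> co v i' m = 0)" if i: "i < f" for v i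
  proof
    assume v: "v \<in> D.comp i"
    \<comment> \<open>Testing the action of one element \<open>a\<close> of \<open>K\<close> with
      distinct conjugates is enough to kill the coordinates of the other components.\<close>
    obtain a where a: "\<forall>i<f. \<forall>j<f. i \<noteq> j \<longrightarrow> absF S (emb S i a - emb S j a) = 1"
      using primitive_element by blast
    show "\<forall>i'<f. \<forall>m<d. i' \<noteq> i \<longrightarrow> co v i' m = 0"
    proof (intro allI impI)
      fix i' m assume *: "i' < f" "m < d" "i' \<noteq> i"
      have "emb S i' a * co v i' m = emb S i a * co v i' m"
        using arg_cong[OF D.comp_sK[OF v, of a], of "\<lambda>w. co w i' m"] * by simp
      moreover have "emb S i' a \<noteq> emb S i a" using a * i by force
      ultimately show "co v i' m = 0" by simp
    qed
  next
    assume v: "\<forall>i'<f. \<forall>m<d. i' \<noteq> i \<longrightarrow> co v i' m = 0"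
    show "v \<in> D.comp i" unfolding D.comp_def
    proof (intro CollectI allI co_eqI)
      fix b i' m assume "i' < f" "m < d"
      thus "co (sK D b v) i' m = co (sF D (emb S i b) v) i' m" using v by (cases "i' = i") auto
    qed
  qed
  have e_sum: "(\<Sum>m<n. s (c m) (e i m)) = mk (\<lambda>i' m. if i' = i \<and> m < n then c m else 0)"
    if i: "i < f" and n: "n \<le> d" for i n c
  proof (rule co_eqI)
    fix i' m assume "i' < f" "m < d"
    hence "co (\<Sum>m<n. s (c m) (e i m)) i' m = (\<Sum>m'<n. if i' = i \<and> m = m' then c m' else 0)"
      using i n by (auto simp: co_sum_set intro!: sum.cong)
    also have "\<dots> = (if i' = i \<and> m < n then c m else 0)" by (cases "i' = i") auto
    finally show "co (\<Sum>m<n. s (c m) (e i m)) i' m = co (mk (\<lambda>i' m. if i' = i \<and> m < n then c m else 0)) i' m"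
      using \<open>i' < f\<close> \<open>m < d\<close> by simp
  qed
  have indep: "D.VF.indep_family d (e i)" if i: "i < f" for i
    unfolding D.VF.indep_family_def
  proof (intro allI impI)
    fix c m assume "(\<Sum>l<d. sF D (c l) (e i l)) = 0" "m < d"
    thus "c m = 0" using e_sum[OF i order_refl, of c] co_mk[OF i \<open>m < d\<close>, of "\<lambda>i' m. if i' = i \<and> m < d then c m else 0"]
      co_zero[OF i \<open>m < d\<close>] by simp
  qed
  have r: "m < jump_count d (k i) j \<longleftrightarrow> m < d \<and> j \<le> k i m" if "i < f" for i j m
    using less_jump_count_iff k_decreasing that by blast
  \<comment> \<open>The equation on the right says that the only nonzero coordinates of
    \<open>v\<close> are those in component \<open>i\<close> at the first
    \<open>jump_count d (k i) j\<close> positions.\<close>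
  have Fil_comp: "v \<in> Fil D j \<inter> D.comp i \<longleftrightarrow>
      v = (\<Sum>m<jump_count d (k i) j. s (co v i m) (e i m))" if i: "i < f" for v i j
  proof
    assume v: "v \<in> Fil D j \<inter> D.comp i"
    have "v = mk (\<lambda>i' m. if i' = i \<and> m < jump_count d (k i) j then co v i m else 0)"
    proof (rule co_eqI)
      fix i' m assume "i' < f" "m < d"
      thus "co v i' m = co (mk (\<lambda>i' m. if i' = i \<and> m < jump_count d (k i) j then co v i m else 0)) i' m"
        using v comp_iff[OF i] r[OF i] by (cases "i' = i") auto
    qed
    thus "v = (\<Sum>m<jump_count d (k i) j. s (co v i m) (e i m))"
      unfolding e_sum[OF i jump_count_le] .
  next
    assume "v = (\<Sum>m<jump_count d (k i) j. s (co v i m) (e i m))"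
    hence *: "v = mk (\<lambda>i' m. if i' = i \<and> m < jump_count d (k i) j then co v i m else 0)"
      unfolding e_sum[OF i jump_count_le] .
    have co_v: "co v i' m = (if i' = i \<and> m < jump_count d (k i) j then co v i m else 0)" if "i' < f" "m < d" for i' m
      using arg_cong[OF *, of "\<lambda>v. co v i' m"] that by simp
    have "j \<le> k i' m" if "i' < f" "m < d" "co v i' m \<noteq> 0" for i' m
      using co_v[OF that(1,2)] that(3) r[OF i, of m j] by (auto split: if_splits)
    moreover have "co v i' m = 0" if "i' < f" "m < d" "i' \<noteq> i" for i' m
      using co_v[OF that(1,2)] that(3) by simp
    ultimately show "v \<in> Fil D j \<inter> D.comp i" using comp_iff[OF i] by simp
  qed
  have dim: "D.VF.dim (component S D i (Fil D j)) = jump_count d (k i) j" if i: "i < f" for i j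
  proof -
    have "component S D i (Fil D j) = D.VF.span (e i ` {..<jump_count d (k i) j})"
    proof
      show "component S D i (Fil D j) \<subseteq> D.VF.span (e i ` {..<jump_count d (k i) j})"
      proof
        fix v assume "v \<in> component S D i (Fil D j)"
        hence "v = (\<Sum>m<jump_count d (k i) j. sF D (co v i m) (e i m))"
          using Fil_comp[OF i] unfolding D.component_Fil[OF i] D_simps(1) by blast
        thus "v \<in> D.VF.span (e i ` {..<jump_count d (k i) j})" using D.VF.sum_in_span by metis
      qed
      have "e i ` {..<jump_count d (k i) j} \<subseteq> Fil D j \<inter> D.comp i"
        using r[OF i] i comp_iff[OF i] by (auto split: if_splits)
      thus "D.VF.span (e i ` {..<jump_count d (k i) j}) \<subseteq> component S D i (Fil D j)"
        unfolding D.component_Fil[OF i]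
        by (intro D.VF.span_minimal D.VF.subspace_inter D.subspace_Fil D.subspace_comp)
    qed
    thus ?thesis
      using D.VF.dim_indep_family[OF D.VF.indep_family_mono[OF indep[OF i] jump_count_le]] by metis
  qed
  have hodge: "has_hodge_data S d k D"
    unfolding has_hodge_data_def
  proof (intro allI impI)
    fix i j assume i: "i < f"
    show "int (D.VF.dim (component S D i (Fil D j))) - int (D.VF.dim (component S D i (Fil D (j + 1))))
        = int (card {m. m < d \<and> k i m = j})"
      unfolding dim[OF i] using jump_count_Suc[of d "k i" j] by simp
  qed
  show SDL: "(D, L) \<in> SDL S d k" using strongly_divisible[OF B] hodge by (simp add: SDL_def)
  interpret X: hodge_lattice S D L d k by (rule SDL_hodge_lattice[OF SDL k_decreasing])
  have "adapted_basis S d D L i (e i)" if i: "i < f" for i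
    unfolding X.adapted_basis_iff[OF i]
  proof (intro conjI allI)
    show "D.VF.indep_family d (e i)" by (rule indep[OF i])
    fix j
    let ?r = "jump_count d (k i) j"
    show "Fil D j \<inter> L \<inter> D.comp i = D.VO.Ospan ?r (e i)"
    proof
      show "Fil D j \<inter> L \<inter> D.comp i \<subseteq> D.VO.Ospan ?r (e i)"
      proof
        fix v assume v: "v \<in> Fil D j \<inter> L \<inter> D.comp i"
        hence "v = (\<Sum>m<?r. s (co v i m) (e i m))" using Fil_comp[OF i, of v j] by blast
        moreover have "absF S (co v i m) \<le> 1" if "m < ?r" for m
          using v r[OF i, of m j] that i by (auto simp: L_def)
        ultimately show "v \<in> D.VO.Ospan ?r (e i)" using D.VO.OspanI[of ?r "co v i" "e i"] by simp
      qed
      show "D.VO.Ospan ?r (e i) \<subseteq> Fil D j \<inter> L \<inter> D.comp i"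
      proof (rule D.VO.Ospan_minimal)
        fix m assume m: "m < ?r"
        thus "e i m \<in> Fil D j \<inter> L \<inter> D.comp i"
          using r[OF i, of m j] i comp_iff[OF i] e_in_L by (auto split: if_splits)
      qed (use L_submod D.subspace_comp[of i] D.subspace_Fil[of j] in
          \<open>auto simp: submod_def ringF_def intro: subspace_0 subspace_add subspace_scale simp del: D_simps(3,4)\<close>)
    qed
  qed
  moreover have "phi D (e (prev S i) m) = (\<Sum>l<d. sF D ((A i * \<Delta> i) $$ (l, m)) (e i l))"
    if i: "i < f" and m: "m < d" for i m
  proof (rule co_eqI)
    fix i' l assume il: "i' < f" "l < d"
    have "co (phi D (e (prev S i) m)) i' l = (\<Sum>m'<d. M i' $$ (l, m') * co (e (prev S i) m) (prev S i') m')"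
      using il by simp
    \<comment> \<open>A vector of component \<open>prev S i\<close> has coordinates in component
      \<open>prev S i'\<close> only if \<open>i' = i\<close>, since \<open>prev S\<close> is
      injective.\<close>
    also have "\<dots> = (\<Sum>m'<d. if m' = m then (if i' = i then M i $$ (l, m) else 0) else 0)"
      using m prev_less prev_eq_iff[OF il(1) i] by (intro sum.cong refl) auto
    also have "\<dots> = (if i' = i then M i $$ (l, m) else 0)" using m by simp
    also have "\<dots> = co (\<Sum>l<d. sF D ((A i * \<Delta> i) $$ (l, m)) (e i l)) i' l"
      using e_sum[OF i order_refl, of "\<lambda>l. M i $$ (l, m)"] il by (simp add: M_def)
    finally show "co (phi D (e (prev S i) m)) i' l = co (\<Sum>l<d. sF D ((A i * \<Delta> i) $$ (l, m)) (e i l)) i' l" .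
  qed
  ultimately show "presented_by S d k A (D, L)"
    unfolding presented_by_def prod.case by (intro exI[of _ e]) blast
qed

end

text \<open>Any basis of size \<open>a * b\<close> can be arranged as a grid; with
  \<open>a = f\<close> and \<open>b = d\<close> its rows become the components of the standard
  module.\<close>

lemma (in lin_space) grid_coordinates:
  assumes B: "finite B" "card B = a * b" "independent B" "span B = UNIV"
  shows "\<exists>e co. (\<forall>v. (\<Sum>i<a. \<Sum>m<b. scale (co v i m) (e i m)) = v) \<and>
    (\<forall>c. \<forall>i<a. \<forall>m<b. co (\<Sum>i<a. \<Sum>m<b. scale (c i m) (e i m)) i m = c i m)"
proof -
  let ?I = "{..<a} \<times> {..<b}"
  obtain \<beta> where \<beta>: "bij_betw \<beta> ?I B"
    using finite_same_card_bij[of ?I B] B by auto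
  define e where "e i m = \<beta> (i, m)" for i m
  have sum_eq: "(\<Sum>x\<in>B. scale (u x) x) = (\<Sum>i<a. \<Sum>m<b. scale (u (e i m)) (e i m))" for u
    using sum.reindex_bij_betw[OF \<beta>, of "\<lambda>x. scale (u x) x", symmetric]
    by (simp add: e_def sum.cartesian_product case_prod_beta)
  have "\<exists>c. (\<Sum>i<a. \<Sum>m<b. scale (c i m) (e i m)) = v" for v
  proof -
    have "v \<in> span B" using B by simp
    then obtain u where "v = (\<Sum>x\<in>B. scale (u x) x)" using span_finite[OF B(1)] by auto
    thus ?thesis using sum_eq[of u] by (intro exI[of _ "\<lambda>i m. u (e i m)"]) simp
  qed
  then obtain co where co: "\<And>v. (\<Sum>i<a. \<Sum>m<b. scale (co v i m) (e i m)) = v" by metis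
  have uniq: "c i m = c' i m"
    if eq: "(\<Sum>i<a. \<Sum>m<b. scale (c i m) (e i m)) = (\<Sum>i<a. \<Sum>m<b. scale (c' i m) (e i m))"
      and im: "i < a" "m < b" for c c' i m
  proof -
    define u where "u x = (case inv_into ?I \<beta> x of (i, m) \<Rightarrow> c i m - c' i m)" for x
    have u: "u (e i m) = c i m - c' i m" if "i < a" "m < b" for i m
      using that \<beta> by (simp add: u_def e_def bij_betw_def)
    have "(\<Sum>x\<in>B. scale (u x) x) = (\<Sum>i<a. \<Sum>m<b. scale (c i m - c' i m) (e i m))"
      unfolding sum_eq using u by (intro sum.cong) auto
    also have "\<dots> = 0" using eq by (simp add: scale_left_diff_distrib sum_subtractf)
    finally have "u (e i m) = 0"
      using independentD[OF B(3,1) order_refl] \<beta> im by (auto simp: e_def bij_betw_def)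
    thus ?thesis using u[OF im] by simp
  qed
  have "co (\<Sum>i<a. \<Sum>m<b. scale (c i m) (e i m)) i m = c i m" if "i < a" "m < b" for c i m
    using uniq[OF co that] .
  thus ?thesis using co by (intro exI[of _ e] exI[of _ co]) auto
qed

text \<open>The hypothesis \<open>carrier_type\<close> lets the type \<open>'v\<close> carry modules
  of dimension \<open>f * d\<close> over \<open>F\<close>. That \<open>Theta\<close> is induced by
  the assignment on tuples is expressed by two conjuncts: every tuple presents some lattice, and its
  class goes to the isomorphism class of any lattice it presents.\<close>

theorem theorem3p8:
  fixes S :: "('q::field_char_0, 'a::field, 'k::field) coeff_data"
    and d :: nat
    and k :: "nat \<Rightarrow> nat \<Rightarrow> int"
  assumes datum: "coeff_datum S"
    and decreasing: "\<forall>i<res_deg S. \<forall>m n. m \<le> n \<and> n < d \<longrightarrow> k i n \<le> k i m"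
    and nonneg: "\<forall>i<res_deg S. \<forall>m<d. 0 \<le> k i m"
    and carrier_type: "\<exists>(s :: 'a \<Rightarrow> 'v::ab_group_add \<Rightarrow> 'v) B.
      Vector_Spaces.vector_space s \<and> finite B \<and> card B = res_deg S * d \<and>
      \<not> Modules.module.dependent s B \<and> Modules.module.span s B = UNIV"
  shows "equiv (GLO_tuples S d) (sim S d k)
    \<and> equiv (SDL S d k :: (('a, 'k, 'v) fil_phi_module \<times> 'v set) set) (iso_rel S d k)
    \<and> (\<forall>A \<in> GLO_tuples S d. \<exists>X \<in> (SDL S d k :: (('a, 'k, 'v) fil_phi_module \<times> 'v set) set).
         presented_by S d k A X)
    \<and> (\<forall>A \<in> GLO_tuples S d. \<forall>X \<in> (SDL S d k :: (('a, 'k, 'v) fil_phi_module \<times> 'v set) set).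
         presented_by S d k A X \<longrightarrow> Theta S d k (sim S d k `` {A}) = iso_rel S d k `` {X})
    \<and> bij_betw (Theta S d k)
         (GLO_tuples S d // sim S d k)
         ((SDL S d k :: (('a, 'k, 'v) fil_phi_module \<times> 'v set) set) // iso_rel S d k)"
proof -
  interpret coeff_ring S by unfold_locales (rule datum)
  have k: "\<forall>i<f. decreasing_upto d (k i)" using decreasing by (simp add: decreasing_upto_def)
  obtain s :: "'a \<Rightarrow> 'v \<Rightarrow> 'v" and B where s: "Vector_Spaces.vector_space s"
    and B: "finite B" "card B = f * d" "\<not> Modules.module.dependent s B" "Modules.module.span s B = UNIV"
    using carrier_type by blast
  interpret lin_space s using s by (rule lin_space.intro)
  obtain e co where e: "\<And>v. (\<Sum>i<f. \<Sum>m<d. s (co v i m) (e i m)) = v"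
    "\<And>c i m. i < f \<Longrightarrow> m < d \<Longrightarrow> co (\<Sum>i<f. \<Sum>m<d. s (c i m) (e i m)) i m = c i m"
    using grid_coordinates[OF B] by blast
  have ex: "\<exists>X \<in> (SDL S d k :: (('a, 'k, 'v) fil_phi_module \<times> 'v set) set). presented_by S d k A X"
    if A: "A \<in> GLO_tuples S d" for A
  proof -
    interpret standard_lattice S s d k A e co
      using k nonneg A e by unfold_locales auto
    show ?thesis using presents[OF B(1,4)] by blast
  qed
  show ?thesis
    using equiv_sim[OF k] iso_rel_equiv[OF k] ex Theta_class[OF k nonneg] Theta_bij[OF k nonneg ex]
    by blast
qed

end
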